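(* Let $(\Omega,\mathcal E,\mathbb P)$ be a probability space and $\mathcal F\subset\mathcal E$ a sub-$\sigma$-algebra. Let $(\phi,\psi)$ be Young conjugate functions with $\phi$ finite-valued and $\rho:H^\phi_{\mathcal F}(\mathcal E)\to L^0(\mathcal F)$ a conditional risk measure. Then $\rho$ has the Lebesgue property, and for every $x\in H^\phi_{\mathcal F}(\mathcal E)$ there exists $y\in L^\psi_{\mathcal F}(\mathcal E)$ with $y\le0$ and $\mathbb E_{\mathbb P}[y|\mathcal F]=-1$ such that $$\rho(x)=\mathbb E_{\mathbb P}[xy|\mathcal F]-\rho^\#(y).$$
   Context: $L^0(\mathcal E)$ is the space of real-valued $\mathcal E$-measurable random variables modulo a.s. equality, ordered by a.s. inequality; $L^0(\mathcal F)$ is defined likewise; $L^0_{++}(\mathcal F)$ and $\overline{L^0}(\mathcal F)$ denote the classes of $\mathcal F$-measurable random variables with values in $(0,\infty)$ and $[-\infty,\infty]$. Suprema of families in $\overline{L^0}(\mathcal F)$ are essential suprema. The extended conditional expectation is $\mathbb E_{\mathbb P}[x|\mathcal F]:=\lim_n\mathbb E_{\mathbb P}[x^+\wedge n|\mathcal F]-\lim_n\mathbb E_{\mathbb P}[x^-\wedge n|\mathcal F]\in\overline{L^0}(\mathcal F)$ whenever at least one of the limits is finite. A Young function is an increasing left-continuous convex function $\phi:[0,\infty)\to[0,\infty]$, finite on a neighborhood of $0$, with $\phi(0)=0$, $\lim_{r\to\infty}\phi(r)=\infty$; its conjugate is $\psi(r):=\sup_{s\ge0}\{rs-\phi(s)\}$.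 $L^\psi_{\mathcal F}(\mathcal E):=\{x\in L^0(\mathcal E):\exists\eta\in L^0_{++}(\mathcal F),\ \mathbb E_{\mathbb P}[\psi(\eta|x|)|\mathcal F]\in L^0(\mathcal F)\}$ and $H^\phi_{\mathcal F}(\mathcal E):=\{x\in L^0(\mathcal E):\forall\eta\in L^0_{++}(\mathcal F),\ \mathbb E_{\mathbb P}[\phi(\eta|x|)|\mathcal F]\in L^0(\mathcal F)\}$. $L^1_{\mathcal F}(\mathcal E):=\{x\in L^0(\mathcal E):\mathbb E_{\mathbb P}[|x||\mathcal F]<\infty\}$. Write $\mathscr X:=H^\phi_{\mathcal F}(\mathcal E)$. A *conditional risk measure* is $\rho:\mathscr X\to L^0(\mathcal F)$ with: $\rho(\eta x+(1-\eta)y)\le\eta\rho(x)+(1-\eta)\rho(y)$ for $\eta\in L^0(\mathcal F)$, $0\le\eta\le1$, $x,y\in\mathscr X$; $x\le y$ implies $\rho(y)\le\rho(x)$; $\rho(x+\eta)=\rho(x)-\eta$ for $\eta\in L^0(\mathcal F)$, $x\in\mathscr X$. Fenchel transform: $\rho^\#(y):=\sup\{\mathbb E_{\mathbb P}[xy|\mathcal F]-\rho(x):x\in\mathscr X\}\in\overline{L^0}(\mathcal F)$ for $y$ in the Köthe dual module $\mathscr X^\#:=\{y\in L^0(\mathcal E):xy\in L^1_{\mathcal F}(\mathcal E)\ \forall x\in\mathscr X\}$, which is $L^\psi_{\mathcal F}(\mathcal E)$. Lebesgue property: $\lim_nx_n=x$ a.s. ($x_n,x\in\mathscr X$), $y\in\mathscr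 X$, $|x_n|\le y$ for all $n$ imply $\lim_n\rho(x_n)=\rho(x)$ a.s. *)

theory Defs
  imports "HOL-Probability.Probability"
begin

text \<open>
  The \<open>\<sigma>\<close>-algebra of events and the probability measure are carried by \<^term>\<open>M\<close>; \<^term>\<open>F\<close> is a
  sub-\<open>\<sigma>\<close>-algebra of \<^term>\<open>M\<close> in the sense of \<^const>\<open>subalgebra\<close>. Elements of the spaces
  \<open>L\<^sup>0\<close> are represented by measurable functions; equality, order and convergence of classes
  are the almost sure ones with respect to \<^term>\<open>M\<close>.
\<close>

definition L0 :: "'a measure \<Rightarrow> ('a \<Rightarrow> real) set" where
  "L0 N = borel_measurable N"

text \<open>
  Positivity is imposed everywhere, not just almost surely, so that Young functions below are
  never evaluated at negative arguments, where nothing (not even measurability) is assumed.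
\<close>

definition L0_pos :: "'a measure \<Rightarrow> ('a \<Rightarrow> real) set" where
  "L0_pos N = {\<eta> \<in> L0 N. \<forall>\<omega>\<in>space N. 0 < \<eta> \<omega>}"

text \<open>
  Extended conditional expectation. The truncations are bounded random variables, so
  \<^const>\<open>real_cond_exp\<close> applies to them, and the limits exist almost surely by monotonicity.
  The value is meaningful only when at least one of the two limits is finite
  (for type \<^typ>\<open>ereal\<close>, \<open>\<infinity> - \<infinity> = \<infinity>\<close>). The argument is extended real-valued because the
  conjugate of a finite Young function may take the value \<open>\<infinity>\<close>.
\<close>

definition cond_exp_pos :: "'a measure \<Rightarrow> 'a measure \<Rightarrow> ('a \<Rightarrow> ereal) \<Rightarrow> 'a \<Rightarrow> ereal" where
  "cond_exp_pos M F x \<omega> =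
     lim (\<lambda>n::nat. ereal (real_cond_exp M F
            (\<lambda>w. real_of_ereal (min (max (x w) 0) (ereal (real n)))) \<omega>))"

definition ext_cond_exp :: "'a measure \<Rightarrow> 'a measure \<Rightarrow> ('a \<Rightarrow> ereal) \<Rightarrow> 'a \<Rightarrow> ereal" where
  "ext_cond_exp M F x \<omega> = cond_exp_pos M F x \<omega> - cond_exp_pos M F (\<lambda>w. - x w) \<omega>"

text \<open>Only the values on \<open>[0,\<infinity>)\<close> of a Young function are relevant.\<close>

definition young_function :: "(real \<Rightarrow> ereal) \<Rightarrow> bool" where
  "young_function \<phi> \<longleftrightarrow>
     (\<forall>r\<ge>0. 0 \<le> \<phi> r) \<and>
     mono_on {0..} \<phi> \<and>
     (\<forall>r>0. (\<phi> \<longlongrightarrow> \<phi> r) (at_left r)) \<and>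
     (\<forall>r\<ge>0. \<forall>s\<ge>0. \<forall>t\<in>{0..1}.
        \<phi> (t * r + (1 - t) * s) \<le> ereal t * \<phi> r + ereal (1 - t) * \<phi> s) \<and>
     (\<exists>\<delta>>0. \<forall>r. 0 \<le> r \<and> r < \<delta> \<longrightarrow> \<phi> r < \<infinity>) \<and>
     \<phi> 0 = 0 \<and>
     (\<phi> \<longlongrightarrow> \<infinity>) at_top"

definition young_conjugate_pair :: "(real \<Rightarrow> ereal) \<Rightarrow> (real \<Rightarrow> ereal) \<Rightarrow> bool" where
  "young_conjugate_pair \<phi> \<psi> \<longleftrightarrow>
     young_function \<phi> \<and> (\<forall>r\<ge>0. \<psi> r = (SUP s\<in>{0..}. ereal (r * s) - \<phi> s))"

definition cond_exp_in_L0 :: "'a measure \<Rightarrow> 'a measure \<Rightarrow> ('a \<Rightarrow> ereal) \<Rightarrow> bool" where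
  "cond_exp_in_L0 M F u \<longleftrightarrow> (\<exists>z\<in>L0 F. AE \<omega> in M. ext_cond_exp M F u \<omega> = ereal (z \<omega>))"

definition cond_orlicz_space ::
  "'a measure \<Rightarrow> 'a measure \<Rightarrow> (real \<Rightarrow> ereal) \<Rightarrow> ('a \<Rightarrow> real) set" where
  "cond_orlicz_space M F \<psi> =
     {x \<in> L0 M. \<exists>\<eta>\<in>L0_pos F. cond_exp_in_L0 M F (\<lambda>w. \<psi> (\<eta> w * \<bar>x w\<bar>))}"

definition cond_orlicz_heart ::
  "'a measure \<Rightarrow> 'a measure \<Rightarrow> (real \<Rightarrow> ereal) \<Rightarrow> ('a \<Rightarrow> real) set" where
  "cond_orlicz_heart M F \<phi> =
     {x \<in> L0 M. \<forall>\<eta>\<in>L0_pos F. cond_exp_in_L0 M F (\<lambda>w. \<phi> (\<eta> w * \<bar>x w\<bar>))}"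

text \<open>
  Monotonicity with respect to the almost sure order forces \<^term>\<open>\<rho>\<close> to respect almost sure
  equality, so \<^term>\<open>\<rho>\<close> is a well-defined map on equivalence classes.
\<close>

definition conditional_risk_measure ::
  "'a measure \<Rightarrow> 'a measure \<Rightarrow> ('a \<Rightarrow> real) set \<Rightarrow> (('a \<Rightarrow> real) \<Rightarrow> ('a \<Rightarrow> real)) \<Rightarrow> bool" where
  "conditional_risk_measure M F X \<rho> \<longleftrightarrow>
     (\<forall>x\<in>X. \<rho> x \<in> L0 F) \<and>
     (\<forall>\<eta>\<in>L0 F. \<forall>x\<in>X. \<forall>y\<in>X. (AE \<omega> in M. 0 \<le> \<eta> \<omega> \<and> \<eta> \<omega> \<le> 1) \<longrightarrow>
        (AE \<omega> in M. \<rho> (\<lambda>w. \<eta> w * x w + (1 - \<eta> w) * y w) \<omega>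
                      \<le> \<eta> \<omega> * \<rho> x \<omega> + (1 - \<eta> \<omega>) * \<rho> y \<omega>)) \<and>
     (\<forall>x\<in>X. \<forall>y\<in>X. (AE \<omega> in M. x \<omega> \<le> y \<omega>) \<longrightarrow> (AE \<omega> in M. \<rho> y \<omega> \<le> \<rho> x \<omega>)) \<and>
     (\<forall>\<eta>\<in>L0 F. \<forall>x\<in>X. AE \<omega> in M. \<rho> (\<lambda>w. x w + \<eta> w) \<omega> = \<rho> x \<omega> - \<eta> \<omega>)"

definition lebesgue_property ::
  "'a measure \<Rightarrow> ('a \<Rightarrow> real) set \<Rightarrow> (('a \<Rightarrow> real) \<Rightarrow> ('a \<Rightarrow> real)) \<Rightarrow> bool" where
  "lebesgue_property M X \<rho> \<longleftrightarrow>
     (\<forall>xs x y. (\<forall>n::nat. xs n \<in> X) \<and> x \<in> X \<and> y \<in> X \<and>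
        (AE \<omega> in M. (\<lambda>n. xs n \<omega>) \<longlonglongrightarrow> x \<omega>) \<and>
        (\<forall>n. AE \<omega> in M. \<bar>xs n \<omega>\<bar> \<le> y \<omega>) \<longrightarrow>
        (AE \<omega> in M. (\<lambda>n. \<rho> (xs n) \<omega>) \<longlonglongrightarrow> \<rho> x \<omega>))"

definition is_family_esssup ::
  "'a measure \<Rightarrow> 'a measure \<Rightarrow> ('a \<Rightarrow> ereal) set \<Rightarrow> ('a \<Rightarrow> ereal) \<Rightarrow> bool" where
  "is_family_esssup M F A g \<longleftrightarrow>
     g \<in> borel_measurable F \<and>
     (\<forall>f\<in>A. AE \<omega> in M. f \<omega> \<le> g \<omega>) \<and>
     (\<forall>h\<in>borel_measurable F. (\<forall>f\<in>A. AE \<omega> in M. f \<omega> \<le> h \<omega>) \<longrightarrow> (AE \<omega> in M. g \<omega> \<le> h \<omega>))"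

text \<open>
  Essential suprema are unique up to almost sure equality; the choice operator only selects
  a representative.
\<close>

definition family_esssup ::
  "'a measure \<Rightarrow> 'a measure \<Rightarrow> ('a \<Rightarrow> ereal) set \<Rightarrow> 'a \<Rightarrow> ereal" where
  "family_esssup M F A = (SOME g. is_family_esssup M F A g)"

definition L1_cond :: "'a measure \<Rightarrow> 'a measure \<Rightarrow> ('a \<Rightarrow> real) set" where
  "L1_cond M F = {x \<in> L0 M. AE \<omega> in M. ext_cond_exp M F (\<lambda>w. ereal \<bar>x w\<bar>) \<omega> < \<infinity>}"

definition koethe_dual :: "'a measure \<Rightarrow> 'a measure \<Rightarrow> ('a \<Rightarrow> real) set \<Rightarrow> ('a \<Rightarrow> real) set" where
  "koethe_dual M F X = {y \<in> L0 M. \<forall>x\<in>X. (\<lambda>w. x w * y w) \<in> L1_cond M F}"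

text \<open>
  The transform is meant for \<^term>\<open>y \<in> koethe_dual M F X\<close>, where all the conditional
  expectations below are almost surely finite. The conditional Orlicz space of the conjugate
  Young function is the Koethe dual of the conditional Orlicz heart.
\<close>

definition fenchel_transform ::
  "'a measure \<Rightarrow> 'a measure \<Rightarrow> ('a \<Rightarrow> real) set \<Rightarrow> (('a \<Rightarrow> real) \<Rightarrow> ('a \<Rightarrow> real)) \<Rightarrow>
   ('a \<Rightarrow> real) \<Rightarrow> 'a \<Rightarrow> ereal" where
  "fenchel_transform M F X \<rho> y =
     family_esssup M F
       ((\<lambda>x. \<lambda>\<omega>. ext_cond_exp M F (\<lambda>w. ereal (x w * y w)) \<omega> - ereal (\<rho> x \<omega>)) ` X)"

end

theory Submission
  imports Defs
begin

text \<open>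
  The Lebesgue property is automatic: a convex monotone map that is finite on the whole heart
  cannot jump along a null sequence, by a gliding hump argument. For the dual representation at
  \<open>x\<close>, put \<open>D u = \<rho> (x + u) - \<rho> x\<close>. A linear functional on the bounded random variables below
  \<open>u \<mapsto> E[D u]\<close> exists by the scalar Hahn--Banach theorem, and the Lebesgue property makes it
  \<open>\<sigma>\<close>-additive, so Radon--Nikodym gives a density \<open>y = - g\<close>. Testing with \<open>indicator A * u\<close> for
  \<open>A \<in> F\<close> turns \<open>E[u * y] \<le> E[D u]\<close> into \<open>E[u * y | F] \<le> D u\<close>, and truncation carries this over
  to the whole heart; hence the supremum in the Fenchel transform of \<open>y\<close> is attained at \<open>x\<close>.
  That \<open>y\<close> lies in the Orlicz space of \<open>\<psi>\<close> follows from \<open>E[\<bar>u\<bar> * g | F] < \<infinity>\<close> for all \<open>u\<close> in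
  the heart by a second gliding hump.
\<close>

section \<open>Extended conditional expectations\<close>

text \<open>For a general \<open>u\<close> in the heart the increment \<open>D u\<close> is finite
  but need not be integrable. This is why the scalar functional lives on bounded functions only,
  where cash invariance gives \<open>\<bar>D u\<bar> \<le> c\<close> whenever
  \<open>\<bar>u\<bar> \<le> c\<close>. On the way back to the heart the products
  \<open>u * y\<close> are again only conditionally integrable; conditional expectations are
  therefore handled through \<open>nn_cond_exp\<close>, which exists without integrability, and real
  values appear once finiteness is known. The same defect obstructs the gliding humps. They compare
  integrals, for countably many multipliers at once, whereas the data only give at each point some
  bound or index that depends on the point. Both arguments first shrink the bad set to a
  nonnegligible part on which countably many such requirements hold with constants
  (\<open>uniform_exhaustion\<close>) and then use one construction of upper bounds in the heart
  (\<open>heart_dominating\<close>). In the first argument the locality of \<open>\<rho>\<close> on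
  sets of \<open>F\<close> makes the shrinking harmless; in the second the estimates are
  pointwise.\<close>

context sigma_finite_subalgebra
begin

text \<open>Monotone convergence, applied before and after conditioning, shows that both sides have
  the same integral over every set of \<open>F\<close>. The sequence only has to increase a.s.,
  which is all that conditional expectations do.\<close>

lemma nn_cond_exp_SUP:
  assumes [measurable]: "\<And>n::nat. f n \<in> borel_measurable M"
    and inc: "\<And>n. AE x in M. f n x \<le> f (Suc n) x"
  shows "AE x in M. nn_cond_exp M F (\<lambda>x. SUP n. f n x) x = (SUP n. nn_cond_exp M F (f n) x)"
proof -
  have "AE x in M. (SUP n. nn_cond_exp M F (f n) x) = nn_cond_exp M F (\<lambda>x. SUP n. f n x) x"
  proof (rule nn_cond_exp_charact)
    fix A assume A [measurable]: "A \<in> sets F"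
    have AM [measurable]: "A \<in> sets M" using A subalg unfolding subalgebra_def by auto
    have inc': "AE x in M. nn_cond_exp M F (f n) x \<le> nn_cond_exp M F (f (Suc n)) x" for n
      by (rule nn_cond_exp_mono) (auto simp: inc)
    have "(\<integral>\<^sup>+ x \<in> A. (SUP n. f n x) \<partial>M) = (\<integral>\<^sup>+ x. (SUP n. f n x * indicator A x) \<partial>M)"
      by (simp add: SUP_mult_right_ennreal)
    also have "\<dots> = (SUP n. (\<integral>\<^sup>+ x. f n x * indicator A x \<partial>M))"
    proof (rule nn_integral_monotone_convergence_SUP_AE)
      show "AE x in M. f i x * indicator A x \<le> f (Suc i) x * indicator A x" for i
        using inc[of i] by eventually_elim (simp add: mult_right_mono)
    qed simp
    also have "\<dots> = (SUP n. (\<integral>\<^sup>+ x. nn_cond_exp M F (f n) x * indicator A x \<partial>M))"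
    proof (rule SUP_cong)
      fix n
      have "(\<integral>\<^sup>+ x. indicator A x * nn_cond_exp M F (f n) x \<partial>M) = (\<integral>\<^sup>+ x. indicator A x * f n x \<partial>M)"
        by (rule nn_cond_exp_intg) auto
      then show "(\<integral>\<^sup>+ x. f n x * indicator A x \<partial>M) = (\<integral>\<^sup>+ x. nn_cond_exp M F (f n) x * indicator A x \<partial>M)"
        by (simp add: mult.commute)
    qed simp
    also have "\<dots> = (\<integral>\<^sup>+ x. (SUP n. nn_cond_exp M F (f n) x * indicator A x) \<partial>M)"
    proof (rule nn_integral_monotone_convergence_SUP_AE[symmetric])
      show "AE x in M. nn_cond_exp M F (f i) x * indicator A x \<le> nn_cond_exp M F (f (Suc i)) x * indicator A x" for i
        using inc'[of i] by eventually_elim (simp add: mult_right_mono)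
    qed simp
    also have "\<dots> = (\<integral>\<^sup>+ x \<in> A. (SUP n. nn_cond_exp M F (f n) x) \<partial>M)"
      by (simp add: SUP_mult_right_ennreal)
    finally show "(\<integral>\<^sup>+ x \<in> A. (SUP n. f n x) \<partial>M) = (\<integral>\<^sup>+ x \<in> A. (SUP n. nn_cond_exp M F (f n) x) \<partial>M)" .
  qed auto
  then show ?thesis by eventually_elim simp
qed

text \<open>Locality: the indicator of \<open>A\<close> is \<open>F\<close>-measurable and moves
  through the conditional expectation. It serves to glue estimates along countable covers by sets of
  \<open>F\<close>.\<close>

lemma nn_cond_exp_mono_on:
  assumes A: "A \<in> sets F" and le: "AE x in M. x \<in> A \<longrightarrow> f x \<le> g x"
    and [measurable]: "f \<in> borel_measurable M" "g \<in> borel_measurable M"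
  shows "AE x in M. x \<in> A \<longrightarrow> nn_cond_exp M F f x \<le> nn_cond_exp M F g x"
proof -
  have [measurable]: "A \<in> sets F" "A \<in> sets M" using A subalg unfolding subalgebra_def by auto
  have 1: "AE x in M. indicator A x * nn_cond_exp M F f x = nn_cond_exp M F (\<lambda>x. indicator A x * f x) x"
    by (rule nn_cond_exp_prod) auto
  have 2: "AE x in M. indicator A x * nn_cond_exp M F g x = nn_cond_exp M F (\<lambda>x. indicator A x * g x) x"
    by (rule nn_cond_exp_prod) auto
  have 3: "AE x in M. nn_cond_exp M F (\<lambda>x. indicator A x * f x) x \<le> nn_cond_exp M F (\<lambda>x. indicator A x * g x) x"
  proof (rule nn_cond_exp_mono)
    show "AE x in M. indicator A x * f x \<le> indicator A x * g x"
      using le by eventually_elim (auto simp: indicator_def)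
  qed auto
  from 1 2 3 show ?thesis
  proof eventually_elim
    case (elim x)
    show ?case
    proof
      assume "x \<in> A"
      with elim show "nn_cond_exp M F f x \<le> nn_cond_exp M F g x" by (auto simp: indicator_def)
    qed
  qed
qed

lemma nn_cond_exp_finite:
  assumes [measurable]: "f \<in> borel_measurable M" and fin: "(\<integral>\<^sup>+ x. f x \<partial>M) < \<infinity>"
  shows "AE x in M. nn_cond_exp M F f x < \<infinity>"
proof -
  have "(\<integral>\<^sup>+ x. 1 * nn_cond_exp M F f x \<partial>M) = (\<integral>\<^sup>+ x. 1 * f x \<partial>M)"
    by (rule nn_cond_exp_intg) auto
  then have "AE x in M. nn_cond_exp M F f x \<noteq> \<infinity>"
    using fin by (intro nn_integral_PInf_AE) auto
  then show ?thesis by eventually_elim (simp add: top.not_eq_extremum)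
qed

lemma nn_cond_exp_zero: "AE x in M. nn_cond_exp M F (\<lambda>_. 0) x = 0"
  using nn_cond_exp_F_meas[of "\<lambda>_. 0", OF borel_measurable_const] by eventually_elim simp

text \<open>\<open>real_cond_exp\<close> is the difference of the \<open>nn_cond_exp\<close> of the
  positive and of the negative part, and the latter vanishes here. Since only a.s. finiteness is
  asked for, \<open>f\<close> may fail to be integrable.\<close>

lemma nn_cond_exp_eq_real:
  assumes [measurable]: "f \<in> borel_measurable M" and f: "AE x in M. 0 \<le> f x"
    and fin: "AE x in M. nn_cond_exp M F (\<lambda>x. ennreal (f x)) x < \<infinity>"
  shows "AE x in M. nn_cond_exp M F (\<lambda>x. ennreal (f x)) x = ennreal (real_cond_exp M F f x)
    \<and> 0 \<le> real_cond_exp M F f x"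
proof -
  have "AE x in M. nn_cond_exp M F (\<lambda>x. ennreal (- f x)) x = nn_cond_exp M F (\<lambda>_. 0) x"
  proof (rule nn_cond_exp_cong)
    show "AE x in M. ennreal (- f x) = 0" using f by eventually_elim (simp add: ennreal_neg)
  qed auto
  with fin nn_cond_exp_zero show ?thesis
    by eventually_elim (simp add: real_cond_exp_def)
qed

lemma real_cond_exp_nonneg_bounded:
  assumes [measurable]: "f \<in> borel_measurable M"
    and f: "AE x in M. 0 \<le> f x \<and> f x \<le> c"
  shows "AE x in M. ereal (real_cond_exp M F f x) = enn2ereal (nn_cond_exp M F (\<lambda>x. ennreal (f x)) x)"
proof -
  have 1: "AE x in M. nn_cond_exp M F (\<lambda>x. ennreal (f x)) x \<le> nn_cond_exp M F (\<lambda>x. ennreal c) x"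
  proof (rule nn_cond_exp_mono)
    show "AE x in M. ennreal (f x) \<le> ennreal c" using f by eventually_elim (simp add: ennreal_leI)
  qed auto
  have 2: "AE x in M. ennreal c = nn_cond_exp M F (\<lambda>x. ennreal c) x"
    by (rule nn_cond_exp_F_meas) auto
  have "AE x in M. nn_cond_exp M F (\<lambda>x. ennreal (f x)) x < \<infinity>"
    using 1 2 by eventually_elim (metis ennreal_less_top infinity_ennreal_def order.strict_trans1)
  then have "AE x in M. nn_cond_exp M F (\<lambda>x. ennreal (f x)) x = ennreal (real_cond_exp M F f x)
    \<and> 0 \<le> real_cond_exp M F f x"
    using f by (intro nn_cond_exp_eq_real) auto
  then show ?thesis by eventually_elim simp
qed

text \<open>The truncations increase to the positive part, so the limit in the definition is a.s. a
  supremum and conditional monotone convergence applies. \<open>e2ennreal\<close> sends negative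
  values to 0 and thereby takes the positive part.\<close>

lemma cond_exp_pos_eq:
  assumes [measurable]: "u \<in> borel_measurable M"
  shows "AE x in M. cond_exp_pos M F u x = enn2ereal (nn_cond_exp M F (\<lambda>w. e2ennreal (u w)) x)"
proof -
  define f where "f = (\<lambda>(n::nat) w. real_of_ereal (min (max (u w) 0) (ereal (real n))))"
  have [measurable]: "f n \<in> borel_measurable M" for n unfolding f_def by measurable
  have fe: "ereal (f n w) = min (max (u w) 0) (ereal (real n))" for n w
    unfolding f_def by (cases "u w") (auto simp: min_def max_def)
  have fb: "0 \<le> f n w \<and> f n w \<le> real n" for n w
    using fe[of n w] by (metis ereal_less_eq(3) max.cobounded2 min.bounded_iff min.cobounded2 of_nat_0_le_iff zero_ereal_def)
  have fennr: "ennreal (f n w) = e2ennreal (min (max (u w) 0) (ereal (real n)))" for n w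
    by (simp add: fe[symmetric])
  have inc: "f n w \<le> f (Suc n) w" for n w
  proof -
    have "ereal (f n w) \<le> ereal (f (Suc n) w)" unfolding fe by (intro min.mono) auto
    then show ?thesis by simp
  qed
  have sup: "(SUP n. ennreal (f n w)) = e2ennreal (u w)" for w
  proof (rule antisym)
    show "(SUP n. ennreal (f n w)) \<le> e2ennreal (u w)"
    proof (rule SUP_least)
      fix n
      have "ennreal (f n w) \<le> e2ennreal (max (u w) 0)" unfolding fennr by (intro e2ennreal_mono) simp
      also have "\<dots> = e2ennreal (u w)" by (auto simp: max_def e2ennreal_neg)
      finally show "ennreal (f n w) \<le> e2ennreal (u w)" .
    qed
    show "e2ennreal (u w) \<le> (SUP n. ennreal (f n w))"
    proof (cases "u w")
      case (real r)
      obtain n :: nat where "r \<le> real n" using real_arch_simple by blast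
      then have "ennreal (f n w) = e2ennreal (u w)"
        using real by (cases "r \<ge> 0") (auto simp: f_def min_def max_def ennreal_neg)
      then show ?thesis by (metis SUP_upper UNIV_I)
    next
      case PInf
      then have "f n w = real n" for n by (auto simp: f_def min_def)
      then have "(SUP n. ennreal (f n w)) = (SUP n. of_nat n)" by (simp add: ennreal_of_nat_eq_real_of_nat)
      then show ?thesis by (simp only: ennreal_SUP_of_nat_eq_top top_greatest)
    next
      case MInf
      then show ?thesis by (simp add: e2ennreal_neg)
    qed
  qed
  have A: "AE x in M. \<forall>n. ereal (real_cond_exp M F (f n) x) = enn2ereal (nn_cond_exp M F (\<lambda>x. ennreal (f n x)) x)"
    unfolding AE_all_countable
  proof
    show "AE x in M. ereal (real_cond_exp M F (f n) x) = enn2ereal (nn_cond_exp M F (\<lambda>x. ennreal (f n x)) x)" for n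
      by (rule real_cond_exp_nonneg_bounded[where c = "real n"]) (use fb in auto)
  qed
  have B: "AE x in M. nn_cond_exp M F (\<lambda>x. SUP n. ennreal (f n x)) x = (SUP n. nn_cond_exp M F (\<lambda>x. ennreal (f n x)) x)"
    by (rule nn_cond_exp_SUP) (auto intro!: AE_I2 ennreal_leI inc)
  have C: "AE x in M. \<forall>n. nn_cond_exp M F (\<lambda>x. ennreal (f n x)) x \<le> nn_cond_exp M F (\<lambda>x. ennreal (f (Suc n) x)) x"
    unfolding AE_all_countable by (intro allI nn_cond_exp_mono AE_I2 ennreal_leI inc) auto
  from A B C show ?thesis
  proof eventually_elim
    case (elim x)
    have "incseq (\<lambda>n. nn_cond_exp M F (\<lambda>x. ennreal (f n x)) x)" using elim(3) by (auto intro: incseq_SucI)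
    then have "(\<lambda>n. nn_cond_exp M F (\<lambda>x. ennreal (f n x)) x) \<longlonglongrightarrow> nn_cond_exp M F (\<lambda>w. e2ennreal (u w)) x"
      using elim(2) LIMSEQ_SUP unfolding sup by metis
    then have "(\<lambda>n. enn2ereal (nn_cond_exp M F (\<lambda>x. ennreal (f n x)) x)) \<longlonglongrightarrow> enn2ereal (nn_cond_exp M F (\<lambda>w. e2ennreal (u w)) x)"
      by (rule isCont_tendsto_compose[OF continuous_at_enn2ereal])
    then have "(\<lambda>n. ereal (real_cond_exp M F (f n) x)) \<longlonglongrightarrow> enn2ereal (nn_cond_exp M F (\<lambda>w. e2ennreal (u w)) x)"
      using elim(1) by simp
    then show ?case unfolding cond_exp_pos_def f_def by (rule limI)
  qed
qed

lemma ext_cond_exp_eq: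
  assumes [measurable]: "u \<in> borel_measurable M"
  shows "AE x in M. ext_cond_exp M F u x =
    enn2ereal (nn_cond_exp M F (\<lambda>w. e2ennreal (u w)) x) - enn2ereal (nn_cond_exp M F (\<lambda>w. e2ennreal (- u w)) x)"
  using cond_exp_pos_eq[of u, OF assms] cond_exp_pos_eq[of "\<lambda>w. - u w"]
  unfolding ext_cond_exp_def by (auto elim!: eventually_elim2)

lemma ext_cond_exp_nonneg:
  assumes [measurable]: "u \<in> borel_measurable M" and "\<And>x. x \<in> space M \<Longrightarrow> 0 \<le> u x"
  shows "AE x in M. ext_cond_exp M F u x = enn2ereal (nn_cond_exp M F (\<lambda>w. e2ennreal (u w)) x)"
proof -
  have "AE x in M. nn_cond_exp M F (\<lambda>w. e2ennreal (- u w)) x = nn_cond_exp M F (\<lambda>_. 0) x"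
    using assms(2) by (intro nn_cond_exp_cong AE_I2) (auto simp: e2ennreal_neg)
  with ext_cond_exp_eq[OF assms(1)] nn_cond_exp_zero show ?thesis
    by eventually_elim (simp add: zero_ennreal.rep_eq)
qed

text \<open>\<open>nn_cond_exp\<close> is already an \<open>F\<close>-measurable function, so only
  a.s. finiteness is at stake; \<open>enn2real\<close> then supplies the representative.\<close>

lemma cond_exp_in_L0_iff:
  assumes "u \<in> borel_measurable M" and "\<And>x. x \<in> space M \<Longrightarrow> 0 \<le> u x"
  shows "cond_exp_in_L0 M F u \<longleftrightarrow> (AE x in M. nn_cond_exp M F (\<lambda>w. e2ennreal (u w)) x < \<infinity>)"
proof
  assume "cond_exp_in_L0 M F u"
  then obtain z where "AE x in M. ext_cond_exp M F u x = ereal (z x)"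
    unfolding cond_exp_in_L0_def by auto
  with ext_cond_exp_nonneg[OF assms, simplified] show "AE x in M. nn_cond_exp M F (\<lambda>w. e2ennreal (u w)) x < \<infinity>"
  proof eventually_elim
    case (elim x)
    then have "nn_cond_exp M F (\<lambda>w. e2ennreal (u w)) x \<noteq> \<top>" by auto
    then show ?case by (simp add: top.not_eq_extremum)
  qed
next
  assume fin: "AE x in M. nn_cond_exp M F (\<lambda>w. e2ennreal (u w)) x < \<infinity>"
  show "cond_exp_in_L0 M F u"
    unfolding cond_exp_in_L0_def
  proof (intro bexI)
    show "(\<lambda>x. enn2real (nn_cond_exp M F (\<lambda>w. e2ennreal (u w)) x)) \<in> L0 F"
      unfolding L0_def by measurable
    show "AE x in M. ext_cond_exp M F u x = ereal (enn2real (nn_cond_exp M F (\<lambda>w. e2ennreal (u w)) x))"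
      using ext_cond_exp_nonneg[OF assms, simplified] fin
    proof eventually_elim
      case (elim x)
      then show ?case by (cases "nn_cond_exp M F (\<lambda>w. e2ennreal (u w)) x") auto
    qed
  qed
qed

end

section \<open>The conditional Orlicz heart\<close>

text \<open>Egorov's trick: infinitely many countable exhaustions can be stopped simultaneously
  without losing all of \<open>C\<close>.\<close>

lemma (in finite_measure) uniform_exhaustion:
  assumes S: "\<And>n j. S n j \<in> sets M" and mono: "\<And>n. incseq (S n)"
    and C: "C \<in> sets M" "measure M C > 0"
    and ex: "AE x in M. x \<in> C \<longrightarrow> (\<forall>n::nat. \<exists>j::nat. x \<in> S n j)"
  shows "\<exists>J. measure M (C \<inter> (\<Inter>n. S n (J n))) > 0"
proof -
  let ?m = "measure M C"
  \<comment> \<open>The bounds \<open>?m * (1/2) ^ (n + 2)\<close> add up to \<open>?m / 2\<close>,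
    so the sets discarded for all \<open>n\<close> together leave at least half of
    \<open>C\<close>.\<close>
  have "\<exists>j. measure M (C - S n j) < ?m * (1/2) ^ (n + 2)" for n
  proof -
    have "(\<lambda>j. measure M (C - S n j)) \<longlonglongrightarrow> measure M (\<Inter>j. C - S n j)"
    proof (rule finite_Lim_measure_decseq)
      show "decseq (\<lambda>j. C - S n j)" using incseq_SucD[OF mono[of n]] by (intro decseq_SucI) auto
    qed (use S C in auto)
    moreover have "measure M (\<Inter>j. C - S n j) = 0"
    proof -
      have "AE x in M. x \<notin> (\<Inter>j. C - S n j)" using ex by eventually_elim blast
      then show ?thesis using S C by (subst measure_eq_0_null_sets) (auto simp: AE_iff_null_sets)
    qed
    ultimately have "(\<lambda>j. measure M (C - S n j)) \<longlonglongrightarrow> 0" by simp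
    moreover have "?m * (1/2) ^ (n + 2) > 0" using C by simp
    ultimately have "eventually (\<lambda>j. measure M (C - S n j) < ?m * (1/2) ^ (n + 2)) sequentially"
      by (rule order_tendstoD(2))
    then show ?thesis by (auto dest: eventually_happens)
  qed
  then obtain J where J: "\<And>n. measure M (C - S n (J n)) < ?m * (1/2) ^ (n + 2)" by metis
  have sums: "(\<lambda>n. ?m * (1/2) ^ (n + 2)) sums (?m / 2)"
    using sums_mult[OF geometric_sums[of "1/2::real"], of "?m * (1/4)"] by (simp add: power_add mult_ac)
  have sm: "summable (\<lambda>n. measure M (C - S n (J n)))"
  proof (rule summable_comparison_test)
    show "\<exists>N. \<forall>n\<ge>N. norm (measure M (C - S n (J n))) \<le> ?m * (1/2) ^ (n + 2)"
      using J by (auto intro!: less_imp_le)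
  qed (use sums in \<open>auto simp: sums_iff\<close>)
  have "measure M (\<Union>n. C - S n (J n)) \<le> (\<Sum>n. measure M (C - S n (J n)))"
    by (rule finite_measure_subadditive_countably) (use S C sm in auto)
  also have "\<dots> \<le> (\<Sum>n. ?m * (1/2) ^ (n + 2))"
    by (rule suminf_le) (use J sm sums in \<open>auto simp: sums_iff intro: less_imp_le\<close>)
  also have "\<dots> = ?m / 2" using sums by (simp add: sums_iff)
  finally have *: "measure M (\<Union>n. C - S n (J n)) \<le> ?m / 2" .
  have "measure M (C - (\<Union>n. C - S n (J n))) = ?m - measure M (\<Union>n. C - S n (J n))"
    by (rule finite_measure_Diff) (use S C in auto)
  moreover have "C - (\<Union>n. C - S n (J n)) = C \<inter> (\<Inter>n. S n (J n))" by auto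
  ultimately show ?thesis using * C by (intro exI[of _ J]) auto
qed

text \<open>Here \<open>f\<close> stands for a finite Young function continued to the negative axis
  so as to be monotone on the whole line, hence Borel. \<open>f_star\<close> is convexity on the
  segment from 0, where \<open>f\<close> vanishes, to \<open>r\<close>. It makes \<open>f\<close>
  small near 0, and it lets a factor \<open>c\<close> in the argument reduce \<open>f\<close> by at
  least that factor.\<close>

locale young_heart = prob_space M for M :: "'a measure" +
  fixes F :: "'a measure" and f :: "real \<Rightarrow> real"
  assumes subalgebra_F: "subalgebra M F"
    and f_zero: "f 0 = 0"
    and f_mono: "mono f"
    and f_star: "\<And>c r. 0 \<le> c \<Longrightarrow> c \<le> 1 \<Longrightarrow> 0 \<le> r \<Longrightarrow> f (c * r) \<le> c * f r"
    and f_top: "filterlim f at_top at_top"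
begin

sublocale finite_measure_subalgebra M F
  by unfold_locales (rule subalgebra_F)

lemma f_nonneg: "0 \<le> r \<Longrightarrow> 0 \<le> f r"
  using f_mono f_zero by (metis monoD)

lemma f_measurable [measurable]: "f \<in> borel_measurable borel"
  by (rule borel_measurable_mono[OF f_mono])

text \<open>Integer multipliers replace the positive \<open>F\<close>-measurable ones;
  \<open>cond_orlicz_heart_eq\<close> shows that the space is the same. Being countably many, these
  conditions hold jointly off one null set.\<close>

definition heart :: "('a \<Rightarrow> real) set" where
  "heart = {x \<in> borel_measurable M. \<forall>N::nat.
     AE w in M. nn_cond_exp M F (\<lambda>w. ennreal (f (real N * \<bar>x w\<bar>))) w < \<infinity>}"

lemma heart_measurable: "x \<in> heart \<Longrightarrow> x \<in> borel_measurable M"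
  by (simp add: heart_def)

lemma heart_solid:
  assumes [measurable]: "x \<in> borel_measurable M" and y: "y \<in> heart"
    and le: "AE w in M. \<bar>x w\<bar> \<le> \<bar>y w\<bar>"
  shows "x \<in> heart"
  unfolding heart_def
proof (intro CollectI conjI allI)
  fix N :: nat
  note [measurable] = heart_measurable[OF y]
  have "AE w in M. nn_cond_exp M F (\<lambda>w. ennreal (f (real N * \<bar>x w\<bar>))) w
      \<le> nn_cond_exp M F (\<lambda>w. ennreal (f (real N * \<bar>y w\<bar>))) w"
  proof (rule nn_cond_exp_mono)
    show "AE w in M. ennreal (f (real N * \<bar>x w\<bar>)) \<le> ennreal (f (real N * \<bar>y w\<bar>))"
      using le by eventually_elim (intro ennreal_leI monoD[OF f_mono] mult_left_mono, auto)
  qed auto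
  moreover have "AE w in M. nn_cond_exp M F (\<lambda>w. ennreal (f (real N * \<bar>y w\<bar>))) w < \<infinity>"
    using y by (auto simp: heart_def)
  ultimately show "AE w in M. nn_cond_exp M F (\<lambda>w. ennreal (f (real N * \<bar>x w\<bar>))) w < \<infinity>"
    by eventually_elim (rule order.strict_trans1)
qed auto

text \<open>A sum is at most twice its larger term, so monotonicity bounds \<open>f\<close> of
  \<open>N\<close> times the sum by one of the two summands \<open>?g\<close>. Doubling
  \<open>N\<close> stays within the conditions defining the heart.\<close>

lemma heart_abs_add:
  assumes x: "x \<in> heart" and y: "y \<in> heart"
  shows "(\<lambda>w. \<bar>x w\<bar> + \<bar>y w\<bar>) \<in> heart"
  unfolding heart_def
proof (intro CollectI conjI allI)
  note [measurable] = heart_measurable[OF x] heart_measurable[OF y]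
  fix N :: nat
  let ?g = "\<lambda>x w. ennreal (f (real (2 * N) * \<bar>x w\<bar>))"
  have "AE w in M. nn_cond_exp M F (\<lambda>w. ennreal (f (real N * \<bar>\<bar>x w\<bar> + \<bar>y w\<bar>\<bar>))) w
      \<le> nn_cond_exp M F (\<lambda>w. ?g x w + ?g y w) w"
  proof (rule nn_cond_exp_mono)
    have "f (real N * (\<bar>x w\<bar> + \<bar>y w\<bar>)) \<le> f (real (2 * N) * \<bar>x w\<bar>) + f (real (2 * N) * \<bar>y w\<bar>)" for w
    proof (cases "\<bar>x w\<bar> \<le> \<bar>y w\<bar>")
      case True
      have "real N * (\<bar>x w\<bar> + \<bar>y w\<bar>) \<le> real N * (2 * \<bar>y w\<bar>)" using True by (intro mult_left_mono) auto
      then have "f (real N * (\<bar>x w\<bar> + \<bar>y w\<bar>)) \<le> f (real (2 * N) * \<bar>y w\<bar>)"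
        by (intro monoD[OF f_mono]) (simp add: algebra_simps)
      then show ?thesis using f_nonneg[of "real (2 * N) * \<bar>x w\<bar>"] by simp
    next
      case False
      have "real N * (\<bar>x w\<bar> + \<bar>y w\<bar>) \<le> real N * (2 * \<bar>x w\<bar>)" using False by (intro mult_left_mono) auto
      then have "f (real N * (\<bar>x w\<bar> + \<bar>y w\<bar>)) \<le> f (real (2 * N) * \<bar>x w\<bar>)"
        by (intro monoD[OF f_mono]) (simp add: algebra_simps)
      then show ?thesis using f_nonneg[of "real (2 * N) * \<bar>y w\<bar>"] by simp
    qed
    then show "AE w in M. ennreal (f (real N * \<bar>\<bar>x w\<bar> + \<bar>y w\<bar>\<bar>)) \<le> ?g x w + ?g y w"
      by (intro AE_I2) (auto simp: ennreal_plus[symmetric] f_nonneg simp del: ennreal_plus intro!: ennreal_leI)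
  qed auto
  moreover have "AE w in M. nn_cond_exp M F (?g x) w + nn_cond_exp M F (?g y) w = nn_cond_exp M F (\<lambda>w. ?g x w + ?g y w) w"
    by (rule nn_cond_exp_sum) auto
  moreover have "AE w in M. nn_cond_exp M F (?g x) w < \<infinity>" "AE w in M. nn_cond_exp M F (?g y) w < \<infinity>"
    using x y by (auto simp: heart_def simp del: of_nat_mult)
  ultimately show "AE w in M. nn_cond_exp M F (\<lambda>w. ennreal (f (real N * \<bar>\<bar>x w\<bar> + \<bar>y w\<bar>\<bar>))) w < \<infinity>"
  proof eventually_elim
    case (elim w)
    have "nn_cond_exp M F (?g x) w + nn_cond_exp M F (?g y) w < \<infinity>" using elim(3,4) by simp
    then show ?case unfolding elim(2) by (rule order.strict_trans1[OF elim(1)])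
  qed
qed (use x y in \<open>auto simp: heart_def\<close>)

lemma heart_dominated:
  assumes "z \<in> borel_measurable M" "x \<in> heart" "y \<in> heart" "AE w in M. \<bar>z w\<bar> \<le> \<bar>x w\<bar> + \<bar>y w\<bar>"
  shows "z \<in> heart"
  by (rule heart_solid[OF assms(1) heart_abs_add[OF assms(2,3)]]) (use assms(4) in auto)

lemma heart_nn_integral:
  assumes [measurable]: "x \<in> borel_measurable M"
    and "\<And>N::nat. (\<integral>\<^sup>+ w. ennreal (f (real N * \<bar>x w\<bar>)) \<partial>M) < \<infinity>"
  shows "x \<in> heart"
  unfolding heart_def using assms(2) by (intro CollectI conjI allI nn_cond_exp_finite) auto

text \<open>\<open>f\<close> is real-valued, so constants have finite \<open>f\<close>-integrals
  under a probability measure. This makes all bounded test functions available.\<close>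

lemma heart_bounded:
  assumes [measurable]: "x \<in> borel_measurable M" and b: "AE w in M. \<bar>x w\<bar> \<le> c"
  shows "x \<in> heart"
proof (rule heart_nn_integral)
  fix N :: nat
  have "(\<integral>\<^sup>+ w. ennreal (f (real N * \<bar>x w\<bar>)) \<partial>M) \<le> (\<integral>\<^sup>+ w. ennreal (f (real N * c)) \<partial>M)"
  proof (rule nn_integral_mono_AE)
    show "AE w in M. ennreal (f (real N * \<bar>x w\<bar>)) \<le> ennreal (f (real N * c))"
      using b by eventually_elim (intro ennreal_leI monoD[OF f_mono] mult_left_mono, auto)
  qed
  also have "\<dots> < \<infinity>" by (simp add: emeasure_space_1)
  finally show "(\<integral>\<^sup>+ w. ennreal (f (real N * \<bar>x w\<bar>)) \<partial>M) < \<infinity>" .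
qed auto

text \<open>The tool behind both gliding humps. The candidate is the pointwise supremum
  \<open>x\<close>: where it is positive, some \<open>v k w\<close> exceeds \<open>x w / 2\<close>,
  so \<open>f (N * x)\<close> is at most the sum of all \<open>f (2 * N * v k)\<close>. The factor 2
  makes up for a supremum that is not attained.\<close>

lemma heart_dominating:
  assumes [measurable]: "\<And>k::nat. v k \<in> borel_measurable M"
    and v_nonneg: "\<And>k w. 0 \<le> v k w"
    and fin: "\<And>N::nat. (\<Sum>k. \<integral>\<^sup>+ w. ennreal (f (real N * v k w)) \<partial>M) < \<infinity>"
  shows "\<exists>x\<in>heart. \<forall>k. AE w in M. v k w \<le> x w"
proof -
  define S where "S N w = (\<Sum>k. ennreal (f (real N * v k w)))" for N w
  \<comment> \<open>\<open>real_of_ereal\<close> turns an infinite supremum into 0. This can happen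
    only on a null set: where \<open>S 1\<close> is finite, the values \<open>f (v k w)\<close> are
    bounded in \<open>k\<close>, and then \<open>f_top\<close> bounds the
    \<open>v k w\<close>.\<close>
  define x where "x w = real_of_ereal (SUP k. ereal (v k w))" for w
  have [measurable]: "x \<in> borel_measurable M" unfolding x_def by measurable
  have [measurable]: "S N \<in> borel_measurable M" for N unfolding S_def by measurable
  have S_int: "(\<integral>\<^sup>+ w. S N w \<partial>M) < \<infinity>" for N
    unfolding S_def using fin[of N] by (subst nn_integral_suminf) auto
  have S_le: "ennreal (f (real N * v k w)) \<le> S N w" for N k w
  proof -
    have "(\<Sum>i\<in>{k}. ennreal (f (real N * v i w))) \<le> S N w"
      unfolding S_def by (rule sum_le_suminf) auto
    then show ?thesis by simp
  qed
  have "AE w in M. S 1 w \<noteq> \<infinity>"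
    by (rule nn_integral_PInf_AE) (use S_int[of 1] in auto)
  then have x: "AE w in M. ereal (x w) = (SUP k. ereal (v k w))"
  proof eventually_elim
    case (elim w)
    then obtain C where C: "S 1 w = ennreal C" "0 \<le> C" by (cases "S 1 w") auto
    have "eventually (\<lambda>r. f r > C) at_top" using f_top by (simp add: filterlim_at_top_dense)
    then obtain R where R: "\<And>r. r \<ge> R \<Longrightarrow> f r > C" by (auto simp: eventually_at_top_linorder)
    have "v k w \<le> R" for k
    proof (rule ccontr)
      assume "\<not> v k w \<le> R"
      then have "C < f (v k w)" using R by simp
      moreover have "f (v k w) \<le> C" using S_le[of 1 k w] C by (simp add: f_nonneg v_nonneg)
      ultimately show False by simp
    qed
    then have 1: "(SUP k. ereal (v k w)) \<le> ereal R" by (intro SUP_least) simp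
    have "ereal 0 \<le> ereal (v 0 w)" using v_nonneg by simp
    also have "\<dots> \<le> (SUP k. ereal (v k w))" by (rule SUP_upper) simp
    finally show ?case using 1 unfolding x_def by (cases "SUP k. ereal (v k w)") auto
  qed
  have le: "AE w in M. \<forall>k. v k w \<le> x w"
    using x
  proof eventually_elim
    case (elim w)
    have "ereal (v k w) \<le> ereal (x w)" for k unfolding elim by (rule SUP_upper) simp
    then show ?case by simp
  qed
  have bound: "AE w in M. ennreal (f (real N * \<bar>x w\<bar>)) \<le> S (2 * N) w" for N
    using x le
  proof eventually_elim
    case (elim w)
    have "0 \<le> x w" using elim(2) v_nonneg[of 0 w] by (meson order.trans)
    show ?case
    proof (cases "x w = 0")
      case True
      then show ?thesis by (simp add: f_zero)
    next
      case False
      with \<open>0 \<le> x w\<close> have "ereal (x w / 2) < (SUP k. ereal (v k w))" unfolding elim(1)[symmetric] by simp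
      then obtain k where "x w / 2 < v k w" by (auto simp: less_SUP_iff)
      then have "real N * \<bar>x w\<bar> \<le> real N * (2 * v k w)" using \<open>0 \<le> x w\<close> by (intro mult_left_mono) auto
      also have "\<dots> = real (2 * N) * v k w" by simp
      finally have "ennreal (f (real N * \<bar>x w\<bar>)) \<le> ennreal (f (real (2 * N) * v k w))"
        by (intro ennreal_leI monoD[OF f_mono])
      then show ?thesis using S_le[of "2 * N" k w] by (rule order.trans)
    qed
  qed
  have "x \<in> heart"
  proof (rule heart_nn_integral)
    fix N :: nat
    have "(\<integral>\<^sup>+ w. ennreal (f (real N * \<bar>x w\<bar>)) \<partial>M) \<le> (\<integral>\<^sup>+ w. S (2 * N) w \<partial>M)"
      by (rule nn_integral_mono_AE[OF bound])
    then show "(\<integral>\<^sup>+ w. ennreal (f (real N * \<bar>x w\<bar>)) \<partial>M) < \<infinity>" using S_int by (rule order.strict_trans1)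
  qed auto
  then show ?thesis using le by (auto simp: AE_all_countable)
qed

end

section \<open>The Lebesgue property\<close>

locale conditional_risk = young_heart M F f for M F :: "'a measure" and f +
  fixes \<rho> :: "('a \<Rightarrow> real) \<Rightarrow> ('a \<Rightarrow> real)"
  assumes rho_measurable_F: "\<And>x. x \<in> heart \<Longrightarrow> \<rho> x \<in> borel_measurable F"
    and rho_convex: "\<And>\<eta> x y. \<eta> \<in> borel_measurable F \<Longrightarrow> x \<in> heart \<Longrightarrow> y \<in> heart \<Longrightarrow>
        (AE w in M. 0 \<le> \<eta> w \<and> \<eta> w \<le> 1) \<Longrightarrow>
        AE w in M. \<rho> (\<lambda>w. \<eta> w * x w + (1 - \<eta> w) * y w) w \<le> \<eta> w * \<rho> x w + (1 - \<eta> w) * \<rho> y w"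
    and rho_antimono: "\<And>x y. x \<in> heart \<Longrightarrow> y \<in> heart \<Longrightarrow> (AE w in M. x w \<le> y w) \<Longrightarrow>
        AE w in M. \<rho> y w \<le> \<rho> x w"
    and rho_cash: "\<And>\<eta> x. \<eta> \<in> borel_measurable F \<Longrightarrow> x \<in> heart \<Longrightarrow>
        AE w in M. \<rho> (\<lambda>w. x w + \<eta> w) w = \<rho> x w - \<eta> w"
begin

text \<open>Paste \<open>x\<close> on \<open>A\<close> and \<open>y\<close> off \<open>A\<close>.
  The result lies below \<open>y\<close> a.s., and convexity with the indicator of \<open>A\<close>
  as coefficient bounds its risk by \<open>\<rho> x\<close> on \<open>A\<close>. This is the
  locality of \<open>\<rho>\<close>.\<close>

lemma rho_antimono_on:
  assumes x: "x \<in> heart" and y: "y \<in> heart" and A: "A \<in> sets F"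
    and le: "AE w in M. w \<in> A \<longrightarrow> x w \<le> y w"
  shows "AE w in M. w \<in> A \<longrightarrow> \<rho> y w \<le> \<rho> x w"
proof -
  define z where "z w = indicator A w * x w + (1 - indicator A w) * y w" for w
  have [measurable]: "A \<in> sets F" "A \<in> sets M" using A subalg by (auto simp: subalgebra_def)
  note [measurable] = heart_measurable[OF x] heart_measurable[OF y]
  have [measurable]: "z \<in> borel_measurable M" unfolding z_def by measurable
  have z: "z \<in> heart"
    by (rule heart_dominated[OF _ x y]) (auto simp: z_def indicator_def)
  have "AE w in M. \<rho> y w \<le> \<rho> z w"
  proof (rule rho_antimono[OF z y])
    show "AE w in M. z w \<le> y w" using le by eventually_elim (auto simp: z_def indicator_def)
  qed
  moreover have "AE w in M. \<rho> z w \<le> indicator A w * \<rho> x w + (1 - indicator A w) * \<rho> y w"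
    unfolding z_def by (rule rho_convex[OF _ x y]) (auto simp: indicator_def)
  ultimately show ?thesis by eventually_elim (auto simp: indicator_def)
qed

lemma heart_affine:
  assumes "x \<in> heart" "y \<in> heart"
  shows "(\<lambda>w. a * x w + b * y w) \<in> heart"
proof -
  note [measurable] = heart_measurable[OF assms(1)] heart_measurable[OF assms(2)]
  have scale: "(\<lambda>w. c * u w) \<in> heart" if u: "u \<in> heart" for c u
  proof -
    note [measurable] = heart_measurable[OF u]
    obtain n :: nat where n: "\<bar>c\<bar> \<le> real n" using real_arch_simple by blast
    have m: "(\<lambda>w. real n * u w) \<in> heart"
    proof -
      have "AE w in M. nn_cond_exp M F (\<lambda>w. ennreal (f (real (N * n) * \<bar>u w\<bar>))) w < \<infinity>" for N
        using u by (simp add: heart_def del: of_nat_mult)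
      then show ?thesis by (auto simp: heart_def abs_mult mult.assoc)
    qed
    show ?thesis
      by (rule heart_solid[OF _ m]) (auto simp: abs_mult intro!: AE_I2 mult_right_mono n)
  qed
  show ?thesis
    by (rule heart_dominated[OF _ scale[OF assms(1), of a] scale[OF assms(2), of b]]) auto
qed

text \<open>\<open>x + u\<close> is the convex combination of \<open>x + c * u\<close> and
  \<open>x\<close> with weight \<open>1 / c\<close>, so difference quotients of
  \<open>\<rho>\<close> grow with the length of the step.\<close>

lemma rho_scale:
  assumes x: "x \<in> heart" and u: "u \<in> heart" and c: "1 \<le> c"
  shows "AE w in M. c * (\<rho> (\<lambda>w. x w + u w) w - \<rho> x w) \<le> \<rho> (\<lambda>w. x w + c * u w) w - \<rho> x w"
proof -
  have y: "(\<lambda>w. x w + c * u w) \<in> heart" using heart_affine[OF x u, of 1 c] by simp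
  have "AE w in M. \<rho> (\<lambda>w. (1 / c) * (x w + c * u w) + (1 - 1 / c) * x w) w
      \<le> (1 / c) * \<rho> (\<lambda>w. x w + c * u w) w + (1 - 1 / c) * \<rho> x w"
    by (rule rho_convex[OF _ y x]) (use c in auto)
  moreover have "(\<lambda>w. (1 / c) * (x w + c * u w) + (1 - 1 / c) * x w) = (\<lambda>w. x w + u w)"
    using c by (auto simp: field_simps)
  ultimately have "AE w in M. \<rho> (\<lambda>w. x w + u w) w \<le> (1 / c) * \<rho> (\<lambda>w. x w + c * u w) w + (1 - 1 / c) * \<rho> x w"
    by simp
  then show ?thesis
  proof eventually_elim
    case (elim w)
    then have "c * \<rho> (\<lambda>w. x w + u w) w \<le> c * ((1 / c) * \<rho> (\<lambda>w. x w + c * u w) w + (1 - 1 / c) * \<rho> x w)"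
      using c by (intro mult_left_mono) auto
    then show ?case using c by (simp add: algebra_simps)
  qed
qed

text \<open>A gliding hump: were \<open>\<rho> (x - z n) - \<rho> x \<ge> \<epsilon>\<close> on a nonnegligible set, some \<open>y\<close> in the heart
  would dominate there suitable multiples \<open>k * z (r k)\<close>, and convexity would force
  \<open>\<rho> (x - y) - \<rho> x \<ge> k * \<epsilon>\<close> for all \<open>k\<close>.\<close>

lemma rho_decreasing_null:
  assumes x: "x \<in> heart" and z: "\<And>n. z n \<in> heart" and z_nonneg: "\<And>n w. 0 \<le> z n w"
    and dec: "\<And>n w. z (Suc n) w \<le> z n w"
    and lim: "AE w in M. (\<lambda>n. z n w) \<longlonglongrightarrow> 0"
    and \<epsilon>: "\<epsilon> > 0"
  shows "AE w in M. \<exists>n. \<rho> (\<lambda>w. x w - z n w) w - \<rho> x w < \<epsilon>"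
proof -
  have spaceF: "space F = space M" using subalg by (simp add: subalgebra_def)
  note [measurable] = heart_measurable[OF x] heart_measurable[OF z]
  have xz: "(\<lambda>w. x w - c * z n w) \<in> heart" for n c
    using heart_affine[OF x z[of n], of 1 "- c"] by simp
  have xz1: "(\<lambda>w. x w - z n w) \<in> heart" for n using xz[of 1 n] by simp
  note [measurable] = rho_measurable_F[OF x] rho_measurable_F[OF xz1]
  define C where "C = {w \<in> space F. \<forall>n. \<epsilon> \<le> \<rho> (\<lambda>w. x w - z n w) w - \<rho> x w}"
  have C_F: "C \<in> sets F" unfolding C_def by measurable
  then have C_M: "C \<in> sets M" using subalg by (auto simp: subalgebra_def)
  have z0: "z n w \<le> z 0 w" for n w
    using dec by (induction n) (auto intro: order.trans)
  have "measure M C = 0"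
  proof (rule ccontr)
    assume "measure M C \<noteq> 0"
    then have pos: "measure M C > 0" using measure_nonneg[of M C] by linarith
    \<comment> \<open>\<open>f (N * z 0)\<close> need not be integrable; only its conditional
      expectation \<open>V N\<close> is a.s. finite. Below, \<open>A\<close> is a nonnegligible
      \<open>F\<close>-set inside \<open>C\<close> on which each \<open>V N\<close> is at most a
      constant \<open>J N\<close>, so that integrals over \<open>A\<close> are finite for all
      \<open>N\<close> at once.\<close>
    define V where "V N = nn_cond_exp M F (\<lambda>w. ennreal (f (real N * z 0 w)))" for N :: nat
    have [measurable]: "V N \<in> borel_measurable F" for N unfolding V_def by measurable
    have V_fin: "AE w in M. V N w < \<infinity>" for N
      using z[of 0] z_nonneg unfolding heart_def V_def by auto
    define S where "S N j = {w \<in> space F. V N w \<le> of_nat j}" for N j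
    have S_F: "S N j \<in> sets F" for N j unfolding S_def by measurable
    have S_M: "S N j \<in> sets M" for N j using S_F subalg by (auto simp: subalgebra_def)
    have "\<exists>J. measure M (C \<inter> (\<Inter>N. S N (J N))) > 0"
    proof (rule uniform_exhaustion[OF S_M _ C_M pos])
      show "incseq (S N)" for N
      proof (rule incseq_SucI, rule subsetI)
        fix j w assume "w \<in> S N j"
        moreover have "(of_nat j :: ennreal) \<le> of_nat (Suc j)" by (subst of_nat_le_iff) simp
        ultimately show "w \<in> S N (Suc j)" unfolding S_def by (auto intro: order.trans)
      qed
      have "AE w in M. \<forall>N. V N w < \<infinity>" using V_fin by (simp add: AE_all_countable)
      then show "AE w in M. w \<in> C \<longrightarrow> (\<forall>N. \<exists>j. w \<in> S N j)"
      proof eventually_elim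
        case (elim w)
        show ?case
        proof (intro impI allI)
          fix N assume "w \<in> C"
          then have "w \<in> space F" by (auto simp: C_def)
          obtain r where r: "V N w = ennreal r" using elim[rule_format, of N] by (cases "V N w") auto
          obtain j :: nat where "r \<le> real j" using real_arch_simple by blast
          then have "V N w \<le> of_nat j" unfolding r by (simp add: ennreal_of_nat_eq_real_of_nat ennreal_leI)
          then show "\<exists>j. w \<in> S N j" using \<open>w \<in> space F\<close> by (auto simp: S_def)
        qed
      qed
    qed
    then obtain J where J: "measure M (C \<inter> (\<Inter>N. S N (J N))) > 0" by auto
    define A where "A = C \<inter> (\<Inter>N. S N (J N))"
    have A_F [measurable]: "A \<in> sets F" unfolding A_def using C_F S_F by auto
    then have A_M [measurable]: "A \<in> sets M" using subalg by (auto simp: subalgebra_def)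
    have A_pos: "measure M A > 0" using J by (simp add: A_def)
    have int_fin: "(\<integral>\<^sup>+ w. indicator A w * ennreal (f (real N * z 0 w)) \<partial>M) < \<infinity>" for N
    proof -
      have "(\<integral>\<^sup>+ w. indicator A w * ennreal (f (real N * z 0 w)) \<partial>M) = (\<integral>\<^sup>+ w. indicator A w * V N w \<partial>M)"
        unfolding V_def by (rule nn_cond_exp_intg[symmetric]) auto
      also have "\<dots> \<le> (\<integral>\<^sup>+ w. of_nat (J N) \<partial>M)"
        by (rule nn_integral_mono) (auto simp: A_def S_def indicator_def)
      also have "\<dots> < \<infinity>" by (simp add: emeasure_space_1 ennreal_of_nat_eq_real_of_nat)
      finally show ?thesis .
    qed
    have int_lim: "(\<lambda>n. \<integral>\<^sup>+ w. indicator A w * ennreal (f (real N * z n w)) \<partial>M) \<longlonglongrightarrow> (\<integral>\<^sup>+ w. 0 \<partial>M)" for N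
    proof (rule nn_integral_dominated_convergence)
      show "AE w in M. indicator A w * ennreal (f (real N * z n w)) \<le> indicator A w * ennreal (f (real N * z 0 w))" for n
        by (intro AE_I2 mult_left_mono ennreal_leI monoD[OF f_mono] z0) auto
      show "AE w in M. (\<lambda>n. indicator A w * ennreal (f (real N * z n w))) \<longlonglongrightarrow> 0"
        using lim
      proof eventually_elim
        case (elim w)
        have "(\<lambda>n. real N * z n w) \<longlonglongrightarrow> 0" using tendsto_mult_right_zero[OF elim, of "real N"] .
        then have ev: "eventually (\<lambda>n. real N * z n w < 1) sequentially" by (rule order_tendstoD) simp
        have "(\<lambda>n. f (real N * z n w)) \<longlonglongrightarrow> 0"
        proof (rule tendsto_sandwich)
          show "eventually (\<lambda>n. 0 \<le> f (real N * z n w)) sequentially"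
            by (auto intro!: always_eventually f_nonneg mult_nonneg_nonneg z_nonneg)
          show "eventually (\<lambda>n. f (real N * z n w) \<le> real N * z n w * f 1) sequentially"
            using ev
          proof eventually_elim
            case (elim n)
            then show ?case using f_star[of "real N * z n w" 1] z_nonneg[of n w] by simp
          qed
          show "(\<lambda>n. real N * z n w * f 1) \<longlonglongrightarrow> 0"
            using tendsto_mult_left_zero[OF \<open>(\<lambda>n. real N * z n w) \<longlonglongrightarrow> 0\<close>, of "f 1"] .
        qed simp
        then have "(\<lambda>n. ennreal (f (real N * z n w))) \<longlonglongrightarrow> ennreal 0" by (intro tendsto_ennrealI)
        then show ?case by (auto simp: indicator_def)
      qed
    qed (use int_fin in auto)
    \<comment> \<open>The square provides for two factors: \<open>v k = k * z (r k)\<close> carries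
      one \<open>k\<close> as the height of the hump, and
      \<open>N * v k \<le> k * k * z (r k)\<close> as soon as \<open>N \<le> k\<close>. One choice
      of \<open>r k\<close> thus gives summable tails for every \<open>N\<close>.\<close>
    have "\<exists>n. (\<integral>\<^sup>+ w. indicator A w * ennreal (f (real (k * k) * z n w)) \<partial>M) < ennreal ((1/2) ^ k)" for k
    proof -
      have "eventually (\<lambda>n. (\<integral>\<^sup>+ w. indicator A w * ennreal (f (real (k * k) * z n w)) \<partial>M) < ennreal ((1/2) ^ k)) sequentially"
        by (rule order_tendstoD(2)[OF int_lim]) simp
      then show ?thesis by (auto dest: eventually_happens)
    qed
    then obtain r where r: "\<And>k. (\<integral>\<^sup>+ w. indicator A w * ennreal (f (real (k * k) * z (r k) w)) \<partial>M) < ennreal ((1/2) ^ k)"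
      by metis
    define v where "v k w = indicator A w * (real k * z (r k) w)" for k w
    have [measurable]: "v k \<in> borel_measurable M" for k unfolding v_def by measurable
    have v_nonneg: "0 \<le> v k w" for k w unfolding v_def using z_nonneg by auto
    have "\<exists>y\<in>heart. \<forall>k. AE w in M. v k w \<le> y w"
    proof (rule heart_dominating)
      fix N :: nat
      \<comment> \<open>For \<open>k < N\<close> the choice of \<open>r k\<close> says nothing;
        these finitely many terms are bounded through \<open>z (r k) \<le> z 0\<close> and
        \<open>int_fin\<close>.\<close>
      define b where "b k = (if k \<in> {..<N} then (\<integral>\<^sup>+ w. indicator A w * ennreal (f (real (N * k) * z 0 w)) \<partial>M) else 0)" for k
      have f_ind: "ennreal (f (real N * v k w)) = indicator A w * ennreal (f (real (N * k) * z (r k) w))" for k w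
        by (auto simp: v_def indicator_def f_zero mult.assoc)
      have "(\<integral>\<^sup>+ w. ennreal (f (real N * v k w)) \<partial>M) \<le> ennreal ((1/2) ^ k) + b k" for k
      proof (cases "k < N")
        case True
        have "(\<integral>\<^sup>+ w. ennreal (f (real N * v k w)) \<partial>M) \<le> b k"
          unfolding f_ind b_def using True
          by (auto intro!: nn_integral_mono mult_left_mono ennreal_leI monoD[OF f_mono] z0)
        then show ?thesis by (simp add: add_increasing)
      next
        case False
        have "(\<integral>\<^sup>+ w. ennreal (f (real N * v k w)) \<partial>M) \<le> (\<integral>\<^sup>+ w. indicator A w * ennreal (f (real (k * k) * z (r k) w)) \<partial>M)"
          unfolding f_ind
        proof (intro nn_integral_mono mult_left_mono ennreal_leI monoD[OF f_mono] mult_right_mono)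
          show "real (N * k) \<le> real (k * k)" using False by (subst of_nat_le_iff) (simp add: mult_le_mono1)
        qed (use z_nonneg in auto)
        also have "\<dots> \<le> ennreal ((1/2) ^ k)" using r[of k] by simp
        finally show ?thesis by (simp add: add_increasing2)
      qed
      then have "(\<Sum>k. \<integral>\<^sup>+ w. ennreal (f (real N * v k w)) \<partial>M) \<le> (\<Sum>k. ennreal ((1/2) ^ k) + b k)"
        by (intro suminf_le) auto
      also have "\<dots> = (\<Sum>k. ennreal ((1/2) ^ k)) + (\<Sum>k. b k)" by (rule suminf_add[symmetric]) auto
      also have "(\<Sum>k. b k) = (\<Sum>k<N. b k)" by (rule suminf_finite) (auto simp: b_def)
      also have "(\<Sum>k. ennreal ((1/2) ^ k)) = ennreal (\<Sum>k. (1/2) ^ k)"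
        by (rule suminf_ennreal2) auto
      finally have "(\<Sum>k. \<integral>\<^sup>+ w. ennreal (f (real N * v k w)) \<partial>M) \<le> ennreal (\<Sum>k. (1/2) ^ k) + (\<Sum>k<N. b k)" .
      also have "\<dots> < \<infinity>"
      proof -
        have "b k < \<top>" for k using int_fin[of "N * k"] by (simp add: b_def)
        then show ?thesis by auto
      qed
      finally show "(\<Sum>k. \<integral>\<^sup>+ w. ennreal (f (real N * v k w)) \<partial>M) < \<infinity>" .
    qed (use v_nonneg in auto)
    then obtain y where y: "y \<in> heart" "\<And>k. AE w in M. v k w \<le> y w" by auto
    have xy: "(\<lambda>w. x w - y w) \<in> heart" using heart_affine[OF x y(1), of 1 "-1"] by simp
    \<comment> \<open>\<open>Suc k\<close> rather than \<open>k\<close>, since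
      \<open>rho_scale\<close> asks for a factor of at least 1.\<close>
    have "AE w in M. w \<in> A \<longrightarrow> real (Suc k) * \<epsilon> \<le> \<rho> (\<lambda>w. x w - y w) w - \<rho> x w" for k
    proof -
      have "AE w in M. w \<in> A \<longrightarrow> \<rho> (\<lambda>w. x w - real (Suc k) * z (r (Suc k)) w) w \<le> \<rho> (\<lambda>w. x w - y w) w"
      proof (rule rho_antimono_on[OF xy xz A_F])
        show "AE w in M. w \<in> A \<longrightarrow> x w - y w \<le> x w - real (Suc k) * z (r (Suc k)) w"
          using y(2)[of "Suc k"] by eventually_elim (auto simp: v_def)
      qed
      moreover have "AE w in M. real (Suc k) * (\<rho> (\<lambda>w. x w + - z (r (Suc k)) w) w - \<rho> x w)
          \<le> \<rho> (\<lambda>w. x w + real (Suc k) * - z (r (Suc k)) w) w - \<rho> x w"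
        by (rule rho_scale[OF x]) (use heart_affine[OF x z, of 0 "-1"] in auto)
      ultimately show ?thesis
      proof eventually_elim
        case (elim w)
        show ?case
        proof
          assume "w \<in> A"
          then have "\<epsilon> \<le> \<rho> (\<lambda>w. x w - z (r (Suc k)) w) w - \<rho> x w" by (auto simp: A_def C_def)
          then have "real (Suc k) * \<epsilon> \<le> real (Suc k) * (\<rho> (\<lambda>w. x w - z (r (Suc k)) w) w - \<rho> x w)"
            by (intro mult_left_mono) auto
          also have "\<dots> \<le> \<rho> (\<lambda>w. x w - real (Suc k) * z (r (Suc k)) w) w - \<rho> x w"
            using elim(2) by (simp del: of_nat_Suc)
          also have "\<dots> \<le> \<rho> (\<lambda>w. x w - y w) w - \<rho> x w"
            using elim(1) \<open>w \<in> A\<close> by (simp del: of_nat_Suc)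
          finally show "real (Suc k) * \<epsilon> \<le> \<rho> (\<lambda>w. x w - y w) w - \<rho> x w" .
        qed
      qed
    qed
    then have "AE w in M. \<forall>k. w \<in> A \<longrightarrow> real (Suc k) * \<epsilon> \<le> \<rho> (\<lambda>w. x w - y w) w - \<rho> x w"
      by (simp only: AE_all_countable) simp
    then have "AE w in M. w \<notin> A"
    proof eventually_elim
      case (elim w)
      show ?case
      proof
        assume "w \<in> A"
        obtain k :: nat where "\<rho> (\<lambda>w. x w - y w) w - \<rho> x w < real k * \<epsilon>"
          using \<epsilon> by (metis ex_less_of_nat_mult)
        also have "\<dots> \<le> real (Suc k) * \<epsilon>" using \<epsilon> by (intro mult_right_mono) auto
        finally show False using elim \<open>w \<in> A\<close> by (metis not_less)
      qed
    qed
    then have "measure M A = 0" by (subst measure_eq_0_null_sets) (auto simp: AE_iff_null_sets[OF A_M])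
    with A_pos show False by simp
  qed
  then have "C \<in> null_sets M" using C_M by (auto simp: null_sets_def emeasure_eq_measure)
  then have "AE w in M. w \<notin> C" by (rule AE_not_in)
  with AE_space show ?thesis
    by eventually_elim (auto simp: C_def spaceF not_le)
qed

end

context conditional_risk
begin

text \<open>Reduction to a decreasing null sequence: \<open>z n\<close> is the supremum of the
  errors from \<open>n\<close> on, so \<open>xs n\<close> lies between \<open>x - z n\<close> and
  \<open>x + z n\<close>. By midpoint convexity the drop of \<open>\<rho>\<close> from
  \<open>x\<close> to \<open>x + z n\<close> is at most its rise from \<open>x\<close> to
  \<open>x - z n\<close>, and \<open>rho_decreasing_null\<close> makes that rise small.\<close>

lemma rho_lebesgue:
  assumes xs: "\<And>n. xs n \<in> heart" and x: "x \<in> heart" and y: "y \<in> heart"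
    and lim: "AE w in M. (\<lambda>n. xs n w) \<longlonglongrightarrow> x w"
    and bound: "\<And>n. AE w in M. \<bar>xs n w\<bar> \<le> y w"
  shows "AE w in M. (\<lambda>n. \<rho> (xs n) w) \<longlonglongrightarrow> \<rho> x w"
proof -
  note [measurable] = heart_measurable[OF x] heart_measurable[OF y] heart_measurable[OF xs]
  \<comment> \<open>A.s. the minimum is just \<open>\<bar>xs m w - x w\<bar>\<close>. The cut at
    \<open>\<bar>x w\<bar> + \<bar>y w\<bar>\<close> makes the real supremum in \<open>z\<close>
    well defined at every point, the exceptional null set included.\<close>
  define a where "a m w = min \<bar>xs m w - x w\<bar> (\<bar>x w\<bar> + \<bar>y w\<bar>)" for m w
  define z where "z n w = (SUP m\<in>{n..}. a m w)" for n w
  have a_nonneg: "0 \<le> a m w" for m w by (simp add: a_def)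
  have a_le: "a m w \<le> \<bar>x w\<bar> + \<bar>y w\<bar>" for m w by (simp add: a_def)
  have bdd: "bdd_above ((\<lambda>m. a m w) ` I)" for w I using a_le by (auto intro!: bdd_aboveI2)
  have [measurable]: "a m \<in> borel_measurable M" for m unfolding a_def by measurable
  have [measurable]: "z n \<in> borel_measurable M" for n
    unfolding z_def by (rule borel_measurable_cSUP) (use bdd in auto)
  have a_z: "a m w \<le> z n w" if "n \<le> m" for m n w
    unfolding z_def using that by (intro cSUP_upper bdd) auto
  have z_nonneg: "0 \<le> z n w" for n w using a_z[of n n w] a_nonneg[of n w] by simp
  have z_le: "z n w \<le> \<bar>x w\<bar> + \<bar>y w\<bar>" for n w
    unfolding z_def by (rule cSUP_least) (auto simp: a_le)
  have z_heart: "z n \<in> heart" for n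
    by (rule heart_dominated[OF _ x y]) (use z_nonneg z_le in auto)
  have z_dec: "z (Suc n) w \<le> z n w" for n w
    unfolding z_def by (rule cSUP_subset_mono) (use bdd in auto)
  have z_lim: "AE w in M. (\<lambda>n. z n w) \<longlonglongrightarrow> 0"
    using lim
  proof eventually_elim
    case (elim w)
    show ?case
    proof (rule LIMSEQ_I)
      fix r :: real assume r: "0 < r"
      then obtain N where N: "\<And>n. n \<ge> N \<Longrightarrow> norm (xs n w - x w) < r / 2"
        using LIMSEQ_D[OF elim, of "r / 2"] by auto
      have "z n w \<le> r / 2" if "n \<ge> N" for n
        unfolding z_def using that
      proof (intro cSUP_least)
        fix m assume "m \<in> {n..}"
        then have "\<bar>xs m w - x w\<bar> \<le> r / 2" using N[of m] that by auto
        then show "a m w \<le> r / 2" unfolding a_def by (rule min.coboundedI1)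
      qed auto
      then have "z n w < r" if "n \<ge> N" for n using that r by force
      then show "\<exists>N. \<forall>n\<ge>N. norm (z n w - 0) < r" using z_nonneg by (intro exI[of _ N]) simp
    qed
  qed
  have close: "AE w in M. \<bar>xs n w - x w\<bar> \<le> z n w" for n
  proof -
    have "AE w in M. \<forall>n. \<bar>xs n w\<bar> \<le> y w" using bound by (simp add: AE_all_countable)
    with lim show ?thesis
    proof eventually_elim
      case (elim w)
      have "\<bar>xs n w - x w\<bar> \<le> \<bar>x w\<bar> + \<bar>y w\<bar>" using elim(2)[rule_format, of n] by linarith
      then have "\<bar>xs n w - x w\<bar> = a n w" by (simp add: a_def)
      also have "\<dots> \<le> z n w" by (rule a_z) simp
      finally show ?case .
    qed
  qed
  have lo: "(\<lambda>w. x w - z n w) \<in> heart" for n using heart_affine[OF x z_heart, of 1 "-1"] by simp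
  have hi: "(\<lambda>w. x w + z n w) \<in> heart" for n using heart_affine[OF x z_heart, of 1 1] by simp
  have near: "AE w in M. \<bar>\<rho> (xs n) w - \<rho> x w\<bar> \<le> \<rho> (\<lambda>w. x w - z n w) w - \<rho> x w" for n
  proof -
    have 1: "AE w in M. \<rho> (xs n) w \<le> \<rho> (\<lambda>w. x w - z n w) w"
    proof (rule rho_antimono[OF lo xs])
      show "AE w in M. x w - z n w \<le> xs n w" using close[of n] by eventually_elim linarith
    qed
    have 2: "AE w in M. \<rho> (\<lambda>w. x w + z n w) w \<le> \<rho> (xs n) w"
    proof (rule rho_antimono[OF xs hi])
      show "AE w in M. xs n w \<le> x w + z n w" using close[of n] by eventually_elim linarith
    qed
    have "AE w in M. \<rho> (\<lambda>w. (1/2) * (x w - z n w) + (1 - 1/2) * (x w + z n w)) w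
       \<le> (1/2) * \<rho> (\<lambda>w. x w - z n w) w + (1 - 1/2) * \<rho> (\<lambda>w. x w + z n w) w"
      by (rule rho_convex[OF _ lo hi]) auto
    moreover have "(\<lambda>w. (1/2) * (x w - z n w) + (1 - 1/2) * (x w + z n w)) = x"
      by (auto simp: field_simps)
    ultimately have "AE w in M. \<rho> x w \<le> (1/2) * \<rho> (\<lambda>w. x w - z n w) w + (1/2) * \<rho> (\<lambda>w. x w + z n w) w"
      by simp
    with 1 2 show ?thesis by eventually_elim linarith
  qed
  have dec: "AE w in M. \<rho> (\<lambda>w. x w - z (Suc n) w) w \<le> \<rho> (\<lambda>w. x w - z n w) w" for n
    by (rule rho_antimono[OF lo lo]) (auto simp: z_dec)
  have small: "AE w in M. \<forall>k::nat. \<exists>n. \<rho> (\<lambda>w. x w - z n w) w - \<rho> x w < 1 / real (Suc k)"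
    unfolding AE_all_countable
    by (intro allI rho_decreasing_null[OF x z_heart z_nonneg z_dec z_lim]) simp
  have "AE w in M. \<forall>n. \<bar>\<rho> (xs n) w - \<rho> x w\<bar> \<le> \<rho> (\<lambda>w. x w - z n w) w - \<rho> x w"
    "AE w in M. \<forall>n. \<rho> (\<lambda>w. x w - z (Suc n) w) w \<le> \<rho> (\<lambda>w. x w - z n w) w"
    using near dec by (simp_all add: AE_all_countable)
  with small show ?thesis
  proof eventually_elim
    case (elim w)
    have dq: "decseq (\<lambda>n. \<rho> (\<lambda>w. x w - z n w) w)" using elim(3) by (intro decseq_SucI) auto
    show ?case
    proof (rule LIMSEQ_I)
      fix r :: real assume "0 < r"
      then obtain k :: nat where k: "1 / real (Suc k) < r" using reals_Archimedean by (auto simp: inverse_eq_divide)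
      obtain N where N: "\<rho> (\<lambda>w. x w - z N w) w - \<rho> x w < 1 / real (Suc k)" using elim(1) by blast
      show "\<exists>N. \<forall>n\<ge>N. norm (\<rho> (xs n) w - \<rho> x w) < r"
      proof (intro exI[of _ N] allI impI)
        fix n assume "N \<le> n"
        then have "\<rho> (\<lambda>w. x w - z n w) w \<le> \<rho> (\<lambda>w. x w - z N w) w" using decseqD[OF dq] by blast
        then show "norm (\<rho> (xs n) w - \<rho> x w) < r" using elim(2)[rule_format, of n] N k by simp
      qed
    qed
  qed
qed

end

section \<open>A Hahn--Banach theorem for spaces of functions\<close>

definition function_subspace :: "('a \<Rightarrow> real) set \<Rightarrow> bool" where
  "function_subspace S \<longleftrightarrow> (\<lambda>_. 0) \<in> S \<and> (\<forall>a b. \<forall>u\<in>S. \<forall>v\<in>S. (\<lambda>w. a * u w + b * v w) \<in> S)"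

definition function_convex_on :: "('a \<Rightarrow> real) set \<Rightarrow> (('a \<Rightarrow> real) \<Rightarrow> real) \<Rightarrow> bool" where
  "function_convex_on S q \<longleftrightarrow> (\<forall>t\<in>{0..1}. \<forall>u\<in>S. \<forall>v\<in>S.
     q (\<lambda>w. t * u w + (1 - t) * v w) \<le> t * q u + (1 - t) * q v)"

definition function_linear_on :: "('a \<Rightarrow> real) set \<Rightarrow> (('a \<Rightarrow> real) \<Rightarrow> real) \<Rightarrow> bool" where
  "function_linear_on S l \<longleftrightarrow> (\<forall>a b. \<forall>u\<in>S. \<forall>v\<in>S. l (\<lambda>w. a * u w + b * v w) = a * l u + b * l v)"

text \<open>A minimal convex function below \<open>p\<close> vanishing at \<open>0\<close> is linear, because the two
  operations below that lower a convex function cannot change it.\<close>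

lemma function_Hahn_Banach:
  fixes p :: "('a \<Rightarrow> real) \<Rightarrow> real"
  assumes S: "function_subspace S" and p: "function_convex_on S p" "p (\<lambda>_. 0) = 0"
  shows "\<exists>l. function_linear_on S l \<and> (\<forall>u\<in>S. l u \<le> p u)"
proof -
  \<comment> \<open>Values off \<open>S\<close> are pinned to 0; otherwise they could be lowered
    without end and the pointwise order would have no minimal element.\<close>
  define K where "K = {q. function_convex_on S q \<and> q (\<lambda>_. 0) = 0 \<and> (\<forall>u\<in>S. q u \<le> p u) \<and> (\<forall>u. u \<notin> S \<longrightarrow> q u = 0)}"
  have S0: "(\<lambda>_. 0) \<in> S" using S by (simp add: function_subspace_def)
  have Slin: "(\<lambda>w. a * u w + b * v w) \<in> S" if "u \<in> S" "v \<in> S" for a b u v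
    using S that by (simp add: function_subspace_def)
  have Sscale: "(\<lambda>w. a * u w) \<in> S" if "u \<in> S" for a u using Slin[OF that that, of a 0] by simp
  have Sminus: "(\<lambda>w. - u w) \<in> S" if "u \<in> S" for u using Sscale[OF that, of "-1"] by simp
  have cvx: "q (\<lambda>w. t * u w + (1 - t) * v w) \<le> t * q u + (1 - t) * q v"
    if "q \<in> K" "0 \<le> t" "t \<le> 1" "u \<in> S" "v \<in> S" for q t u v
    using that by (auto simp: K_def function_convex_on_def)
  have K0: "q (\<lambda>_. 0) = 0" if "q \<in> K" for q using that by (simp add: K_def)
  have Kp: "q u \<le> p u" if "q \<in> K" "u \<in> S" for q u using that by (simp add: K_def)
  have neg: "- q u \<le> q (\<lambda>w. - u w)" if "q \<in> K" "u \<in> S" for q u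
    using cvx[OF that(1), of "1/2" u "\<lambda>w. - u w"] that Sminus K0[OF that(1)] by simp
  \<comment> \<open>Convexity between \<open>u\<close> and \<open>- u\<close>, together with value 0
    at the origin, bounds all members of \<open>K\<close> from below in terms of \<open>p\<close>
    alone. Infima over chains are therefore finite.\<close>
  have lower: "- p (\<lambda>w. - u w) \<le> q u" if "q \<in> K" "u \<in> S" for q u
    using neg[OF that(1) Sminus[OF that(2)]] Kp[OF that(1) Sminus[OF that(2)]] by simp
  define r where "r = {(q, q'). q \<in> K \<and> q' \<in> K \<and> q' \<le> q}"
  have FieldK: "Field r = K" by (auto simp: r_def Field_def)
  have "\<exists>m\<in>Field r. \<forall>q\<in>Field r. (m, q) \<in> r \<longrightarrow> q = m"
  proof (rule Zorns_po_lemma)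
    show "Partial_order r"
      unfolding order_on_defs FieldK
      by (auto simp: r_def refl_on_def trans_def antisym_def intro: order.trans order.antisym)
    fix C assume C: "C \<in> Chains r"
    show "\<exists>u\<in>Field r. \<forall>q\<in>C. (q, u) \<in> r"
    proof (cases "C = {}")
      case True
      have "(\<lambda>u. if u \<in> S then p u else 0) \<in> K"
        using p S0 Slin by (auto simp: K_def function_convex_on_def)
      then show ?thesis using True FieldK by blast
    next
      case False
      have CK: "q \<in> K" if "q \<in> C" for q using C that by (auto simp: Chains_def r_def)
      have chain: "q \<le> q' \<or> q' \<le> q" if "q \<in> C" "q' \<in> C" for q q' using C that by (auto simp: Chains_def r_def)
      \<comment> \<open>The infimum of a chain is convex because the smaller of \<open>q\<close> and
        \<open>q'\<close> lies below both: this gives \<open>key\<close> with independent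
        \<open>q\<close> and \<open>q'\<close>. The infimum is then taken in one of them at a time,
        dividing by \<open>t\<close> and by \<open>1 - t\<close>, whence the separate endpoint
        cases.\<close>
      define m where "m u = (if u \<in> S then INF q\<in>C. q u else 0)" for u
      have bdd: "bdd_below ((\<lambda>q. q u) ` C)" if "u \<in> S" for u
        using lower[OF CK that] by (auto intro!: bdd_belowI2)
      have m_le: "m u \<le> q u" if "q \<in> C" "u \<in> S" for q u
        unfolding m_def using that by (auto intro!: cINF_lower bdd)
      have "m \<in> K"
        unfolding K_def function_convex_on_def
      proof (intro CollectI conjI ballI allI impI)
        fix t :: real and u v assume t: "t \<in> {0..1}" and u: "u \<in> S" and v: "v \<in> S"
        let ?c = "\<lambda>w. t * u w + (1 - t) * v w"
        have cS: "?c \<in> S" using Slin[OF u v] .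
        have key: "m ?c \<le> t * q u + (1 - t) * q' v" if q: "q \<in> C" and q': "q' \<in> C" for q q'
        proof -
          obtain s where s: "s \<in> C" "s \<le> q" "s \<le> q'" using chain[OF q q'] q q' by blast
          have "m ?c \<le> s ?c" by (rule m_le[OF s(1) cS])
          also have "\<dots> \<le> t * s u + (1 - t) * s v" using cvx[OF CK[OF s(1)] _ _ u v] t by simp
          also have "\<dots> \<le> t * q u + (1 - t) * q' v"
            using t s by (intro add_mono mult_left_mono) (auto simp: le_fun_def)
          finally show ?thesis .
        qed
        have key2: "m ?c - (1 - t) * q' v \<le> t * m u" if q': "q' \<in> C" for q'
        proof (cases "t = 0")
          case True
          obtain q where "q \<in> C" using False by blast
          then show ?thesis using key[OF _ q', of q] True by simp
        next
          case tpos: False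
          then have t0: "t > 0" using t by simp
          have "(m ?c - (1 - t) * q' v) / t \<le> m u"
            unfolding m_def[of u] if_P[OF u]
          proof (intro cINF_greatest[OF False])
            fix q assume "q \<in> C"
            from key[OF this q'] t0 show "(m ?c - (1 - t) * q' v) / t \<le> q u"
              by (simp add: field_simps)
          qed
          then show ?thesis using t0 by (simp add: field_simps)
        qed
        show "m ?c \<le> t * m u + (1 - t) * m v"
        proof (cases "t = 1")
          case True
          obtain q where "q \<in> C" using False by blast
          then show ?thesis using key2[of q] True by simp
        next
          case tn: False
          then have t0: "1 - t > 0" using t by simp
          have "(m ?c - t * m u) / (1 - t) \<le> m v"
            unfolding m_def[of v] if_P[OF v]
          proof (intro cINF_greatest[OF False])
            fix q assume "q \<in> C"
            from key2[OF this] t0 show "(m ?c - t * m u) / (1 - t) \<le> q v"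
              by (simp add: field_simps)
          qed
          then show ?thesis using t0 by (simp add: field_simps)
        qed
      next
        have "(INF q\<in>C. q (\<lambda>_. 0)) = (INF q\<in>C. 0)" using K0[OF CK] by (intro INF_cong) auto
        then show "m (\<lambda>_. 0) = 0" unfolding m_def using S0 False by simp
      next
        fix u assume u: "u \<in> S"
        obtain q where "q \<in> C" using False by blast
        then show "m u \<le> p u" using m_le[OF _ u] Kp[OF CK _, OF _ u] by (meson order.trans)
      qed (simp add: m_def)
      moreover have "m \<le> q" if "q \<in> C" for q
      proof (rule le_funI)
        show "m u \<le> q u" for u
          using m_le[OF that] CK[OF that] by (cases "u \<in> S") (auto simp: m_def K_def)
      qed
      ultimately show ?thesis unfolding FieldK using CK by (intro bexI[of _ m]) (auto simp: r_def)
    qed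
  qed
  then obtain q where q: "q \<in> K" and min: "\<And>q'. q' \<in> K \<Longrightarrow> q' \<le> q \<Longrightarrow> q' = q"
    unfolding FieldK by (auto simp: r_def)
  have hom_ge1: "t * q u = q (\<lambda>w. t * u w)" if t: "1 \<le> t" and u: "u \<in> S" for t u
  proof -
    \<comment> \<open>First lowering operation: for \<open>t \<ge> 1\<close>, convexity towards 0
      gives \<open>t * q (u / t) \<le> q u\<close>. Minimality turns this into equality, which is
      positive homogeneity.\<close>
    define q' where "q' u = (if u \<in> S then t * q (\<lambda>w. (1/t) * u w) else 0)" for u
    have le: "q' u \<le> q u" if u: "u \<in> S" for u
    proof -
      have "q (\<lambda>w. (1/t) * u w + (1 - 1/t) * 0) \<le> (1/t) * q u + (1 - 1/t) * q (\<lambda>_. 0)"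
        using t by (intro cvx[OF q _ _ u S0]) auto
      then have "q (\<lambda>w. (1/t) * u w) \<le> (1/t) * q u" using K0[OF q] by simp
      then have "t * q (\<lambda>w. (1/t) * u w) \<le> t * ((1/t) * q u)" using t by (intro mult_left_mono) auto
      then show ?thesis using t u by (simp add: q'_def)
    qed
    have "q' \<in> K"
      unfolding K_def function_convex_on_def
    proof (intro CollectI conjI ballI allI impI)
      fix s :: real and u v assume s: "s \<in> {0..1}" and u: "u \<in> S" and v: "v \<in> S"
      have "q (\<lambda>w. s * ((1/t) * u w) + (1 - s) * ((1/t) * v w)) \<le> s * q (\<lambda>w. (1/t) * u w) + (1 - s) * q (\<lambda>w. (1/t) * v w)"
        using s by (intro cvx[OF q] Sscale u v) auto
      moreover have "(\<lambda>w. s * ((1/t) * u w) + (1 - s) * ((1/t) * v w)) = (\<lambda>w. (1/t) * (s * u w + (1 - s) * v w))"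
        using t by (intro ext) (simp add: field_simps)
      ultimately have "t * q (\<lambda>w. (1/t) * (s * u w + (1 - s) * v w)) \<le> t * (s * q (\<lambda>w. (1/t) * u w) + (1 - s) * q (\<lambda>w. (1/t) * v w))"
        using t by (intro mult_left_mono) auto
      then show "q' (\<lambda>w. s * u w + (1 - s) * v w) \<le> s * q' u + (1 - s) * q' v"
        unfolding q'_def if_P[OF u] if_P[OF v] if_P[OF Slin[OF u v]] by (simp add: algebra_simps)
    next
      fix u assume "u \<in> S"
      then show "q' u \<le> p u" using le Kp[OF q] by (meson order.trans)
    qed (auto simp: q'_def S0 K0[OF q])
    moreover have "q' \<le> q"
    proof (rule le_funI)
      show "q' u \<le> q u" for u using le q by (cases "u \<in> S") (auto simp: q'_def K_def)
    qed
    ultimately have "q' = q" by (rule min)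
    then have "q (\<lambda>w. t * u w) = q' (\<lambda>w. t * u w)" by simp
    also have "\<dots> = t * q u" using t Sscale[OF u] by (simp add: q'_def)
    finally show ?thesis by simp
  qed
  have hom: "q (\<lambda>w. t * u w) = t * q u" if t: "0 < t" and u: "u \<in> S" for t u
  proof (cases "1 \<le> t")
    case True
    then show ?thesis using hom_ge1[OF True u] by simp
  next
    case False
    have "(1/t) * q (\<lambda>w. t * u w) = q (\<lambda>w. (1/t) * (t * u w))"
      using t False by (intro hom_ge1 Sscale u) auto
    also have "(\<lambda>w. (1/t) * (t * u w)) = u" using t by auto
    finally show ?thesis using t by (simp add: field_simps)
  qed
  have subadd: "q (\<lambda>w. u w + v w) \<le> q u + q v" if u: "u \<in> S" and v: "v \<in> S" for u v
  proof -
    have "q (\<lambda>w. (1/2) * (2 * u w) + (1 - 1/2) * (2 * v w)) \<le> (1/2) * q (\<lambda>w. 2 * u w) + (1 - 1/2) * q (\<lambda>w. 2 * v w)"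
      by (intro cvx[OF q] Sscale u v) auto
    then show ?thesis using hom[of 2 u] hom[of 2 v] u v by simp
  qed
  have add: "q (\<lambda>w. u w + v w) = q u + q v" if u: "u \<in> S" and v: "v \<in> S" for u v
  proof -
    \<comment> \<open>Second lowering operation. The value at \<open>t = 0\<close> shows
      \<open>q' \<le> q\<close>; once minimality gives \<open>q' = q\<close>, the value at
      \<open>t = 1\<close> reads \<open>q u \<le> q (u + v) - q v\<close>, the inequality that
      sublinearity lacks for additivity.\<close>
    define q' where "q' u = (if u \<in> S then INF t\<in>{0..}. q (\<lambda>w. u w + t * v w) - t * q v else 0)" for u
    have Sadd: "(\<lambda>w. u w + t * v w) \<in> S" if "u \<in> S" for u t using Slin[OF that v, of 1 t] by simp
    have lb: "- q (\<lambda>w. - u w) \<le> q (\<lambda>w. u w + t * v w) - t * q v" if u: "u \<in> S" and t: "0 \<le> t" for u t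
    proof (cases "t = 0")
      case True
      then show ?thesis using neg[OF q Sminus[OF u]] by simp
    next
      case False
      then have "t * q v = q (\<lambda>w. t * v w)" using hom[OF _ v, of t] t by simp
      also have "\<dots> = q (\<lambda>w. (u w + t * v w) + - u w)" by (simp add: algebra_simps)
      also have "\<dots> \<le> q (\<lambda>w. u w + t * v w) + q (\<lambda>w. - u w)"
        by (rule subadd[OF Sadd[OF u] Sminus[OF u]])
      finally show ?thesis by simp
    qed
    have bdd: "bdd_below ((\<lambda>t. q (\<lambda>w. u w + t * v w) - t * q v) ` {0..})" if "u \<in> S" for u
      using lb[OF that] by (auto intro!: bdd_belowI2)
    have q'_le: "q' u \<le> q (\<lambda>w. u w + t * v w) - t * q v" if "u \<in> S" "0 \<le> t" for u t
      unfolding q'_def using that by (auto intro!: cINF_lower bdd)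
    have q'_q: "q' u \<le> q u" if "u \<in> S" for u using q'_le[OF that, of 0] by simp
    have "q' \<in> K"
      unfolding K_def function_convex_on_def
    proof (intro CollectI conjI ballI allI impI)
      fix s :: real and a b assume s: "s \<in> {0..1}" and a: "a \<in> S" and b: "b \<in> S"
      let ?c = "\<lambda>w. s * a w + (1 - s) * b w"
      let ?h = "\<lambda>u t. q (\<lambda>w. u w + t * v w) - t * q v"
      have cS: "?c \<in> S" using Slin[OF a b] .
      have key: "q' ?c \<le> s * ?h a t + (1 - s) * ?h b t'" if t: "0 \<le> t" "0 \<le> t'" for t t'
      proof -
        have "q' ?c \<le> ?h ?c (s * t + (1 - s) * t')" using s t by (intro q'_le[OF cS]) auto
        also have "(\<lambda>w. ?c w + (s * t + (1 - s) * t') * v w) = (\<lambda>w. s * (a w + t * v w) + (1 - s) * (b w + t' * v w))"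
          by (auto simp: algebra_simps)
        also have "q \<dots> \<le> s * q (\<lambda>w. a w + t * v w) + (1 - s) * q (\<lambda>w. b w + t' * v w)"
          using s by (intro cvx[OF q] Sadd a b) auto
        finally show ?thesis by (simp add: algebra_simps)
      qed
      have key2: "q' ?c - (1 - s) * ?h b t' \<le> s * q' a" if t': "0 \<le> t'" for t'
      proof (cases "s = 0")
        case True
        then show ?thesis using key[of 0 t'] t' by simp
      next
        case False
        then have s0: "s > 0" using s by simp
        have "(q' ?c - (1 - s) * ?h b t') / s \<le> q' a"
          unfolding q'_def[of a] if_P[OF a]
        proof (intro cINF_greatest)
          fix t :: real assume "t \<in> {0..}"
          with key[of t t'] t' s0 show "(q' ?c - (1 - s) * ?h b t') / s \<le> ?h a t"
            by (simp add: pos_divide_le_eq mult.commute)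
        qed simp
        then show ?thesis using s0 by (simp add: pos_divide_le_eq mult.commute)
      qed
      show "q' ?c \<le> s * q' a + (1 - s) * q' b"
      proof (cases "s = 1")
        case True
        then show ?thesis using key2[of 0] by simp
      next
        case False
        then have s0: "1 - s > 0" using s by simp
        have "(q' ?c - s * q' a) / (1 - s) \<le> q' b"
          unfolding q'_def[of b] if_P[OF b]
        proof (intro cINF_greatest)
          fix t :: real assume "t \<in> {0..}"
          with key2[of t] s0 show "(q' ?c - s * q' a) / (1 - s) \<le> ?h b t"
            by (simp add: pos_divide_le_eq mult.commute)
        qed simp
        then show ?thesis using s0 by (simp add: pos_divide_le_eq mult.commute)
      qed
    next
      have "0 \<le> q' (\<lambda>_. 0)"
        unfolding q'_def if_P[OF S0] using lb[OF S0] K0[OF q] by (intro cINF_greatest) auto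
      then show "q' (\<lambda>_. 0) = 0" using q'_q[OF S0] K0[OF q] by simp
    next
      fix u assume "u \<in> S"
      then show "q' u \<le> p u" using q'_q Kp[OF q] by (meson order.trans)
    qed (auto simp: q'_def)
    moreover have "q' \<le> q"
    proof (rule le_funI)
      show "q' u \<le> q u" for u using q'_q q by (cases "u \<in> S") (auto simp: q'_def K_def)
    qed
    ultimately have "q' = q" by (rule min)
    then have "q u \<le> q (\<lambda>w. u w + v w) - q v" using q'_le[OF u, of 1] by simp
    then show ?thesis using subadd[OF u v] by simp
  qed
  have minus: "q (\<lambda>w. - u w) = - q u" if u: "u \<in> S" for u
    using add[OF u Sminus[OF u]] K0[OF q] by simp
  have homog: "q (\<lambda>w. t * u w) = t * q u" if u: "u \<in> S" for t u
  proof -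
    consider "t > 0" | "t = 0" | "t < 0" by linarith
    then show ?thesis
    proof cases
      case 3
      have "q (\<lambda>w. - (- t * u w)) = - (- t * q u)"
        using minus[OF Sscale[OF u, of "- t"]] hom[OF _ u, of "- t"] 3 by simp
      then show ?thesis by simp
    qed (use hom u K0[OF q] in auto)
  qed
  have "function_linear_on S q"
    unfolding function_linear_on_def using add[OF Sscale Sscale] homog by simp
  then show ?thesis using Kp[OF q] by blast
qed

section \<open>Subgradients represented by densities\<close>

context conditional_risk
begin

text \<open>The domain of the scalar functional: increments along these functions are bounded, hence
  integrable. Bounds hold everywhere on the space, so that they pass to parts of a function
  pointwise.\<close>

definition bfun :: "('a \<Rightarrow> real) set" where
  "bfun = {u \<in> borel_measurable M. \<exists>c. \<forall>w\<in>space M. \<bar>u w\<bar> \<le> c}"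

definition increment :: "('a \<Rightarrow> real) \<Rightarrow> ('a \<Rightarrow> real) \<Rightarrow> 'a \<Rightarrow> real" where
  "increment x u w = \<rho> (\<lambda>w. x w + u w) w - \<rho> x w"

lemma bfunI: "u \<in> borel_measurable M \<Longrightarrow> (\<And>w. w \<in> space M \<Longrightarrow> \<bar>u w\<bar> \<le> c) \<Longrightarrow> u \<in> bfun"
  unfolding bfun_def by auto

lemma bfun_measurable: "u \<in> bfun \<Longrightarrow> u \<in> borel_measurable M"
  unfolding bfun_def by auto

lemma bfun_bound:
  assumes "u \<in> bfun" obtains c where "\<And>w. w \<in> space M \<Longrightarrow> \<bar>u w\<bar> \<le> c"
  using assms by (auto simp: bfun_def)

lemma bfun_heart:
  assumes u: "u \<in> bfun" shows "u \<in> heart"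
proof -
  obtain c where "\<And>w. w \<in> space M \<Longrightarrow> \<bar>u w\<bar> \<le> c" using bfun_bound[OF u] by blast
  then show ?thesis by (intro heart_bounded[of _ c] bfun_measurable u) auto
qed

lemma bfun_subspace: "function_subspace bfun"
  unfolding function_subspace_def
proof (intro conjI allI ballI)
  show "(\<lambda>_. 0) \<in> bfun" by (rule bfunI[of _ 0]) auto
  fix a b u v assume u: "u \<in> bfun" and v: "v \<in> bfun"
  note [measurable] = bfun_measurable[OF u] bfun_measurable[OF v]
  obtain c where c: "\<And>w. w \<in> space M \<Longrightarrow> \<bar>u w\<bar> \<le> c" using bfun_bound[OF u] by blast
  obtain d where d: "\<And>w. w \<in> space M \<Longrightarrow> \<bar>v w\<bar> \<le> d" using bfun_bound[OF v] by blast
  show "(\<lambda>w. a * u w + b * v w) \<in> bfun"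
  proof (rule bfunI)
    fix w assume w: "w \<in> space M"
    have "\<bar>a * u w + b * v w\<bar> \<le> \<bar>a\<bar> * \<bar>u w\<bar> + \<bar>b\<bar> * \<bar>v w\<bar>" by (metis abs_mult abs_triangle_ineq)
    also have "\<dots> \<le> \<bar>a\<bar> * c + \<bar>b\<bar> * d" using c[OF w] d[OF w] by (intro add_mono mult_left_mono) auto
    finally show "\<bar>a * u w + b * v w\<bar> \<le> \<bar>a\<bar> * c + \<bar>b\<bar> * d" .
  qed auto
qed

lemma bfun_linear: "u \<in> bfun \<Longrightarrow> v \<in> bfun \<Longrightarrow> (\<lambda>w. a * u w + b * v w) \<in> bfun"
  using bfun_subspace unfolding function_subspace_def by blast

lemma bfun_mult_integrable:
  assumes u: "u \<in> bfun" and g: "integrable M g"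
  shows "integrable M (\<lambda>w. u w * g w)"
proof -
  note [measurable] = bfun_measurable[OF u] borel_measurable_integrable[OF g]
  obtain c where c: "\<And>w. w \<in> space M \<Longrightarrow> \<bar>u w\<bar> \<le> c" using bfun_bound[OF u] by blast
  show ?thesis
  proof (rule Bochner_Integration.integrable_bound)
    show "integrable M (\<lambda>w. c * g w)" using g by simp
    show "AE w in M. norm (u w * g w) \<le> norm (c * g w)"
      using c by (intro AE_I2) (force simp: abs_mult intro!: mult_right_mono)
  qed auto
qed

lemma heart_plus: "x \<in> heart \<Longrightarrow> y \<in> heart \<Longrightarrow> (\<lambda>w. x w + y w) \<in> heart"
  using heart_affine[of x y 1 1] by simp

lemma increment_measurable_F:
  "x \<in> heart \<Longrightarrow> u \<in> heart \<Longrightarrow> increment x u \<in> borel_measurable F"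
  unfolding increment_def using rho_measurable_F heart_plus by (intro borel_measurable_diff) auto

lemma increment_measurable:
  "x \<in> heart \<Longrightarrow> u \<in> heart \<Longrightarrow> increment x u \<in> borel_measurable M"
  using increment_measurable_F measurable_from_subalg subalg by blast

lemma increment_antimono:
  assumes "x \<in> heart" "u \<in> heart" "v \<in> heart" "AE w in M. u w \<le> v w"
  shows "AE w in M. increment x v w \<le> increment x u w"
  using rho_antimono[OF heart_plus[OF assms(1,2)] heart_plus[OF assms(1,3)]] assms(4)
  by (auto simp: increment_def)

lemma increment_zero: "increment x (\<lambda>_. 0) = (\<lambda>_. 0)"
  by (auto simp: increment_def)

lemma increment_const:
  assumes "x \<in> heart" shows "AE w in M. increment x (\<lambda>_. c) w = - c"
  using rho_cash[of "\<lambda>_. c" x] assms by (auto simp: increment_def)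

text \<open>Monotonicity compares \<open>u\<close> with the constants \<open>c\<close> and
  \<open>- c\<close>, whose increments are \<open>- c\<close> and \<open>c\<close> by cash
  invariance.\<close>

lemma increment_bounded:
  assumes x: "x \<in> heart" and u: "u \<in> borel_measurable M" and c: "AE w in M. \<bar>u w\<bar> \<le> c"
  shows "AE w in M. \<bar>increment x u w\<bar> \<le> c"
proof -
  have uh: "u \<in> heart" by (rule heart_bounded[OF u c])
  have ch: "(\<lambda>_. d) \<in> heart" for d by (rule heart_bounded[of _ "\<bar>d\<bar>"]) auto
  have 1: "AE w in M. increment x (\<lambda>_. c) w \<le> increment x u w"
  proof (rule increment_antimono[OF x uh ch])
    show "AE w in M. u w \<le> c" using c by eventually_elim simp
  qed
  have 2: "AE w in M. increment x u w \<le> increment x (\<lambda>_. - c) w"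
  proof (rule increment_antimono[OF x ch uh])
    show "AE w in M. - c \<le> u w" using c by eventually_elim simp
  qed
  from 1 2 increment_const[OF x, of c] increment_const[OF x, of "- c"] show ?thesis
    by eventually_elim simp
qed

lemma increment_integrable:
  assumes x: "x \<in> heart" and u: "u \<in> bfun"
  shows "integrable M (increment x u)"
proof -
  obtain c where c: "\<And>w. w \<in> space M \<Longrightarrow> \<bar>u w\<bar> \<le> c" using bfun_bound[OF u] by blast
  have "AE w in M. \<bar>increment x u w\<bar> \<le> c"
    by (rule increment_bounded[OF x bfun_measurable[OF u]]) (use c in auto)
  then show ?thesis
    by (intro integrable_const_bound[where B = c] increment_measurable x bfun_heart u) simp
qed

lemma increment_lebesgue:
  assumes x: "x \<in> heart" and us: "\<And>n. us n \<in> heart" and u: "u \<in> heart" and y: "y \<in> heart"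
    and lim: "AE w in M. (\<lambda>n. us n w) \<longlonglongrightarrow> u w" and bound: "\<And>n. AE w in M. \<bar>us n w\<bar> \<le> y w"
  shows "AE w in M. (\<lambda>n. increment x (us n) w) \<longlonglongrightarrow> increment x u w"
proof -
  have "AE w in M. (\<lambda>n. \<rho> (\<lambda>w. x w + us n w) w) \<longlonglongrightarrow> \<rho> (\<lambda>w. x w + u w) w"
  proof (rule rho_lebesgue)
    show "(\<lambda>w. \<bar>x w\<bar> + \<bar>y w\<bar>) \<in> heart" by (rule heart_abs_add[OF x y])
    show "AE w in M. (\<lambda>n. x w + us n w) \<longlonglongrightarrow> x w + u w"
      using lim by eventually_elim (intro tendsto_intros)
    show "AE w in M. \<bar>x w + us n w\<bar> \<le> \<bar>x w\<bar> + \<bar>y w\<bar>" for n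
      using bound[of n] by eventually_elim linarith
  qed (auto intro!: heart_plus x u us)
  then show ?thesis
    unfolding increment_def by eventually_elim (intro tendsto_intros)
qed

text \<open>Conditional convexity with constant coefficients integrates to scalar convexity, so no
  version of Hahn--Banach over \<open>F\<close>-measurable scalars enters; the conditional
  inequality is recovered later in \<open>conditional_subgradient\<close>.\<close>

lemma dominated_linear_functional:
  assumes x: "x \<in> heart"
  shows "\<exists>l. function_linear_on bfun l \<and> (\<forall>u\<in>bfun. l u \<le> (\<integral>w. increment x u w \<partial>M))"
proof (rule function_Hahn_Banach[OF bfun_subspace])
  show "function_convex_on bfun (\<lambda>u. \<integral>w. increment x u w \<partial>M)"
    unfolding function_convex_on_def
  proof (intro ballI)
    fix t :: real and u v assume t: "t \<in> {0..1}" and u: "u \<in> bfun" and v: "v \<in> bfun"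
    let ?c = "\<lambda>w. t * u w + (1 - t) * v w"
    have "AE w in M. \<rho> (\<lambda>w. t * (x w + u w) + (1 - t) * (x w + v w)) w
        \<le> t * \<rho> (\<lambda>w. x w + u w) w + (1 - t) * \<rho> (\<lambda>w. x w + v w) w"
      using t by (intro rho_convex heart_plus x bfun_heart u v) auto
    moreover have "(\<lambda>w. t * (x w + u w) + (1 - t) * (x w + v w)) = (\<lambda>w. x w + ?c w)"
      by (auto simp: algebra_simps)
    ultimately have "AE w in M. increment x ?c w \<le> t * increment x u w + (1 - t) * increment x v w"
      by (simp add: increment_def algebra_simps)
    then have "(\<integral>w. increment x ?c w \<partial>M) \<le> (\<integral>w. t * increment x u w + (1 - t) * increment x v w \<partial>M)"
      by (intro integral_mono_AE increment_integrable x bfun_linear u v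
          Bochner_Integration.integrable_add integrable_mult_right)
    also have "\<dots> = t * (\<integral>w. increment x u w \<partial>M) + (1 - t) * (\<integral>w. increment x v w \<partial>M)"
      by (subst Bochner_Integration.integral_add) (auto intro!: increment_integrable x u v)
    finally show "(\<integral>w. increment x ?c w \<partial>M) \<le> t * (\<integral>w. increment x u w \<partial>M) + (1 - t) * (\<integral>w. increment x v w \<partial>M)" .
  qed
qed (simp add: increment_zero)

text \<open>Since \<open>\<rho>\<close> is decreasing, \<open>l\<close> is nonpositive on
  nonnegative functions and \<open>- l\<close> of indicators is a measure; hence the minus sign
  before the integral. Countable additivity, absolute continuity and the passage from indicators to
  bounded functions all come from \<open>l_lim\<close>, the continuity of \<open>l\<close> along
  uniformly bounded a.s. convergent sequences.\<close>

lemma subgradient_density: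
  assumes x: "x \<in> heart"
  shows "\<exists>g\<in>borel_measurable M. (\<forall>w. 0 \<le> g w) \<and> integrable M g \<and>
    (\<forall>u\<in>bfun. - (\<integral>w. u w * g w \<partial>M) \<le> (\<integral>w. increment x u w \<partial>M))"
proof -
  obtain l where l: "function_linear_on bfun l" and l_le: "\<And>u. u \<in> bfun \<Longrightarrow> l u \<le> (\<integral>w. increment x u w \<partial>M)"
    using dominated_linear_functional[OF x] by auto
  have l_lin: "l (\<lambda>w. a * u w + b * v w) = a * l u + b * l v" if "u \<in> bfun" "v \<in> bfun" for a b u v
    using l that by (simp add: function_linear_on_def)
  have l_scale: "l (\<lambda>w. a * u w) = a * l u" if "u \<in> bfun" for a u
    using l_lin[OF that that, of a 0] by simp
  have l_minus: "l (\<lambda>w. - u w) = - l u" if "u \<in> bfun" for u using l_scale[OF that, of "-1"] by simp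
  have l_add: "l (\<lambda>w. u w + v w) = l u + l v" if "u \<in> bfun" "v \<in> bfun" for u v
    using l_lin[OF that, of 1 1] by simp
  have b_minus: "(\<lambda>w. - u w) \<in> bfun" if "u \<in> bfun" for u using bfun_linear[OF that that, of "-1" 0] by simp
  have b_diff: "(\<lambda>w. u w - v w) \<in> bfun" if "u \<in> bfun" "v \<in> bfun" for u v using bfun_linear[OF that, of 1 "-1"] by simp
  have b_ind: "indicator A \<in> bfun" if "A \<in> sets M" for A
    by (rule bfunI[of _ 1]) (use that in \<open>auto simp: indicator_def\<close>)
  have b_0: "(\<lambda>_. 0) \<in> bfun" by (rule bfunI[of _ 0]) auto
  have l_0: "l (\<lambda>_. 0) = 0" using l_scale[OF b_0, of 0] by simp
  have inc_le: "l u \<le> 0" if u: "u \<in> bfun" and pos: "\<And>w. w \<in> space M \<Longrightarrow> 0 \<le> u w" for u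
  proof -
    have "AE w in M. increment x u w \<le> increment x (\<lambda>_. 0) w"
      by (rule increment_antimono[OF x bfun_heart[OF b_0] bfun_heart[OF u]]) (use pos in auto)
    then have "(\<integral>w. increment x u w \<partial>M) \<le> (\<integral>w. increment x (\<lambda>_. 0) w \<partial>M)"
      by (intro integral_mono_AE increment_integrable x u b_0)
    then show ?thesis using l_le[OF u] by (simp add: increment_zero)
  qed
  \<comment> \<open>Linearity squeezes \<open>l (us n)\<close> between
    \<open>- E[D (- us n)]\<close> and \<open>E[D (us n)]\<close>. Both tend to 0 by the Lebesgue
    property followed by dominated convergence with the constant \<open>c\<close>.\<close>
  have l_null: "(\<lambda>n. l (us n)) \<longlonglongrightarrow> 0"
    if us: "\<And>n. us n \<in> bfun" and c: "\<And>n w. w \<in> space M \<Longrightarrow> \<bar>us n w\<bar> \<le> c"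
      and lim: "AE w in M. (\<lambda>n. us n w) \<longlonglongrightarrow> 0" for us :: "nat \<Rightarrow> 'a \<Rightarrow> real" and c
  proof -
    have int0: "(\<lambda>n. \<integral>w. increment x (us n) w \<partial>M) \<longlonglongrightarrow> 0"
      if us: "\<And>n. us n \<in> bfun" and c: "\<And>n w. w \<in> space M \<Longrightarrow> \<bar>us n w\<bar> \<le> c"
      and lim: "AE w in M. (\<lambda>n. us n w) \<longlonglongrightarrow> 0" for us :: "nat \<Rightarrow> 'a \<Rightarrow> real"
    proof -
      have "(\<lambda>n. \<integral>w. increment x (us n) w \<partial>M) \<longlonglongrightarrow> (\<integral>w. 0 \<partial>M)"
      proof (rule integral_dominated_convergence[where w = "\<lambda>_. c"])
        show "AE w in M. (\<lambda>n. increment x (us n) w) \<longlonglongrightarrow> 0"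
          using increment_lebesgue[OF x bfun_heart[OF us] bfun_heart[OF b_0] heart_bounded[of "\<lambda>_. c" "\<bar>c\<bar>"] lim] c
          by (auto simp: increment_zero)
        show "AE w in M. norm (increment x (us n) w) \<le> c" for n
          using increment_bounded[OF x bfun_measurable[OF us], of n c] c by auto
      qed (auto intro!: increment_measurable x bfun_heart us)
      then show ?thesis by simp
    qed
    show ?thesis
    proof (rule tendsto_sandwich)
      have "(\<lambda>n. - (\<integral>w. increment x (\<lambda>w. - us n w) w \<partial>M)) \<longlonglongrightarrow> - 0"
        by (intro tendsto_minus int0 b_minus us) (use c lim in \<open>auto elim!: eventually_mono intro!: tendsto_eq_intros\<close>)
      then show "(\<lambda>n. - (\<integral>w. increment x (\<lambda>w. - us n w) w \<partial>M)) \<longlonglongrightarrow> 0" by simp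
      show "(\<lambda>n. \<integral>w. increment x (us n) w \<partial>M) \<longlonglongrightarrow> 0" by (rule int0[OF us c lim])
      show "eventually (\<lambda>n. - (\<integral>w. increment x (\<lambda>w. - us n w) w \<partial>M) \<le> l (us n)) sequentially"
      proof (intro always_eventually allI)
        fix n show "- (\<integral>w. increment x (\<lambda>w. - us n w) w \<partial>M) \<le> l (us n)"
          using l_le[OF b_minus[OF us]] l_minus[OF us] by (simp add: minus_le_iff)
      qed
    qed (use l_le us in auto)
  qed
  have l_lim: "(\<lambda>n. l (us n)) \<longlonglongrightarrow> l u"
    if us: "\<And>n. us n \<in> bfun" and u: "u \<in> bfun" and c: "\<And>n w. w \<in> space M \<Longrightarrow> \<bar>us n w\<bar> \<le> c"
      and lim: "AE w in M. (\<lambda>n. us n w) \<longlonglongrightarrow> u w" for us :: "nat \<Rightarrow> 'a \<Rightarrow> real" and u c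
  proof -
    obtain d where d: "\<And>w. w \<in> space M \<Longrightarrow> \<bar>u w\<bar> \<le> d" using bfun_bound[OF u] by blast
    have "(\<lambda>n. l (\<lambda>w. us n w - u w)) \<longlonglongrightarrow> 0"
    proof (rule l_null)
      show "(\<lambda>w. us n w - u w) \<in> bfun" for n by (intro b_diff us u)
      show "\<bar>us n w - u w\<bar> \<le> c + d" if "w \<in> space M" for n w using c[OF that, of n] d[OF that] by linarith
      show "AE w in M. (\<lambda>n. us n w - u w) \<longlonglongrightarrow> 0"
        using lim by eventually_elim (auto intro!: tendsto_eq_intros)
    qed
    moreover have "l (\<lambda>w. us n w - u w) = l (us n) - l u" for n
      using l_lin[OF us u, of 1 n "-1"] by simp
    ultimately have "(\<lambda>n. l (us n) - l u) \<longlonglongrightarrow> 0" by simp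
    then show ?thesis by (simp add: LIM_zero_iff)
  qed
  define \<nu> where "\<nu> = measure_of (space M) (sets M) (\<lambda>A. ennreal (- l (indicator A)))"
  have sets_\<nu>: "sets \<nu> = sets M" unfolding \<nu>_def by (rule sets.sets_measure_of_eq)
  have space_\<nu>: "space \<nu> = space M" using sets_\<nu> by (rule sets_eq_imp_space_eq)
  have em: "emeasure \<nu> A = ennreal (- l (indicator A))" if A: "A \<in> sets M" for A
  proof (rule emeasure_measure_of[OF \<nu>_def])
    show "sets M \<subseteq> Pow (space M)" using sets.space_closed .
    show "A \<in> sets \<nu>" using A sets_\<nu> by simp
    show "positive (sets \<nu>) (\<lambda>A. ennreal (- l (indicator A)))"
      unfolding positive_def using l_0 by (simp add: indicator_def[abs_def])
    show "countably_additive (sets \<nu>) (\<lambda>A. ennreal (- l (indicator A)))"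
      unfolding sets_\<nu>
    proof (rule countably_additiveI)
      fix B :: "nat \<Rightarrow> 'a set" assume B: "range B \<subseteq> sets M" "disjoint_family B" "\<Union> (range B) \<in> sets M"
      have Bi: "B i \<in> sets M" for i using B by auto
      have part: "(\<Sum>i<n. l (indicator (B i))) = l (indicator (\<Union>i<n. B i))" for n
      proof (induction n)
        case 0
        then show ?case using l_0 by (simp add: indicator_def[abs_def])
      next
        case (Suc n)
        have "indicator (\<Union>i<Suc n. B i) = (\<lambda>w. indicator (\<Union>i<n. B i) w + (indicator (B n) w :: real))"
        proof
          fix w
          have "w \<notin> B n" if "i < n" "w \<in> B i" for i
            using B(2) that unfolding disjoint_family_on_def by (metis UNIV_I disjoint_iff less_irrefl)
          then show "indicator (\<Union>i<Suc n. B i) w = indicator (\<Union>i<n. B i) w + (indicator (B n) w :: real)"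
            by (auto simp: indicator_def lessThan_Suc)
        qed
        then show ?case using Suc l_add[OF b_ind b_ind, of "\<Union>i<n. B i" "B n"] Bi by simp
      qed
      have "(\<lambda>n. l (indicator (\<Union>i<n. B i))) \<longlonglongrightarrow> l (indicator (\<Union> (range B)))"
      proof (rule l_lim)
        show "indicator (\<Union>i<n. B i) \<in> bfun" for n using Bi by (intro b_ind) auto
        show "indicator (\<Union> (range B)) \<in> bfun" using B by (intro b_ind)
        show "\<bar>indicator (\<Union>i<n. B i) w :: real\<bar> \<le> 1" for n w by (simp add: indicator_def)
        show "AE w in M. (\<lambda>n. indicator (\<Union>i<n. B i) w :: real) \<longlonglongrightarrow> indicator (\<Union> (range B)) w"
          by (auto intro!: AE_I2 LIMSEQ_indicator_UN)
      qed
      then have "(\<lambda>n. \<Sum>i<n. - l (indicator (B i))) \<longlonglongrightarrow> - l (indicator (\<Union> (range B)))"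
        unfolding sum_negf part by (rule tendsto_minus)
      then have "(\<lambda>i. - l (indicator (B i))) sums - l (indicator (\<Union> (range B)))" by (simp add: sums_def)
      moreover have "0 \<le> - l (indicator (B i))" for i using inc_le[OF b_ind[OF Bi]] by simp
      ultimately show "(\<Sum>i. ennreal (- l (indicator (B i)))) = ennreal (- l (indicator (\<Union> (range B))))"
        by (intro suminf_ennreal_eq) auto
    qed
  qed
  have "\<exists>h\<in>borel_measurable M. density M h = \<nu>"
  proof (rule Radon_Nikodym_finite_measure[OF _ sets_\<nu>])
    show "finite_measure \<nu>"
      by (rule finite_measureI) (simp add: space_\<nu> em)
    show "absolutely_continuous M \<nu>"
      unfolding absolutely_continuous_def
    proof
      fix A assume A: "A \<in> null_sets M"
      then have AM: "A \<in> sets M" by auto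
      \<comment> \<open>The constant sequence 0 converges a.s. to the indicator of a null set, so
        continuity of \<open>l\<close> already contains absolute continuity.\<close>
      have "(\<lambda>n::nat. l (\<lambda>_. 0)) \<longlonglongrightarrow> l (indicator A)"
      proof (rule l_lim[OF b_0 b_ind[OF AM]])
        show "AE w in M. (\<lambda>n. 0::real) \<longlonglongrightarrow> indicator A w"
          using AE_not_in[OF A] by eventually_elim simp
      qed auto
      then have "l (indicator A) = 0" using l_0 by (simp add: LIMSEQ_const_iff)
      then show "A \<in> null_sets \<nu>" using AM em[OF AM] sets_\<nu> by (auto simp: null_sets_def)
    qed
  qed
  then obtain h where h [measurable]: "h \<in> borel_measurable M" and dens: "density M h = \<nu>" by auto
  define g where "g w = enn2real (h w)" for w
  have [measurable]: "g \<in> borel_measurable M" unfolding g_def by measurable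
  have g_nonneg: "0 \<le> g w" for w by (simp add: g_def)
  have h_int: "(\<integral>\<^sup>+ w. h w \<partial>M) = emeasure \<nu> (space M)"
    unfolding dens[symmetric] by (subst emeasure_density) (auto intro!: nn_integral_cong)
  have "AE w in M. h w \<noteq> \<infinity>"
    by (rule nn_integral_PInf_AE) (auto simp: h_int em)
  then have gh: "AE w in M. ennreal (g w) = h w"
    by eventually_elim (simp add: g_def ennreal_enn2real top.not_eq_extremum)
  have g_int: "integrable M g"
  proof (rule integrableI_nonneg)
    have "(\<integral>\<^sup>+ w. ennreal (g w) \<partial>M) = (\<integral>\<^sup>+ w. h w \<partial>M)" by (rule nn_integral_cong_AE[OF gh])
    then show "(\<integral>\<^sup>+ w. ennreal (g w) \<partial>M) < \<infinity>" by (simp add: h_int em)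
  qed (auto simp: g_nonneg)
  note ug_int = bfun_mult_integrable[OF _ g_int]
  \<comment> \<open>The induction runs through all nonnegative measurable functions while
    \<open>l\<close> is controlled only on \<open>bfun\<close>; hence the implication. Boundedness
    descends to summands and to approximants from below because all of them are nonnegative.\<close>
  have rep_pos: "u \<in> bfun \<longrightarrow> l u = - (\<integral>w. u w * g w \<partial>M)"
    if "u \<in> borel_measurable M" "\<And>w. 0 \<le> u w" for u
    using that
  proof (induction rule: borel_measurable_induct_real)
    case (set A)
    note [measurable] = set
    have "ennreal (- l (indicator A)) = emeasure \<nu> A" using em[OF set] by simp
    also have "\<dots> = (\<integral>\<^sup>+ w. h w * indicator A w \<partial>M)"
      unfolding dens[symmetric] by (rule emeasure_density) (use set in auto)
    also have "\<dots> = (\<integral>\<^sup>+ w. ennreal (indicator A w * g w) \<partial>M)"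
      using gh by (intro nn_integral_cong_AE) (auto elim!: eventually_mono simp: indicator_def)
    also have "\<dots> = ennreal (\<integral>w. indicator A w * g w \<partial>M)"
      by (rule nn_integral_eq_integral[OF ug_int[OF b_ind[OF set]]]) (auto simp: g_nonneg)
    finally have "- l (indicator A) = (\<integral>w. indicator A w * g w \<partial>M)"
      using inc_le[OF b_ind[OF set]] by (subst (asm) ennreal_inj) (auto intro!: integral_nonneg_AE simp: g_nonneg)
    then show ?case by simp
  next
    case (mult u c)
    show ?case
    proof
      assume cu: "(\<lambda>w. c * u w) \<in> bfun"
      show "l (\<lambda>w. c * u w) = - (\<integral>w. c * u w * g w \<partial>M)"
      \<comment> \<open>For \<open>c = 0\<close> the boundedness of \<open>c * u\<close> says
        nothing about \<open>u\<close>.\<close>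
      proof (cases "c = 0")
        case True
        then show ?thesis using l_0 by simp
      next
        case False
        have "(\<lambda>w. (1/c) * (c * u w) + 0 * (c * u w)) \<in> bfun" by (rule bfun_linear[OF cu cu])
        then have u: "u \<in> bfun" using False by simp
        then show ?thesis using mult.IH l_scale[OF u] by (simp add: mult.assoc)
      qed
    qed
  next
    case (add u v)
    show ?case
    proof
      assume uv: "(\<lambda>w. v w + u w) \<in> bfun"
      obtain c where c: "\<And>w. w \<in> space M \<Longrightarrow> \<bar>v w + u w\<bar> \<le> c" using bfun_bound[OF uv] by blast
      have "\<bar>u w\<bar> \<le> c \<and> \<bar>v w\<bar> \<le> c" if "w \<in> space M" for w
        using c[OF that] add.hyps(2)[of w] add.hyps(4)[of w] by linarith
      then have u: "u \<in> bfun" and v: "v \<in> bfun" using add.hyps by (auto intro!: bfunI[of _ c])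
      show "l (\<lambda>w. v w + u w) = - (\<integral>w. (v w + u w) * g w \<partial>M)"
        using add.IH u v l_add[OF v u] ug_int[OF u] ug_int[OF v] by (simp add: distrib_right)
    qed
  next
    case (seq U)
    show ?case
    proof
      assume u: "u \<in> bfun"
      obtain c where c: "\<And>w. w \<in> space M \<Longrightarrow> \<bar>u w\<bar> \<le> c" using bfun_bound[OF u] by blast
      have Uu: "U i w \<le> u w" if "w \<in> space M" for i w
        using seq.hyps(3) seq.hyps(4)[OF that] by (intro incseq_le) (auto simp: incseq_def le_fun_def)
      have Uc: "\<bar>U i w\<bar> \<le> c" if "w \<in> space M" for i w
        using Uu[OF that, of i] seq.hyps(2)[of i w] c[OF that] by linarith
      have Ub: "U i \<in> bfun" for i by (rule bfunI[OF seq.hyps(1)]) (rule Uc)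
      have "(\<lambda>i. l (U i)) \<longlonglongrightarrow> l u"
        by (rule l_lim[OF Ub u Uc]) (use seq.hyps(4) in auto)
      moreover have "(\<lambda>i. \<integral>w. U i w * g w \<partial>M) \<longlonglongrightarrow> (\<integral>w. u w * g w \<partial>M)"
      proof (rule integral_dominated_convergence[where w = "\<lambda>w. c * g w"])
        show "AE w in M. (\<lambda>i. U i w * g w) \<longlonglongrightarrow> u w * g w"
          by (intro AE_I2 tendsto_intros seq.hyps(4))
        show "AE w in M. norm (U i w * g w) \<le> c * g w" for i
          using Uc g_nonneg by (intro AE_I2) (auto simp: abs_mult intro!: mult_right_mono)
      qed (use g_int seq.hyps(1) bfun_measurable[OF u] in auto)
      then have "(\<lambda>i. - (\<integral>w. U i w * g w \<partial>M)) \<longlonglongrightarrow> - (\<integral>w. u w * g w \<partial>M)" by (rule tendsto_minus)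
      ultimately show "l u = - (\<integral>w. u w * g w \<partial>M)"
        using seq.IH Ub by (auto intro: LIMSEQ_unique)
    qed
  qed
  have rep: "l u = - (\<integral>w. u w * g w \<partial>M)" if u: "u \<in> bfun" for u
  proof -
    note [measurable] = bfun_measurable[OF u]
    obtain c where c: "\<And>w. w \<in> space M \<Longrightarrow> \<bar>u w\<bar> \<le> c" using bfun_bound[OF u] by blast
    let ?p = "\<lambda>w. max (u w) 0" and ?n = "\<lambda>w. max (- u w) 0"
    have p: "?p \<in> bfun"
    proof (rule bfunI)
      show "\<bar>?p w\<bar> \<le> c" if "w \<in> space M" for w using c[OF that] by linarith
    qed auto
    have n: "?n \<in> bfun"
    proof (rule bfunI)
      show "\<bar>?n w\<bar> \<le> c" if "w \<in> space M" for w using c[OF that] by linarith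
    qed auto
    have eq: "?p w - ?n w = u w" for w by (simp add: max_def)
    have "l (\<lambda>w. ?p w - ?n w) = l ?p - l ?n" using l_lin[OF p n, of 1 "-1"] by simp
    also have "\<dots> = - (\<integral>w. ?p w * g w \<partial>M) + (\<integral>w. ?n w * g w \<partial>M)"
      using rep_pos[of ?p] rep_pos[of ?n] p n by simp
    also have "\<dots> = - (\<integral>w. (?p w - ?n w) * g w \<partial>M)"
      using ug_int[OF p] ug_int[OF n] by (simp add: left_diff_distrib)
    finally show ?thesis unfolding eq .
  qed
  show ?thesis
    using g_nonneg g_int l_le rep by (intro bexI[of _ g]) auto
qed

end

section \<open>Agreement of the two descriptions of the conditional Orlicz heart\<close>

context young_heart
begin

text \<open>A positive \<open>F\<close>-measurable \<open>\<eta>\<close> is at most \<open>N\<close>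
  on the \<open>F\<close>-set \<open>E N\<close>, where monotonicity and locality compare it with
  the constant multiplier \<open>N\<close>. As \<open>\<eta>\<close> is finite, the sets
  \<open>E N\<close> exhaust the space.\<close>

lemma cond_orlicz_heart_eq:
  assumes phi: "\<And>r. 0 \<le> r \<Longrightarrow> \<phi> r = ereal (f r)"
  shows "cond_orlicz_heart M F \<phi> = heart"
proof -
  have iff: "cond_exp_in_L0 M F (\<lambda>w. \<phi> (\<eta> w * \<bar>x w\<bar>)) \<longleftrightarrow>
      (AE w in M. nn_cond_exp M F (\<lambda>w. ennreal (f (\<eta> w * \<bar>x w\<bar>))) w < \<infinity>)"
    if x: "x \<in> borel_measurable M" and \<eta>: "\<eta> \<in> borel_measurable F" "\<And>w. w \<in> space M \<Longrightarrow> 0 \<le> \<eta> w" for x \<eta>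
  proof -
    note [measurable] = x measurable_from_subalg[OF subalg \<eta>(1)]
    have eq: "\<phi> (\<eta> w * \<bar>x w\<bar>) = ereal (f (\<eta> w * \<bar>x w\<bar>))" if "w \<in> space M" for w
      using \<eta>(2)[OF that] by (intro phi) auto
    have m [measurable]: "(\<lambda>w. \<phi> (\<eta> w * \<bar>x w\<bar>)) \<in> borel_measurable M"
      by (subst measurable_cong[OF eq]) auto
    have "cond_exp_in_L0 M F (\<lambda>w. \<phi> (\<eta> w * \<bar>x w\<bar>)) \<longleftrightarrow>
        (AE w in M. nn_cond_exp M F (\<lambda>w. e2ennreal (\<phi> (\<eta> w * \<bar>x w\<bar>))) w < \<infinity>)"
      by (rule cond_exp_in_L0_iff[OF m]) (use eq \<eta>(2) in \<open>auto intro!: f_nonneg\<close>)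
    also have "\<dots> \<longleftrightarrow> (AE w in M. nn_cond_exp M F (\<lambda>w. ennreal (f (\<eta> w * \<bar>x w\<bar>))) w < \<infinity>)"
    proof -
      have "AE w in M. nn_cond_exp M F (\<lambda>w. e2ennreal (\<phi> (\<eta> w * \<bar>x w\<bar>))) w
          = nn_cond_exp M F (\<lambda>w. ennreal (f (\<eta> w * \<bar>x w\<bar>))) w"
        by (rule nn_cond_exp_cong) (auto simp: eq)
      note eq' = this
      show ?thesis
      proof
        assume "AE w in M. nn_cond_exp M F (\<lambda>w. e2ennreal (\<phi> (\<eta> w * \<bar>x w\<bar>))) w < \<infinity>"
        with eq' show "AE w in M. nn_cond_exp M F (\<lambda>w. ennreal (f (\<eta> w * \<bar>x w\<bar>))) w < \<infinity>"
          by eventually_elim simp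
      next
        assume "AE w in M. nn_cond_exp M F (\<lambda>w. ennreal (f (\<eta> w * \<bar>x w\<bar>))) w < \<infinity>"
        with eq' show "AE w in M. nn_cond_exp M F (\<lambda>w. e2ennreal (\<phi> (\<eta> w * \<bar>x w\<bar>))) w < \<infinity>"
          by eventually_elim simp
      qed
    qed
    finally show ?thesis .
  qed
  show ?thesis
  proof (intro set_eqI iffI)
    fix x assume x: "x \<in> cond_orlicz_heart M F \<phi>"
    then have xm: "x \<in> borel_measurable M" by (simp add: cond_orlicz_heart_def L0_def)
    show "x \<in> heart"
      unfolding heart_def
    proof (intro CollectI conjI allI xm)
      fix N :: nat
      show "AE w in M. nn_cond_exp M F (\<lambda>w. ennreal (f (real N * \<bar>x w\<bar>))) w < \<infinity>"
      \<comment> \<open>Multipliers in \<open>L0_pos\<close> are strictly positive, so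
        \<open>N = 0\<close> has to come from \<open>f 0 = 0\<close>.\<close>
      proof (cases "N = 0")
        case True
        then show ?thesis using nn_cond_exp_zero by (auto simp: f_zero)
      next
        case False
        then have "(\<lambda>_. real N) \<in> L0_pos F" by (simp add: L0_pos_def L0_def)
        then have "cond_exp_in_L0 M F (\<lambda>w. \<phi> (real N * \<bar>x w\<bar>))"
          using x by (auto simp: cond_orlicz_heart_def)
        then show ?thesis by (subst (asm) iff[OF xm]) auto
      qed
    qed
  next
    fix x assume x: "x \<in> heart"
    note xm [measurable] = heart_measurable[OF x]
    show "x \<in> cond_orlicz_heart M F \<phi>"
      unfolding cond_orlicz_heart_def
    proof (intro CollectI conjI ballI)
      show "x \<in> L0 M" using xm by (simp add: L0_def)
      fix \<eta> assume "\<eta> \<in> L0_pos F"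
      then have \<eta> [measurable]: "\<eta> \<in> borel_measurable F" and pos: "\<And>w. w \<in> space M \<Longrightarrow> 0 < \<eta> w"
        using subalg by (auto simp: L0_pos_def L0_def subalgebra_def)
      note [measurable] = measurable_from_subalg[OF subalg \<eta>]
      have "AE w in M. nn_cond_exp M F (\<lambda>w. ennreal (f (\<eta> w * \<bar>x w\<bar>))) w < \<infinity>"
      proof -
        define E where "E N = {w \<in> space F. \<eta> w \<le> real N}" for N :: nat
        have "AE w in M. w \<in> E N \<longrightarrow> nn_cond_exp M F (\<lambda>w. ennreal (f (\<eta> w * \<bar>x w\<bar>))) w
            \<le> nn_cond_exp M F (\<lambda>w. ennreal (f (real N * \<bar>x w\<bar>))) w" for N
        proof (rule nn_cond_exp_mono_on)
          show "E N \<in> sets F" unfolding E_def by measurable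
          show "AE w in M. w \<in> E N \<longrightarrow> ennreal (f (\<eta> w * \<bar>x w\<bar>)) \<le> ennreal (f (real N * \<bar>x w\<bar>))"
            by (auto simp: E_def intro!: AE_I2 ennreal_leI monoD[OF f_mono] mult_right_mono)
        qed auto
        then have "AE w in M. \<forall>N. w \<in> E N \<longrightarrow> nn_cond_exp M F (\<lambda>w. ennreal (f (\<eta> w * \<bar>x w\<bar>))) w
            \<le> nn_cond_exp M F (\<lambda>w. ennreal (f (real N * \<bar>x w\<bar>))) w"
          by (simp add: AE_all_countable)
        moreover have "AE w in M. \<forall>N. nn_cond_exp M F (\<lambda>w. ennreal (f (real N * \<bar>x w\<bar>))) w < \<infinity>"
          using x by (simp add: heart_def AE_all_countable)
        ultimately show ?thesis
          using AE_space
        proof eventually_elim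
          case (elim w)
          obtain N :: nat where "\<eta> w \<le> real N" using real_arch_simple by blast
          then have "w \<in> E N" using elim(3) subalg by (simp add: E_def subalgebra_def)
          then show ?case using elim(1,2) by (blast intro: order.strict_trans1)
        qed
      qed
      then show "cond_exp_in_L0 M F (\<lambda>w. \<phi> (\<eta> w * \<bar>x w\<bar>))"
        by (subst iff[OF xm \<eta>]) (use pos in \<open>auto intro: less_imp_le\<close>)
    qed
  qed
qed

end

section \<open>Truncation to bounded functions\<close>

context conditional_risk
begin

definition truncate :: "nat \<Rightarrow> ('a \<Rightarrow> real) \<Rightarrow> 'a \<Rightarrow> real" where
  "truncate n u w = max (min (u w) (real n)) (- real n)"

lemma truncate_bfun: "u \<in> borel_measurable M \<Longrightarrow> truncate n u \<in> bfun"
proof (rule bfunI[of _ "real n"])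
  assume [measurable]: "u \<in> borel_measurable M"
  show "truncate n u \<in> borel_measurable M" unfolding truncate_def by measurable
qed (auto simp: truncate_def)

lemma truncate_abs_le: "\<bar>truncate n u w\<bar> \<le> \<bar>u w\<bar>"
  unfolding truncate_def by linarith

lemma truncate_eventually: "eventually (\<lambda>n. truncate n u w = u w) sequentially"
proof -
  obtain N :: nat where "\<bar>u w\<bar> \<le> real N" using real_arch_simple by blast
  then have "truncate n u w = u w" if "n \<ge> N" for n
    using that unfolding truncate_def by (auto simp: max_def min_def)
  then show ?thesis by (auto simp: eventually_sequentially)
qed

lemma truncate_tendsto: "(\<lambda>n. truncate n u w) \<longlonglongrightarrow> u w"
  using truncate_eventually by (rule tendsto_eventually)

lemma truncate_uminus: "truncate n (\<lambda>w. - u w) w = - truncate n u w"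
  unfolding truncate_def by linarith

text \<open>\<open>ennreal\<close> clips negative values: where \<open>u\<close> is negative all
  terms are 0, and elsewhere the truncations increase. Monotone convergence therefore applies to
  signed \<open>u\<close>, and the negative part is reached through \<open>- u\<close>.\<close>

lemma nn_cond_exp_truncate:
  assumes [measurable]: "u \<in> borel_measurable M" "g \<in> borel_measurable M" and g: "\<And>w. 0 \<le> g w"
  shows "AE w in M. nn_cond_exp M F (\<lambda>w. ennreal (u w * g w)) w = (SUP n. nn_cond_exp M F (\<lambda>w. ennreal (truncate n u w * g w)) w)"
    and "AE w in M. (\<lambda>n. nn_cond_exp M F (\<lambda>w. ennreal (truncate n u w * g w)) w)
      \<longlonglongrightarrow> nn_cond_exp M F (\<lambda>w. ennreal (u w * g w)) w"
proof -
  have [measurable]: "truncate n u \<in> borel_measurable M" for n unfolding truncate_def by measurable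
  have inc: "ennreal (truncate n u w * g w) \<le> ennreal (truncate (Suc n) u w * g w)" for n w
  proof (cases "0 \<le> u w")
    case True
    then show ?thesis using g by (intro ennreal_leI mult_right_mono) (auto simp: truncate_def)
  next
    case False
    then have "truncate n u w * g w \<le> 0" using g by (intro mult_nonpos_nonneg) (auto simp: truncate_def)
    then show ?thesis by (simp add: ennreal_neg)
  qed
  have sup: "(SUP n. ennreal (truncate n u w * g w)) = ennreal (u w * g w)" for w
  proof -
    have "(\<lambda>n. ennreal (truncate n u w * g w)) \<longlonglongrightarrow> (SUP n. ennreal (truncate n u w * g w))"
      by (rule LIMSEQ_SUP) (auto intro!: incseq_SucI inc)
    moreover have "(\<lambda>n. ennreal (truncate n u w * g w)) \<longlonglongrightarrow> ennreal (u w * g w)"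
      by (intro tendsto_ennrealI tendsto_mult truncate_tendsto tendsto_const)
    ultimately show ?thesis by (rule LIMSEQ_unique)
  qed
  show *: "AE w in M. nn_cond_exp M F (\<lambda>w. ennreal (u w * g w)) w = (SUP n. nn_cond_exp M F (\<lambda>w. ennreal (truncate n u w * g w)) w)"
    using nn_cond_exp_SUP[of "\<lambda>n w. ennreal (truncate n u w * g w)"] inc unfolding sup by auto
  have "AE w in M. \<forall>n. nn_cond_exp M F (\<lambda>w. ennreal (truncate n u w * g w)) w \<le> nn_cond_exp M F (\<lambda>w. ennreal (truncate (Suc n) u w * g w)) w"
    unfolding AE_all_countable by (intro allI nn_cond_exp_mono AE_I2 inc) auto
  with * show "AE w in M. (\<lambda>n. nn_cond_exp M F (\<lambda>w. ennreal (truncate n u w * g w)) w)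
      \<longlonglongrightarrow> nn_cond_exp M F (\<lambda>w. ennreal (u w * g w)) w"
  proof eventually_elim
    case (elim w)
    then show ?case unfolding elim(1) by (intro LIMSEQ_SUP incseq_SucI) auto
  qed
qed

end

section \<open>The conditional subgradient inequality and the Fenchel transform\<close>

locale risk_subgradient = conditional_risk M F f \<rho> for M F :: "'a measure" and f \<rho> +
  fixes x g :: "'a \<Rightarrow> real"
  assumes x_heart: "x \<in> heart" and g_measurable [measurable]: "g \<in> borel_measurable M"
    and g_nonneg: "\<And>w. 0 \<le> g w" and g_integrable: "integrable M g"
    and subgradient: "\<And>u. u \<in> bfun \<Longrightarrow> - (\<integral>w. u w * g w \<partial>M) \<le> (\<integral>w. increment x u w \<partial>M)"
begin

lemmas bfun_integrable = bfun_mult_integrable[OF _ g_integrable]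

text \<open>Let \<open>A\<close> be the \<open>F\<close>-set where the inequality fails. Convexity
  with the indicator of \<open>A\<close> as coefficient gives
  \<open>D (indicator A * u) \<le> indicator A * D u\<close>, so the scalar inequality forces an
  integral at most 0 on a function that is nonnegative by the choice of \<open>A\<close>; it
  vanishes a.s.\<close>

lemma conditional_subgradient:
  assumes u: "u \<in> bfun"
  shows "AE w in M. - real_cond_exp M F (\<lambda>w. u w * g w) w \<le> increment x u w"
proof -
  define A where "A = {w \<in> space F. increment x u w < - real_cond_exp M F (\<lambda>w. u w * g w) w}"
  note [measurable] = increment_measurable_F[OF x_heart bfun_heart[OF u]] bfun_measurable[OF u]
  have A_F [measurable]: "A \<in> sets F" unfolding A_def by measurable
  then have A_M [measurable]: "A \<in> sets M" using subalg by (auto simp: subalgebra_def)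
  let ?v = "\<lambda>w. indicator A w * u w" and ?r = "real_cond_exp M F (\<lambda>w. u w * g w)"
  obtain c where c: "\<And>w. w \<in> space M \<Longrightarrow> \<bar>u w\<bar> \<le> c" using bfun_bound[OF u] by blast
  have v: "?v \<in> bfun"
    by (rule bfunI[of _ "\<bar>c\<bar>"]) (use c in \<open>force simp: indicator_def\<close>)+
  have r_int: "integrable M ?r" by (rule real_cond_exp_int(1)[OF bfun_integrable[OF u]])
  have ind_int: "integrable M (\<lambda>w. indicator A w * k w)" if "integrable M k" for k :: "'a \<Rightarrow> real"
    using integrable_mult_indicator[OF A_M that] by simp
  have inc_int: "integrable M (increment x u)" by (rule increment_integrable[OF x_heart u])
  have "AE w in M. \<rho> (\<lambda>w. indicator A w * (x w + u w) + (1 - indicator A w) * x w) w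
      \<le> indicator A w * \<rho> (\<lambda>w. x w + u w) w + (1 - indicator A w) * \<rho> x w"
    by (intro rho_convex heart_plus x_heart bfun_heart u) (auto simp: indicator_def)
  moreover have "(\<lambda>w. indicator A w * (x w + u w) + (1 - indicator A w) * x w) = (\<lambda>w. x w + ?v w)"
    by (auto simp: algebra_simps)
  ultimately have "AE w in M. increment x ?v w \<le> indicator A w * increment x u w"
    by (simp add: increment_def algebra_simps)
  then have "(\<integral>w. increment x ?v w \<partial>M) \<le> (\<integral>w. indicator A w * increment x u w \<partial>M)"
    by (intro integral_mono_AE increment_integrable x_heart v ind_int inc_int)
  then have "- (\<integral>w. ?v w * g w \<partial>M) \<le> (\<integral>w. indicator A w * increment x u w \<partial>M)"
    using subgradient[OF v] by simp
  moreover have "(\<integral>w. ?v w * g w \<partial>M) = (\<integral>w. indicator A w * ?r w \<partial>M)"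
    using real_cond_exp_intA[OF bfun_integrable[OF u] A_F] by (simp add: set_lebesgue_integral_def mult.assoc)
  ultimately have "(\<integral>w. indicator A w * - ?r w - indicator A w * increment x u w \<partial>M) \<le> 0"
    using ind_int[OF r_int] ind_int[OF inc_int] by simp
  moreover have nn: "AE w in M. 0 \<le> indicator A w * - ?r w - indicator A w * increment x u w"
    by (auto simp: A_def indicator_def)
  ultimately have "(\<integral>w. indicator A w * - ?r w - indicator A w * increment x u w \<partial>M) = 0"
    using integral_nonneg_AE[OF nn] by linarith
  then have "AE w in M. indicator A w * - ?r w - indicator A w * increment x u w = 0"
    using nn ind_int[OF r_int] ind_int[OF inc_int] by (subst (asm) integral_nonneg_eq_0_iff_AE) auto
  with AE_space show ?thesis
  proof eventually_elim
    case (elim w)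
    then show ?case using subalg by (cases "w \<in> A") (auto simp: A_def subalgebra_def)
  qed
qed

text \<open>The constants 1 and -1, with increments -1 and 1 by cash invariance, give the two
  inequalities.\<close>

lemma real_cond_exp_g: "AE w in M. real_cond_exp M F g w = 1"
proof -
  have b: "(\<lambda>_. c) \<in> bfun" for c by (rule bfunI[of _ "\<bar>c\<bar>"]) auto
  have "AE w in M. real_cond_exp M F (\<lambda>w. -1 * g w) w = -1 * real_cond_exp M F g w"
    by (rule real_cond_exp_cmult[OF g_integrable])
  with conditional_subgradient[OF b, of 1] conditional_subgradient[OF b, of "-1"]
    increment_const[OF x_heart, of 1] increment_const[OF x_heart, of "-1"]
  show ?thesis by eventually_elim simp
qed

text \<open>Tested with minus the truncations of \<open>\<bar>u\<bar>\<close>, the subgradient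
  inequality bounds all truncated conditional expectations by the single real-valued increment at
  \<open>- \<bar>u\<bar>\<close>. The finiteness of \<open>\<rho>\<close> on the whole heart enters
  here.\<close>

lemma nn_cond_exp_abs_finite:
  assumes u: "u \<in> heart"
  shows "AE w in M. nn_cond_exp M F (\<lambda>w. ennreal (\<bar>u w\<bar> * g w)) w < \<infinity>"
proof -
  let ?a = "\<lambda>w. \<bar>u w\<bar>"
  note [measurable] = heart_measurable[OF u]
  have b: "truncate n ?a \<in> bfun" for n by (rule truncate_bfun) auto
  have m [measurable]: "truncate n ?a \<in> borel_measurable M" for n by (rule bfun_measurable[OF b])
  have mb: "(\<lambda>w. - truncate n ?a w) \<in> bfun" for n using bfun_linear[OF b b, of "-1" _ 0] by simp
  have nonneg: "0 \<le> truncate n ?a w * g w" for n w using g_nonneg by (intro mult_nonneg_nonneg) (auto simp: truncate_def)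
  have ma: "(\<lambda>w. - \<bar>u w\<bar>) \<in> heart" by (rule heart_solid[OF _ u]) auto
  have "AE w in M. nn_cond_exp M F (\<lambda>w. ennreal (truncate n ?a w * g w)) w \<le> ennreal (increment x (\<lambda>w. - \<bar>u w\<bar>) w)" for n
  proof -
    have "AE w in M. nn_cond_exp M F (\<lambda>w. ennreal (truncate n ?a w * g w)) w < \<infinity>"
    proof (rule nn_cond_exp_finite)
      show "(\<integral>\<^sup>+ w. ennreal (truncate n ?a w * g w) \<partial>M) < \<infinity>"
        using nn_integral_eq_integral[OF bfun_integrable[OF b]] nonneg by simp
    qed auto
    then have 1: "AE w in M. nn_cond_exp M F (\<lambda>w. ennreal (truncate n ?a w * g w)) w = ennreal (real_cond_exp M F (\<lambda>w. truncate n ?a w * g w) w)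
        \<and> 0 \<le> real_cond_exp M F (\<lambda>w. truncate n ?a w * g w) w"
      by (intro nn_cond_exp_eq_real) (auto simp: nonneg)
    have 2: "AE w in M. real_cond_exp M F (\<lambda>w. -1 * (truncate n ?a w * g w)) w = -1 * real_cond_exp M F (\<lambda>w. truncate n ?a w * g w) w"
      by (rule real_cond_exp_cmult[OF bfun_integrable[OF b]])
    have 3: "AE w in M. increment x (\<lambda>w. - truncate n ?a w) w \<le> increment x (\<lambda>w. - \<bar>u w\<bar>) w"
    proof (rule increment_antimono[OF x_heart ma bfun_heart[OF mb]])
      show "AE w in M. - \<bar>u w\<bar> \<le> - truncate n ?a w"
        using truncate_abs_le[of n ?a] by (intro AE_I2) (auto simp: abs_le_iff)
    qed
    from 1 2 3 conditional_subgradient[OF mb, of n] show ?thesis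
      by eventually_elim (auto intro!: ennreal_leI)
  qed
  then have "AE w in M. \<forall>n. nn_cond_exp M F (\<lambda>w. ennreal (truncate n ?a w * g w)) w \<le> ennreal (increment x (\<lambda>w. - \<bar>u w\<bar>) w)"
    by (simp add: AE_all_countable)
  moreover have "AE w in M. nn_cond_exp M F (\<lambda>w. ennreal (\<bar>u w\<bar> * g w)) w
      = (SUP n. nn_cond_exp M F (\<lambda>w. ennreal (truncate n ?a w * g w)) w)"
    by (rule nn_cond_exp_truncate(1)) (auto simp: g_nonneg)
  ultimately show ?thesis
  proof eventually_elim
    case (elim w)
    have "nn_cond_exp M F (\<lambda>w. ennreal (\<bar>u w\<bar> * g w)) w \<le> ennreal (increment x (\<lambda>w. - \<bar>u w\<bar>) w)"
      unfolding elim(2) using elim(1) by (intro SUP_least) blast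
    then show ?case by (rule order.strict_trans1) simp
  qed
qed

lemma nn_cond_exp_heart_finite:
  assumes u: "u \<in> heart"
  shows "AE w in M. nn_cond_exp M F (\<lambda>w. ennreal (u w * g w)) w < \<infinity>"
proof -
  note [measurable] = heart_measurable[OF u]
  have "AE w in M. nn_cond_exp M F (\<lambda>w. ennreal (u w * g w)) w \<le> nn_cond_exp M F (\<lambda>w. ennreal (\<bar>u w\<bar> * g w)) w"
    by (rule nn_cond_exp_mono) (auto intro!: AE_I2 ennreal_leI mult_right_mono g_nonneg)
  with nn_cond_exp_abs_finite[OF u] show ?thesis
    by eventually_elim (auto intro: order.strict_trans1)
qed

lemma heart_uminus: "u \<in> heart \<Longrightarrow> (\<lambda>w. - u w) \<in> heart"
  using heart_affine[of u u "-1" 0] by simp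

text \<open>Convergence holds separately for the two \<open>nn_cond_exp\<close> whose difference is
  \<open>real_cond_exp\<close>: each is a monotone limit with finite value, although
  \<open>u * g\<close> may not be integrable.\<close>

lemma real_cond_exp_truncate:
  assumes u: "u \<in> heart"
  shows "AE w in M. (\<lambda>n. real_cond_exp M F (\<lambda>w. truncate n u w * g w) w) \<longlonglongrightarrow> real_cond_exp M F (\<lambda>w. u w * g w) w"
proof -
  note [measurable] = heart_measurable[OF u]
  have lim: "AE w in M. (\<lambda>n. enn2real (nn_cond_exp M F (\<lambda>w. ennreal (truncate n v w * g w)) w))
      \<longlonglongrightarrow> enn2real (nn_cond_exp M F (\<lambda>w. ennreal (v w * g w)) w)" if v: "v \<in> heart" for v
    using nn_cond_exp_truncate(2)[OF heart_measurable[OF v] g_measurable g_nonneg] nn_cond_exp_heart_finite[OF v]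
    by eventually_elim (auto intro!: tendsto_enn2real)
  from lim[OF u] lim[OF heart_uminus[OF u]] show ?thesis
    unfolding real_cond_exp_def truncate_uminus
    by eventually_elim (auto intro!: tendsto_diff)
qed

text \<open>The bounded inequality passes to the limit along truncations, its right-hand side by the
  Lebesgue property of \<open>\<rho>\<close>. In this arrangement it exhibits \<open>x\<close> as a
  maximiser in the Fenchel transform at \<open>- g\<close>.\<close>

lemma conditional_subgradient_heart:
  assumes x': "x' \<in> heart"
  shows "AE w in M. - real_cond_exp M F (\<lambda>w. x' w * g w) w - \<rho> x' w
    \<le> - real_cond_exp M F (\<lambda>w. x w * g w) w - \<rho> x w"
proof -
  note [measurable] = heart_measurable[OF x'] heart_measurable[OF x_heart]
  \<comment> \<open>Truncating \<open>x'\<close> and \<open>x\<close> separately, not their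
    difference, keeps each product with \<open>g\<close> integrable when the conditional expectation
    is split, and each of the two parts has its own limit.\<close>
  define u where "u n w = truncate n x' w - truncate n x w" for n w
  have b: "truncate n x \<in> bfun" "truncate n x' \<in> bfun" for n by (auto intro!: truncate_bfun)
  have u: "u n \<in> bfun" for n unfolding u_def using bfun_linear[OF b(2) b(1), of 1 _ "-1"] by simp
  have d: "(\<lambda>w. x' w - x w) \<in> heart" using heart_affine[OF x' x_heart, of 1 "-1"] by simp
  have "AE w in M. (\<lambda>n. increment x (u n) w) \<longlonglongrightarrow> increment x (\<lambda>w. x' w - x w) w"
  proof (rule increment_lebesgue[OF x_heart bfun_heart[OF u] d heart_abs_add[OF x' x_heart]])
    show "AE w in M. (\<lambda>n. u n w) \<longlonglongrightarrow> x' w - x w"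
      unfolding u_def by (intro AE_I2 tendsto_diff truncate_tendsto)
    show "AE w in M. \<bar>u n w\<bar> \<le> \<bar>x' w\<bar> + \<bar>x w\<bar>" for n
    proof (rule AE_I2)
      fix w show "\<bar>u n w\<bar> \<le> \<bar>x' w\<bar> + \<bar>x w\<bar>"
        using truncate_abs_le[of n x w] truncate_abs_le[of n x' w] unfolding u_def by linarith
    qed
  qed
  moreover have "AE w in M. \<forall>n. real_cond_exp M F (\<lambda>w. truncate n x w * g w) w - real_cond_exp M F (\<lambda>w. truncate n x' w * g w) w
      \<le> increment x (u n) w"
    unfolding AE_all_countable
  proof
    fix n
    have "AE w in M. real_cond_exp M F (\<lambda>w. truncate n x' w * g w - truncate n x w * g w) w
        = real_cond_exp M F (\<lambda>w. truncate n x' w * g w) w - real_cond_exp M F (\<lambda>w. truncate n x w * g w) w"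
      by (rule real_cond_exp_diff[OF bfun_integrable[OF b(2)] bfun_integrable[OF b(1)]])
    with conditional_subgradient[OF u, of n]
    show "AE w in M. real_cond_exp M F (\<lambda>w. truncate n x w * g w) w - real_cond_exp M F (\<lambda>w. truncate n x' w * g w) w
      \<le> increment x (u n) w"
      by eventually_elim (simp add: u_def left_diff_distrib)
  qed
  ultimately show ?thesis
    using real_cond_exp_truncate[OF x'] real_cond_exp_truncate[OF x_heart]
  proof eventually_elim
    case (elim w)
    have "real_cond_exp M F (\<lambda>w. x w * g w) w - real_cond_exp M F (\<lambda>w. x' w * g w) w \<le> increment x (\<lambda>w. x' w - x w) w"
      by (rule LIMSEQ_le[OF tendsto_diff[OF elim(4,3)] elim(1)]) (use elim(2) in auto)
    then show ?case by (simp add: increment_def)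
  qed
qed

lemma ext_cond_exp_neg_g:
  assumes u: "u \<in> heart"
  shows "AE w in M. ext_cond_exp M F (\<lambda>w. ereal (u w * - g w)) w = ereal (- real_cond_exp M F (\<lambda>w. u w * g w) w)"
proof -
  note [measurable] = heart_measurable[OF u]
  have "AE w in M. ext_cond_exp M F (\<lambda>w. ereal (u w * - g w)) w =
      enn2ereal (nn_cond_exp M F (\<lambda>w. ennreal (- (u w * g w))) w) - enn2ereal (nn_cond_exp M F (\<lambda>w. ennreal (u w * g w)) w)"
    using ext_cond_exp_eq[of "\<lambda>w. ereal (u w * - g w)"] by simp
  with nn_cond_exp_heart_finite[OF u] nn_cond_exp_heart_finite[OF heart_uminus[OF u]]
  show ?thesis
  proof eventually_elim
    case (elim w)
    then show ?case
      by (cases "nn_cond_exp M F (\<lambda>w. ennreal (u w * g w)) w"; cases "nn_cond_exp M F (\<lambda>w. ennreal (- (u w * g w))) w")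
        (auto simp: real_cond_exp_def)
  qed
qed

text \<open>The family has a maximum, attained at \<open>x\<close>. This shows both that an
  essential supremum exists, so that the choice in \<open>family_esssup\<close> is meaningful, and
  what it is a.s.\<close>

lemma fenchel_transform_neg_g:
  "AE w in M. fenchel_transform M F heart \<rho> (\<lambda>w. - g w) w
    = ereal (- real_cond_exp M F (\<lambda>w. x w * g w) w - \<rho> x w)"
proof -
  define A where "A = (\<lambda>x. \<lambda>w. ext_cond_exp M F (\<lambda>w. ereal (x w * - g w)) w - ereal (\<rho> x w)) ` heart"
  define m where "m w = ereal (- real_cond_exp M F (\<lambda>w. x w * g w) w - \<rho> x w)" for w
  have m: "m \<in> borel_measurable F"
    unfolding m_def using rho_measurable_F[OF x_heart] by measurable
  have le: "AE w in M. h w \<le> m w" if hA: "h \<in> A" for h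
  proof -
    obtain x' where x': "x' \<in> heart" and h: "h = (\<lambda>w. ext_cond_exp M F (\<lambda>w. ereal (x' w * - g w)) w - ereal (\<rho> x' w))"
      using hA unfolding A_def by blast
    from conditional_subgradient_heart[OF x'] ext_cond_exp_neg_g[OF x'] show ?thesis
      by eventually_elim (simp add: h m_def)
  qed
  have mx: "\<exists>h\<in>A. AE w in M. h w = m w"
  proof (intro bexI)
    show "AE w in M. ext_cond_exp M F (\<lambda>w. ereal (x w * - g w)) w - ereal (\<rho> x w) = m w"
      using ext_cond_exp_neg_g[OF x_heart] by eventually_elim (simp add: m_def)
    show "(\<lambda>w. ext_cond_exp M F (\<lambda>w. ereal (x w * - g w)) w - ereal (\<rho> x w)) \<in> A"
      unfolding A_def using x_heart by blast
  qed
  have "is_family_esssup M F A m"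
    unfolding is_family_esssup_def
  proof (intro conjI ballI impI m le)
    fix h assume "\<forall>f\<in>A. AE w in M. f w \<le> h w"
    with mx obtain k where "AE w in M. k w = m w" "AE w in M. k w \<le> h w" by blast
    then show "AE w in M. m w \<le> h w" by eventually_elim simp
  qed
  then have e: "is_family_esssup M F A (family_esssup M F A)"
    unfolding family_esssup_def by (rule someI[of "is_family_esssup M F A"])
  have "AE w in M. family_esssup M F A w \<le> m w"
    using e m le unfolding is_family_esssup_def by blast
  moreover have "AE w in M. m w \<le> family_esssup M F A w"
  proof -
    from mx e obtain k where "AE w in M. k w = m w" "AE w in M. k w \<le> family_esssup M F A w"
      unfolding is_family_esssup_def by blast
    then show ?thesis by eventually_elim simp
  qed
  ultimately show ?thesis
    unfolding fenchel_transform_def A_def[symmetric] m_def by eventually_elim (rule antisym)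
qed

end

section \<open>Membership in the conditional Orlicz space of the conjugate\<close>

text \<open>The selector \<open>conj_argmax\<close> maximises \<open>r * s - f s\<close> over finitely many points \<open>s\<close> of a
  dense sequence \<open>Q\<close>.\<close>

primrec conj_argmax :: "(real \<Rightarrow> real) \<Rightarrow> (nat \<Rightarrow> real) \<Rightarrow> nat \<Rightarrow> real \<Rightarrow> real" where
  "conj_argmax f Q 0 r = 0"
| "conj_argmax f Q (Suc j) r =
    (if r * conj_argmax f Q j r - f (conj_argmax f Q j r) < r * Q j - f (Q j) then Q j else conj_argmax f Q j r)"

text \<open>The conjugate of \<open>f\<close> restricted to finitely many points. The point 0 is
  always a candidate, so the values are nonnegative when \<open>f 0 = 0\<close>; the maximiser
  itself is kept because it is Borel and bounded above in \<open>r\<close>.\<close>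

definition conj_approx :: "(real \<Rightarrow> real) \<Rightarrow> (nat \<Rightarrow> real) \<Rightarrow> nat \<Rightarrow> real \<Rightarrow> real" where
  "conj_approx f Q j r = r * conj_argmax f Q j r - f (conj_argmax f Q j r)"

lemma conj_approx_Suc: "conj_approx f Q j r \<le> conj_approx f Q (Suc j) r"
  and conj_approx_ge: "r * Q j - f (Q j) \<le> conj_approx f Q (Suc j) r"
  by (auto simp: conj_approx_def)

lemma conj_approx_nonneg: "f 0 = 0 \<Longrightarrow> 0 \<le> conj_approx f Q j r"
  by (induction j) (auto simp: conj_approx_def)

lemma conj_argmax_nonneg: "(\<And>j. 0 \<le> Q j) \<Longrightarrow> 0 \<le> conj_argmax f Q j r"
  by (induction j) auto

lemma conj_argmax_bounded: "\<exists>C. \<forall>r. conj_argmax f Q j r \<le> C"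
proof (induction j)
  case (Suc j)
  then obtain C where "\<forall>r. conj_argmax f Q j r \<le> C" by blast
  then show ?case by (intro exI[of _ "max C (Q j)"]) (auto simp: le_max_iff_disj)
qed auto

lemma conj_argmax_measurable [measurable]:
  assumes [measurable]: "f \<in> borel_measurable borel"
  shows "conj_argmax f Q j \<in> borel_measurable borel"
proof (induction j)
  case (Suc j)
  note [measurable] = Suc
  show ?case by simp
qed simp

lemma conj_approx_measurable [measurable]:
  assumes [measurable]: "f \<in> borel_measurable borel"
  shows "conj_approx f Q j \<in> borel_measurable borel"
  unfolding conj_approx_def by measurable

text \<open>Rational points suffice: moving \<open>s\<close> slightly down to a rational costs
  little in the linear term, and \<open>f\<close> does not increase.\<close>

lemma conj_approx_SUP:
  assumes mono: "mono f" and f0: "f 0 = 0" and Q: "range Q = {q \<in> \<rat>. 0 \<le> q}" and r: "0 \<le> r"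
  shows "(SUP s\<in>{0..}. ereal (r * s) - ereal (f s)) = (SUP j. ereal (conj_approx f Q j r))"
proof (rule antisym)
  have Q0: "0 \<le> Q j" for j using Q by blast
  show "(SUP j. ereal (conj_approx f Q j r)) \<le> (SUP s\<in>{0..}. ereal (r * s) - ereal (f s))"
  proof (rule SUP_least)
    fix j
    have "ereal (conj_approx f Q j r) = ereal (r * conj_argmax f Q j r) - ereal (f (conj_argmax f Q j r))"
      by (simp add: conj_approx_def)
    also have "\<dots> \<le> (SUP s\<in>{0..}. ereal (r * s) - ereal (f s))"
      by (rule SUP_upper) (simp add: conj_argmax_nonneg Q0)
    finally show "ereal (conj_approx f Q j r) \<le> (SUP s\<in>{0..}. ereal (r * s) - ereal (f s))" .
  qed
  show "(SUP s\<in>{0..}. ereal (r * s) - ereal (f s)) \<le> (SUP j. ereal (conj_approx f Q j r))"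
  proof (rule SUP_least)
    fix s :: real assume "s \<in> {0..}"
    then have s: "0 \<le> s" by simp
    show "ereal (r * s) - ereal (f s) \<le> (SUP j. ereal (conj_approx f Q j r))"
    proof (rule ereal_le_epsilon2)
      fix e :: real assume e: "0 < e"
      \<comment> \<open>The tolerance is \<open>e / (r + 1)\<close> so that the quotient makes sense
        for \<open>r = 0\<close> as well.\<close>
      have "\<exists>q\<in>\<rat>. 0 \<le> q \<and> q \<le> s \<and> r * s - r * q \<le> e"
      proof (cases "s = 0")
        case True
        then show ?thesis using e by (intro bexI[of _ 0]) auto
      next
        case False
        with s have "max 0 (s - e / (r + 1)) < s" using e r by auto
        then obtain q where q: "q \<in> \<rat>" "max 0 (s - e / (r + 1)) < q" "q < s" using Rats_dense_in_real by blast
        have "r * (s - q) \<le> (r + 1) * (s - q)" using q by (intro mult_right_mono) auto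
        also have "\<dots> \<le> (r + 1) * (e / (r + 1))" using q r by (intro mult_left_mono) auto
        also have "\<dots> = e" using r by simp
        finally show ?thesis using q by (intro bexI[of _ q]) (auto simp: algebra_simps)
      qed
      then obtain j where j: "0 \<le> Q j" "Q j \<le> s" "r * s - r * Q j \<le> e" using Q by (metis (mono_tags, lifting) imageE mem_Collect_eq)
      have "r * s - f s \<le> r * Q j - f (Q j) + e" using monoD[OF mono j(2)] j(3) by simp
      \<comment> \<open>Stage \<open>j\<close> has only compared \<open>Q 0\<close> to
        \<open>Q (j - 1)\<close>; the point \<open>Q j\<close> enters at stage
        \<open>Suc j\<close>.\<close>
      also have "\<dots> \<le> conj_approx f Q (Suc j) r + e" using conj_approx_ge[of r Q j f] by simp
      finally have "ereal (r * s) - ereal (f s) \<le> ereal (conj_approx f Q (Suc j) r) + ereal e" by simp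
      also have "\<dots> \<le> (SUP j. ereal (conj_approx f Q j r)) + ereal e"
        by (intro add_right_mono SUP_upper) simp
      finally show "ereal (r * s) - ereal (f s) \<le> (SUP j. ereal (conj_approx f Q j r)) + ereal e" .
    qed
  qed
qed

context risk_subgradient
begin

text \<open>If \<open>E[\<psi> (g / 4\<^sup>k) | F] = \<infinity>\<close> for all \<open>k\<close> on a nonnegligible set, scaling approximate
  maximisers in the definition of \<open>\<psi>\<close> yields \<open>v k \<ge> 0\<close> with \<open>E[f (v k)] \<le> 1\<close> and
  \<open>E[v k * g | F] \<ge> 4\<^sup>k\<close> there; the element of the heart dominating all \<open>v k / 2\<^sup>k\<close> then
  contradicts \<open>nn_cond_exp_abs_finite\<close>.\<close>

lemma conjugate_cond_exp_finite:
  assumes Q: "\<And>j. 0 \<le> Q j"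
  shows "AE w in M. \<exists>k::nat. nn_cond_exp M F (\<lambda>w. SUP j. ennreal (conj_approx f Q j (g w / 4 ^ k))) w < \<infinity>"
proof -
  define V where "V k j = nn_cond_exp M F (\<lambda>w. ennreal (conj_approx f Q j (g w / 4 ^ k)))" for k j :: nat
  have [measurable]: "V k j \<in> borel_measurable F" for k j unfolding V_def by measurable
  define B where "B = {w \<in> space F. \<forall>k. nn_cond_exp M F (\<lambda>w. SUP j. ennreal (conj_approx f Q j (g w / 4 ^ k))) w = \<infinity>}"
  have B_F: "B \<in> sets F" unfolding B_def by measurable
  then have B_M: "B \<in> sets M" using subalg by (auto simp: subalgebra_def)
  have "measure M B = 0"
  proof (rule ccontr)
    assume "measure M B \<noteq> 0"
    then have pos: "measure M B > 0" using measure_nonneg[of M B] by linarith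
    \<comment> \<open>On \<open>B\<close> the suprema are infinite, so any threshold is passed; 1 is
      the one that fits \<open>c\<close> below. Asking for all \<open>i \<ge> j\<close> makes
      \<open>S k\<close> increase in \<open>j\<close> at every point, while \<open>V k\<close> is
      monotone only a.s.\<close>
    define S where "S k j = {w \<in> space F. \<forall>i\<ge>j. 1 \<le> V k i w}" for k j
    have S_F: "S k j \<in> sets F" for k j unfolding S_def by measurable
    have S_M: "S k j \<in> sets M" for k j using S_F subalg by (auto simp: subalgebra_def)
    have inc: "AE w in M. \<forall>k j. V k j w \<le> V k (Suc j) w"
      unfolding AE_all_countable V_def
      by (intro allI nn_cond_exp_mono AE_I2 ennreal_leI conj_approx_Suc) auto
    have sup: "AE w in M. \<forall>k. nn_cond_exp M F (\<lambda>w. SUP j. ennreal (conj_approx f Q j (g w / 4 ^ k))) w = (SUP j. V k j w)"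
      unfolding AE_all_countable V_def
      by (intro allI nn_cond_exp_SUP AE_I2 ennreal_leI conj_approx_Suc) auto
    have "\<exists>J. measure M (B \<inter> (\<Inter>k. S k (J k))) > 0"
    proof (rule uniform_exhaustion[OF S_M _ B_M pos])
      show "incseq (S k)" for k by (auto simp: S_def incseq_def)
      show "AE w in M. w \<in> B \<longrightarrow> (\<forall>k. \<exists>j. w \<in> S k j)"
        using inc sup
      proof eventually_elim
        case (elim w)
        show ?case
        proof (intro impI allI)
          fix k assume w: "w \<in> B"
          then have "(SUP j. V k j w) = \<infinity>" using elim(2) by (auto simp: B_def)
          then have "1 < (SUP j. V k j w)"
            by (simp only: infinity_ennreal_def ennreal_one_less_top)
          then obtain j where "1 < V k j w" by (auto simp: less_SUP_iff)
          have "incseq (\<lambda>j. V k j w)" using elim(1) by (auto intro: incseq_SucI)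
          then have "V k j w \<le> V k i w" if "j \<le> i" for i using that by (rule incseqD)
          with \<open>1 < V k j w\<close> have "\<forall>i\<ge>j. 1 \<le> V k i w" by (auto intro: less_imp_le order.strict_trans2)
          then show "\<exists>j. w \<in> S k j" using w by (auto simp: S_def B_def)
        qed
      qed
    qed
    then obtain J where J: "measure M (B \<inter> (\<Inter>k. S k (J k))) > 0" by auto
    define A where "A = B \<inter> (\<Inter>k. S k (J k))"
    have A_M: "A \<in> sets M" unfolding A_def using B_M S_M by auto
    have AV: "1 \<le> V k (J k) w" if "w \<in> A" for w k using that by (auto simp: A_def S_def)
    \<comment> \<open>The finite-stage maximiser for the slope \<open>g / 4 ^ k\<close>. It takes
      finitely many candidates at a fixed stage \<open>J k\<close>, hence is bounded by a constant
      \<open>C k\<close>.\<close>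
    define s where "s k w = conj_argmax f Q (J k) (g w / 4 ^ k)" for k w
    have s_meas [measurable]: "s k \<in> borel_measurable M" for k unfolding s_def by measurable
    have s_nonneg: "0 \<le> s k w" for k w unfolding s_def by (rule conj_argmax_nonneg[OF Q])
    have "\<forall>k. \<exists>c. \<forall>w. s k w \<le> c" unfolding s_def using conj_argmax_bounded by blast
    from choice[OF this] obtain C where C: "\<And>k w. s k w \<le> C k" by auto
    define a where "a k w = enn2real (nn_cond_exp M F (\<lambda>w. ennreal (f (s k w))) w)" for k w
    have [measurable]: "a k \<in> borel_measurable F" for k unfolding a_def by measurable
    have a_nonneg: "0 \<le> a k w" for k w by (simp add: a_def)
    have a: "AE w in M. nn_cond_exp M F (\<lambda>w. ennreal (f (s k w))) w = ennreal (a k w)" for k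
    proof -
      have "(\<integral>\<^sup>+ w. ennreal (f (s k w)) \<partial>M) \<le> (\<integral>\<^sup>+ w. ennreal (f (C k)) \<partial>M)"
        by (intro nn_integral_mono ennreal_leI monoD[OF f_mono] C)
      also have "\<dots> < \<infinity>" by (simp add: emeasure_space_1)
      finally have "AE w in M. nn_cond_exp M F (\<lambda>w. ennreal (f (s k w))) w < \<infinity>"
        by (intro nn_cond_exp_finite) auto
      then show ?thesis by eventually_elim (simp add: a_def)
    qed
    \<comment> \<open>Normalisation by an \<open>F\<close>-measurable factor. By
      \<open>f_star\<close>, \<open>E[f (c * s) | F] \<le> c * a \<le> 1\<close>; on
      \<open>A\<close>, where \<open>V k (J k) \<ge> 1\<close>, one has
      \<open>E[s * g | F] \<ge> 4 ^ k * (1 + a)\<close>, so \<open>c * s\<close> still pairs with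
      \<open>g\<close> to at least \<open>4 ^ k\<close>.\<close>
    define c where "c k w = 1 / (1 + a k w)" for k w
    have c_F [measurable]: "c k \<in> borel_measurable F" for k unfolding c_def by measurable
    have [measurable]: "c k \<in> borel_measurable M" for k by (rule measurable_from_subalg[OF subalg c_F])
    have c01: "0 < c k w" "c k w \<le> 1" for k w using a_nonneg[of k w] by (auto simp: c_def)
    define v where "v k w = c k w * s k w" for k w
    have v_meas [measurable]: "v k \<in> borel_measurable M" for k unfolding v_def by measurable
    have v_nonneg: "0 \<le> v k w" for k w using c01(1)[of k w] s_nonneg[of k w] by (simp add: v_def)
    have vC: "v k w \<le> C k" for k w
    proof -
      have "v k w \<le> 1 * s k w" unfolding v_def using c01 s_nonneg by (intro mult_right_mono) auto
      then show ?thesis using C[of k w] by simp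
    qed
    have v_int: "(\<integral>\<^sup>+ w. ennreal (f (v k w)) \<partial>M) \<le> 1" for k
    proof -
      have "(\<integral>\<^sup>+ w. ennreal (f (v k w)) \<partial>M) \<le> (\<integral>\<^sup>+ w. ennreal (c k w) * ennreal (f (s k w)) \<partial>M)"
      proof (rule nn_integral_mono)
        fix w
        have "f (v k w) \<le> c k w * f (s k w)"
          unfolding v_def using c01[of k w] s_nonneg by (intro f_star) auto
        then have "ennreal (f (v k w)) \<le> ennreal (c k w * f (s k w))" by (rule ennreal_leI)
        also have "\<dots> = ennreal (c k w) * ennreal (f (s k w))"
          using c01[of k w] f_nonneg[OF s_nonneg] by (intro ennreal_mult) auto
        finally show "ennreal (f (v k w)) \<le> ennreal (c k w) * ennreal (f (s k w))" .
      qed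
      also have "\<dots> = (\<integral>\<^sup>+ w. ennreal (c k w) * nn_cond_exp M F (\<lambda>w. ennreal (f (s k w))) w \<partial>M)"
        by (rule nn_cond_exp_intg[symmetric]) auto
      also have "\<dots> = (\<integral>\<^sup>+ w. ennreal (c k w * a k w) \<partial>M)"
        using a[of k] c01 a_nonneg
        by (intro nn_integral_cong_AE) (auto elim!: eventually_mono simp: ennreal_mult less_imp_le)
      also have "\<dots> \<le> (\<integral>\<^sup>+ w. ennreal 1 \<partial>M)"
        using a_nonneg by (intro nn_integral_mono ennreal_leI) (auto simp: c_def field_simps add_pos_nonneg)
      also have "\<dots> = 1" by (simp add: emeasure_space_1)
      finally show ?thesis .
    qed
    have v_big: "AE w in M. w \<in> A \<longrightarrow> ennreal (4 ^ k) \<le> nn_cond_exp M F (\<lambda>w. ennreal (v k w * g w)) w" for k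
    proof -
      \<comment> \<open>Equality in Young's inequality at the maximiser, which is the definition of
        \<open>conj_approx\<close> rearranged. Both terms on the right are nonnegative, so the
        identity survives in \<open>ennreal\<close>.\<close>
      have eq: "ennreal (1 / 4 ^ k) * ennreal (s k w * g w) =
          ennreal (conj_approx f Q (J k) (g w / 4 ^ k)) + ennreal (f (s k w))" for w
      proof -
        have "ennreal (1 / 4 ^ k) * ennreal (s k w * g w) = ennreal (1 / 4 ^ k * (s k w * g w))"
          using s_nonneg g_nonneg by (intro ennreal_mult[symmetric]) auto
        also have "1 / 4 ^ k * (s k w * g w) = conj_approx f Q (J k) (g w / 4 ^ k) + f (s k w)"
          by (simp add: conj_approx_def s_def)
        also have "ennreal \<dots> = ennreal (conj_approx f Q (J k) (g w / 4 ^ k)) + ennreal (f (s k w))"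
          by (intro ennreal_plus conj_approx_nonneg f_zero f_nonneg s_nonneg)
        finally show ?thesis .
      qed
      have 1: "AE w in M. ennreal (1 / 4 ^ k) * nn_cond_exp M F (\<lambda>w. ennreal (s k w * g w)) w
          = nn_cond_exp M F (\<lambda>w. ennreal (1 / 4 ^ k) * ennreal (s k w * g w)) w"
        by (rule nn_cond_exp_prod) auto
      have 2: "AE w in M. V k (J k) w + nn_cond_exp M F (\<lambda>w. ennreal (f (s k w))) w
          = nn_cond_exp M F (\<lambda>w. ennreal (1 / 4 ^ k) * ennreal (s k w * g w)) w"
        unfolding eq V_def by (rule nn_cond_exp_sum) auto
      have 3: "AE w in M. ennreal (c k w) * nn_cond_exp M F (\<lambda>w. ennreal (s k w * g w)) w
          = nn_cond_exp M F (\<lambda>w. ennreal (c k w) * ennreal (s k w * g w)) w"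
        by (rule nn_cond_exp_prod) auto
      have 4: "ennreal (c k w) * ennreal (s k w * g w) = ennreal (v k w * g w)" for w
        using c01[of k w] s_nonneg[of k w] g_nonneg[of w] by (simp add: v_def mult.assoc ennreal_mult[symmetric])
      from 1 2 3 a[of k] show ?thesis
        unfolding 4
      proof eventually_elim
        case (elim w)
        show ?case
        proof
          assume "w \<in> A"
          have "ennreal (1 + a k w) = 1 + ennreal (a k w)" using a_nonneg by (simp add: ennreal_plus)
          also have "\<dots> \<le> V k (J k) w + ennreal (a k w)" using AV[OF \<open>w \<in> A\<close>] by (intro add_right_mono)
          also have "\<dots> = ennreal (1 / 4 ^ k) * nn_cond_exp M F (\<lambda>w. ennreal (s k w * g w)) w"
            using elim(1,2,4) by simp
          finally have le: "ennreal (1 + a k w) \<le> ennreal (1 / 4 ^ k) * nn_cond_exp M F (\<lambda>w. ennreal (s k w * g w)) w" .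
          have "ennreal (4 ^ k) = ennreal (4 ^ k * c k w) * ennreal (1 + a k w)"
            using a_nonneg[of k w] by (subst ennreal_mult[symmetric]) (auto simp: c_def)
          also have "\<dots> \<le> ennreal (4 ^ k * c k w) * (ennreal (1 / 4 ^ k) * nn_cond_exp M F (\<lambda>w. ennreal (s k w * g w)) w)"
            by (intro mult_left_mono le) auto
          also have "\<dots> = ennreal (4 ^ k * c k w * (1 / 4 ^ k)) * nn_cond_exp M F (\<lambda>w. ennreal (s k w * g w)) w"
            using c01[of k w] by (subst mult.assoc[symmetric], subst ennreal_mult[symmetric]) auto
          also have "4 ^ k * c k w * (1 / 4 ^ k) = c k w" by simp
          also have "ennreal (c k w) * nn_cond_exp M F (\<lambda>w. ennreal (s k w * g w)) w = nn_cond_exp M F (\<lambda>w. ennreal (v k w * g w)) w"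
            by (rule elim(3))
          finally show "ennreal (4 ^ k) \<le> nn_cond_exp M F (\<lambda>w. ennreal (v k w * g w)) w" .
        qed
      qed
    qed
    \<comment> \<open>The weight \<open>2 ^ k\<close> balances two demands. For
      \<open>k \<ge> N\<close> the factor \<open>N / 2 ^ k\<close> is at most 1, so
      \<open>f_star\<close> bounds the integrals by the summable \<open>N / 2 ^ k\<close>; and of
      the growth \<open>4 ^ k\<close> an unbounded \<open>2 ^ k\<close> remains.\<close>
    have "\<exists>y\<in>heart. \<forall>k. AE w in M. v k w / 2 ^ k \<le> y w"
    proof (rule heart_dominating)
      fix N :: nat
      define b where "b k = (if k \<in> {..<N} then f (real N * C k) else 0)" for k
      have "(\<integral>\<^sup>+ w. ennreal (f (real N * (v k w / 2 ^ k))) \<partial>M) \<le> ennreal (real N * (1/2) ^ k) + ennreal (b k)" for k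
      proof (cases "k < N")
        case True
        have "real N * (v k w / 2 ^ k) \<le> real N * C k" for w
        proof (intro mult_left_mono)
          have "v k w / 2 ^ k \<le> v k w / 1" using v_nonneg[of k w] by (intro divide_left_mono) auto
          then show "v k w / 2 ^ k \<le> C k" using vC[of k w] by simp
        qed simp
        then have "(\<integral>\<^sup>+ w. ennreal (f (real N * (v k w / 2 ^ k))) \<partial>M) \<le> (\<integral>\<^sup>+ w. ennreal (f (real N * C k)) \<partial>M)"
          by (intro nn_integral_mono ennreal_leI monoD[OF f_mono])
        then show ?thesis using True by (simp add: b_def emeasure_space_1 add_increasing)
      next
        case False
        have "N < 2 ^ N" by (rule less_exp)
        also have "(2::nat) ^ N \<le> 2 ^ k" using False by (intro power_increasing) auto
        finally have "real N < 2 ^ k" by (metis of_nat_less_iff of_nat_numeral of_nat_power)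
        then have q: "0 \<le> real N * (1/2) ^ k" "real N * (1/2) ^ k \<le> 1" by (auto simp: power_one_over field_simps)
        have "f (real N * (v k w / 2 ^ k)) \<le> real N * (1/2) ^ k * f (v k w)" for w
          using f_star[OF q v_nonneg[of k w]] by (simp add: power_one_over field_simps)
        then have "(\<integral>\<^sup>+ w. ennreal (f (real N * (v k w / 2 ^ k))) \<partial>M) \<le> (\<integral>\<^sup>+ w. ennreal (real N * (1/2) ^ k) * ennreal (f (v k w)) \<partial>M)"
          using q f_nonneg[OF v_nonneg] by (intro nn_integral_mono) (metis ennreal_leI ennreal_mult)
        also have "\<dots> = ennreal (real N * (1/2) ^ k) * (\<integral>\<^sup>+ w. ennreal (f (v k w)) \<partial>M)"
          by (rule nn_integral_cmult) auto
        also have "\<dots> \<le> ennreal (real N * (1/2) ^ k) * 1" by (intro mult_left_mono v_int) auto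
        finally show ?thesis by (simp add: add_increasing2)
      qed
      then have "(\<Sum>k. \<integral>\<^sup>+ w. ennreal (f (real N * (v k w / 2 ^ k))) \<partial>M) \<le> (\<Sum>k. ennreal (real N * (1/2) ^ k) + ennreal (b k))"
        by (intro suminf_le) auto
      also have "\<dots> = (\<Sum>k. ennreal (real N * (1/2) ^ k)) + (\<Sum>k. ennreal (b k))" by (rule suminf_add[symmetric]) auto
      also have "(\<Sum>k. ennreal (b k)) = (\<Sum>k<N. ennreal (b k))" by (rule suminf_finite) (auto simp: b_def)
      also have "(\<Sum>k. ennreal (real N * (1/2) ^ k)) = ennreal (\<Sum>k. real N * (1/2) ^ k)"
        by (rule suminf_ennreal2) (auto intro!: summable_mult)
      also have "\<dots> + (\<Sum>k<N. ennreal (b k)) < \<infinity>" by auto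
      finally show "(\<Sum>k. \<integral>\<^sup>+ w. ennreal (f (real N * (v k w / 2 ^ k))) \<partial>M) < \<infinity>" .
    qed (use v_nonneg in auto)
    then obtain y where y: "y \<in> heart" "\<And>k. AE w in M. v k w / 2 ^ k \<le> y w" by auto
    note [measurable] = heart_measurable[OF y(1)]
    have "AE w in M. w \<in> A \<longrightarrow> ennreal (2 ^ k) \<le> nn_cond_exp M F (\<lambda>w. ennreal (\<bar>y w\<bar> * g w)) w" for k
    proof -
      have 1: "AE w in M. ennreal (1 / 2 ^ k) * nn_cond_exp M F (\<lambda>w. ennreal (v k w * g w)) w
          = nn_cond_exp M F (\<lambda>w. ennreal (1 / 2 ^ k) * ennreal (v k w * g w)) w"
        by (rule nn_cond_exp_prod) auto
      have 2: "AE w in M. nn_cond_exp M F (\<lambda>w. ennreal (1 / 2 ^ k) * ennreal (v k w * g w)) w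
          \<le> nn_cond_exp M F (\<lambda>w. ennreal (\<bar>y w\<bar> * g w)) w"
      proof (rule nn_cond_exp_mono)
        show "AE w in M. ennreal (1 / 2 ^ k) * ennreal (v k w * g w) \<le> ennreal (\<bar>y w\<bar> * g w)"
          using y(2)[of k]
        proof eventually_elim
          case (elim w)
          have "ennreal (1 / 2 ^ k) * ennreal (v k w * g w) = ennreal (1 / 2 ^ k * (v k w * g w))"
            using v_nonneg g_nonneg by (intro ennreal_mult[symmetric]) auto
          also have "1 / 2 ^ k * (v k w * g w) = v k w / 2 ^ k * g w" by simp
          also have "ennreal \<dots> \<le> ennreal (\<bar>y w\<bar> * g w)"
            using elim g_nonneg by (intro ennreal_leI mult_right_mono) auto
          finally show ?case .
        qed
      qed auto
      from 1 2 v_big[of k] show ?thesis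
      proof eventually_elim
        case (elim w)
        show ?case
        proof
          assume "w \<in> A"
          have "ennreal (2 ^ k) = ennreal (1 / 2 ^ k) * ennreal (4 ^ k)"
            by (subst ennreal_mult[symmetric]) (auto simp: field_simps power_mult_distrib[symmetric])
          also have "\<dots> \<le> ennreal (1 / 2 ^ k) * nn_cond_exp M F (\<lambda>w. ennreal (v k w * g w)) w"
            using elim(3) \<open>w \<in> A\<close> by (intro mult_left_mono) auto
          also have "\<dots> \<le> nn_cond_exp M F (\<lambda>w. ennreal (\<bar>y w\<bar> * g w)) w" using elim(1,2) by simp
          finally show "ennreal (2 ^ k) \<le> nn_cond_exp M F (\<lambda>w. ennreal (\<bar>y w\<bar> * g w)) w" .
        qed
      qed
    qed
    then have "AE w in M. \<forall>k. w \<in> A \<longrightarrow> ennreal (2 ^ k) \<le> nn_cond_exp M F (\<lambda>w. ennreal (\<bar>y w\<bar> * g w)) w"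
      by (simp only: AE_all_countable) simp
    with nn_cond_exp_abs_finite[OF y(1)] have "AE w in M. w \<notin> A"
    proof eventually_elim
      case (elim w)
      show ?case
      proof
        assume wA: "w \<in> A"
        obtain r where r: "nn_cond_exp M F (\<lambda>w. ennreal (\<bar>y w\<bar> * g w)) w = ennreal r" "0 \<le> r"
          using elim(1) by (cases "nn_cond_exp M F (\<lambda>w. ennreal (\<bar>y w\<bar> * g w)) w") auto
        obtain k where "r < 2 ^ k" using real_arch_pow[of 2 r] by auto
        moreover have "2 ^ k \<le> r" using elim(2) wA r by (metis ennreal_le_iff)
        ultimately show False by simp
      qed
    qed
    then have "measure M A = 0" by (subst measure_eq_0_null_sets) (auto simp: AE_iff_null_sets[OF A_M])
    with J show False by (simp add: A_def)
  qed
  then have "B \<in> null_sets M" using B_M by (auto simp: null_sets_def emeasure_eq_measure)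
  then have "AE w in M. w \<notin> B" by (rule AE_not_in)
  with AE_space show ?thesis
    by eventually_elim (use subalg in \<open>auto simp: B_def subalgebra_def top.not_eq_extremum\<close>)
qed

text \<open>The exponent \<open>k\<close> that makes the conditional expectation finite depends on
  the point. Its least choice \<open>K\<close> is \<open>F\<close>-measurable, so
  \<open>\<eta> = (1/4) ^ K\<close> is an admissible multiplier, and on each \<open>F\<close>-set
  where \<open>K\<close> is constant locality reduces to that fixed exponent.\<close>

lemma neg_g_cond_orlicz_space:
  assumes psi: "\<And>r. 0 \<le> r \<Longrightarrow> \<psi> r = (SUP s\<in>{0..}. ereal (r * s) - ereal (f s))"
  shows "(\<lambda>w. - g w) \<in> cond_orlicz_space M F \<psi>"
proof -
  have "countable {q \<in> \<rat>. 0 \<le> (q::real)}" by (rule countable_subset[OF _ countable_rat]) auto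
  moreover have "{q \<in> \<rat>. 0 \<le> (q::real)} \<noteq> {}" by (auto intro: exI[of _ 0])
  ultimately obtain Q :: "nat \<Rightarrow> real" where Q: "range Q = {q \<in> \<rat>. 0 \<le> q}"
    using range_from_nat_into by metis
  have Q0: "0 \<le> Q j" for j using Q by blast
  \<comment> \<open>A countable supremum of Borel functions on the whole line that agrees with
    \<open>\<psi>\<close> on the half-line; it supplies the measurability of the composed
    functions.\<close>
  define P where "P r = (SUP j. ereal (conj_approx f Q j r))" for r
  have psiP: "\<psi> r = P r" if "0 \<le> r" for r
    unfolding P_def psi[OF that] by (rule conj_approx_SUP[OF f_mono f_zero Q that])
  have P_nonneg: "0 \<le> P r" for r
    unfolding P_def using conj_approx_nonneg[of f Q 0 r] f_zero by (intro SUP_upper2[of 0]) auto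
  have [measurable]: "P \<in> borel_measurable borel" unfolding P_def by measurable
  have eP: "e2ennreal (P r) = (SUP j. ennreal (conj_approx f Q j r))" for r
  proof -
    have "e2ennreal (P r) = (SUP j. e2ennreal (ereal (conj_approx f Q j r)))"
      unfolding P_def
      by (rule sup_continuousD[OF sup_continuous_e2ennreal[OF sup_continuous_id, unfolded id_def]])
        (auto intro!: incseq_SucI conj_approx_Suc)
    then show ?thesis by simp
  qed
  define h where "h k = nn_cond_exp M F (\<lambda>w. e2ennreal (P (g w / 4 ^ k)))" for k :: nat
  have [measurable]: "h k \<in> borel_measurable F" for k unfolding h_def by measurable
  have h_fin: "AE w in M. \<exists>k. h k w < \<infinity>"
    unfolding h_def eP by (rule conjugate_cond_exp_finite[OF Q0])
  define K where "K w = (LEAST k. h k w < \<infinity>)" for w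
  have [measurable]: "K \<in> measurable F (count_space UNIV)" unfolding K_def by measurable
  define \<eta> :: "'a \<Rightarrow> real" where "\<eta> w = (1/4) ^ K w" for w
  have \<eta>_F: "\<eta> \<in> borel_measurable F" unfolding \<eta>_def by measurable
  note [measurable] = measurable_from_subalg[OF subalg \<eta>_F]
  have "AE w in M. nn_cond_exp M F (\<lambda>w. e2ennreal (P (\<eta> w * g w))) w < \<infinity>"
  proof -
    define E where "E k = {w \<in> space F. K w = k}" for k
    have "AE w in M. w \<in> E k \<longrightarrow> nn_cond_exp M F (\<lambda>w. e2ennreal (P (\<eta> w * g w))) w \<le> h k w" for k
      unfolding h_def
    proof (rule nn_cond_exp_mono_on)
      show "E k \<in> sets F" unfolding E_def by measurable
      show "AE w in M. w \<in> E k \<longrightarrow> e2ennreal (P (\<eta> w * g w)) \<le> e2ennreal (P (g w / 4 ^ k))"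
        by (auto simp: E_def \<eta>_def power_one_over)
    qed auto
    then have "AE w in M. \<forall>k. w \<in> E k \<longrightarrow> nn_cond_exp M F (\<lambda>w. e2ennreal (P (\<eta> w * g w))) w \<le> h k w"
      by (simp add: AE_all_countable)
    with h_fin AE_space show ?thesis
    proof eventually_elim
      case (elim w)
      have "h (K w) w < \<infinity>" unfolding K_def using elim(1) by (rule LeastI_ex)
      moreover have "w \<in> E (K w)" using elim(2) subalg by (simp add: E_def subalgebra_def)
      ultimately show ?case using elim(3) by (blast intro: order.strict_trans1)
    qed
  qed
  then have "cond_exp_in_L0 M F (\<lambda>w. P (\<eta> w * g w))"
    by (subst cond_exp_in_L0_iff) (auto simp: P_nonneg)
  moreover have "(\<lambda>w. \<psi> (\<eta> w * \<bar>- g w\<bar>)) = (\<lambda>w. P (\<eta> w * g w))"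
    using g_nonneg by (auto simp: \<eta>_def intro!: psiP)
  ultimately have "cond_exp_in_L0 M F (\<lambda>w. \<psi> (\<eta> w * \<bar>- g w\<bar>))" by simp
  moreover have "\<eta> \<in> L0_pos F" using \<eta>_F by (auto simp: L0_pos_def L0_def \<eta>_def)
  ultimately show ?thesis
    unfolding cond_orlicz_space_def by (auto simp: L0_def intro!: bexI[of _ \<eta>])
qed

lemma ext_cond_exp_neg_g_mean: "AE w in M. ext_cond_exp M F (\<lambda>w. ereal (- g w)) w = -1"
proof -
  have one: "(\<lambda>_. 1) \<in> heart" by (rule heart_bounded[of _ 1]) auto
  from ext_cond_exp_neg_g[OF one] real_cond_exp_g show ?thesis
    by eventually_elim (simp add: one_ereal_def)
qed

end

section \<open>Passage from the given Young function to its real-valued continuation\<close>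

theorem theorem3p7:
  fixes M F :: "'a measure"
    and \<phi> \<psi> :: "real \<Rightarrow> ereal"
    and \<rho> :: "('a \<Rightarrow> real) \<Rightarrow> ('a \<Rightarrow> real)"
  assumes "prob_space M"
    and "subalgebra M F"
    and "young_conjugate_pair \<phi> \<psi>"
    and "\<forall>r\<ge>0. \<phi> r < \<infinity>"
    and "conditional_risk_measure M F (cond_orlicz_heart M F \<phi>) \<rho>"
  shows "lebesgue_property M (cond_orlicz_heart M F \<phi>) \<rho> \<and>
    (\<forall>x\<in>cond_orlicz_heart M F \<phi>. \<exists>y\<in>cond_orlicz_space M F \<psi>.
       (AE \<omega> in M. y \<omega> \<le> 0) \<and>
       (AE \<omega> in M. ext_cond_exp M F (\<lambda>w. ereal (y w)) \<omega> = -1) \<and>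
       (AE \<omega> in M. ereal (\<rho> x \<omega>) =
          ext_cond_exp M F (\<lambda>w. ereal (x w * y w)) \<omega>
          - fenchel_transform M F (cond_orlicz_heart M F \<phi>) \<rho> y \<omega>))"
proof -
  \<comment> \<open>The \<open>max 0 r\<close> continues \<open>\<phi>\<close> by its value 0 at the
    origin to negative arguments, where nothing is known about \<open>\<phi>\<close>; this makes
    \<open>f\<close> monotone on the whole line.\<close>
  define f where "f r = real_of_ereal (\<phi> (max 0 r))" for r
  have young: "young_function \<phi>" and psi: "\<And>r. 0 \<le> r \<Longrightarrow> \<psi> r = (SUP s\<in>{0..}. ereal (r * s) - \<phi> s)"
    using assms(3) by (auto simp: young_conjugate_pair_def)
  have phi_nonneg: "0 \<le> \<phi> r" if "0 \<le> r" for r using young that by (simp add: young_function_def)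
  have phi: "\<phi> r = ereal (f r)" if "0 \<le> r" for r
    using assms(4) that phi_nonneg[OF that] by (cases "\<phi> r") (auto simp: f_def max_def)
  have phi0: "\<phi> 0 = 0" using young by (simp add: young_function_def)
  interpret young_heart M F f
  proof (intro young_heart.intro young_heart_axioms.intro assms(1,2))
    show "f 0 = 0" by (simp add: f_def phi0)
    show "mono f"
    proof (rule monoI)
      fix r s :: real assume "r \<le> s"
      have "mono_on {0..} \<phi>" using young by (simp add: young_function_def)
      then have "\<phi> (max 0 r) \<le> \<phi> (max 0 s)" by (rule mono_onD) (use \<open>r \<le> s\<close> in auto)
      moreover have "\<phi> (max 0 r) = ereal (f r)" for r
        using phi[of "max 0 r"] unfolding f_def by simp
      ultimately show "f r \<le> f s" by simp
    qed
    show "f (c * r) \<le> c * f r" if c: "0 \<le> c" "c \<le> 1" and r: "0 \<le> r" for c r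
    proof -
      have "\<forall>r\<ge>0. \<forall>s\<ge>0. \<forall>t\<in>{0..1}. \<phi> (t * r + (1 - t) * s) \<le> ereal t * \<phi> r + ereal (1 - t) * \<phi> s"
        using young by (simp add: young_function_def)
      from this[rule_format, OF r order_refl, of c]
      have "\<phi> (c * r + (1 - c) * 0) \<le> ereal c * \<phi> r + ereal (1 - c) * \<phi> 0"
        using c by simp
      then show ?thesis using c r by (simp add: phi0 phi)
    qed
    show "filterlim f at_top at_top"
    proof -
      have "(\<phi> \<longlongrightarrow> \<infinity>) at_top" using young by (simp add: young_function_def)
      then have "((\<lambda>r. ereal (f r)) \<longlongrightarrow> \<infinity>) at_top"
        by (rule Lim_transform_eventually) (use phi in \<open>auto intro!: eventually_mono[OF eventually_ge_at_top[of 0]]\<close>)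
      then show ?thesis by (simp add: tendsto_PInfty_eq_at_top)
    qed
  qed
  have heart: "cond_orlicz_heart M F \<phi> = heart" by (rule cond_orlicz_heart_eq[OF phi])
  interpret conditional_risk M F f \<rho>
    by unfold_locales (use assms(5) in \<open>auto simp: conditional_risk_measure_def heart L0_def\<close>)
  show ?thesis
    unfolding heart
  proof (intro conjI ballI)
    show "lebesgue_property M heart \<rho>"
      unfolding lebesgue_property_def
    proof (intro allI impI, elim conjE)
      fix xs x y
      assume *: "\<forall>n. xs n \<in> heart" "x \<in> heart" "y \<in> heart"
        "AE \<omega> in M. (\<lambda>n. xs n \<omega>) \<longlonglongrightarrow> x \<omega>" "\<forall>n. AE \<omega> in M. \<bar>xs n \<omega>\<bar> \<le> y \<omega>"
      show "AE \<omega> in M. (\<lambda>n. \<rho> (xs n) \<omega>) \<longlonglongrightarrow> \<rho> x \<omega>"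
        by (rule rho_lebesgue[OF *(1)[rule_format] *(2-4) *(5)[rule_format]])
    qed
    fix x assume x: "x \<in> heart"
    obtain g where g: "g \<in> borel_measurable M" "\<And>w. 0 \<le> g w" "integrable M g"
      "\<And>u. u \<in> bfun \<Longrightarrow> - (\<integral>w. u w * g w \<partial>M) \<le> (\<integral>w. increment x u w \<partial>M)"
      using subgradient_density[OF x] by blast
    interpret risk_subgradient M F f \<rho> x g
      by unfold_locales (use x g in auto)
    show "\<exists>y\<in>cond_orlicz_space M F \<psi>. (AE \<omega> in M. y \<omega> \<le> 0) \<and>
       (AE \<omega> in M. ext_cond_exp M F (\<lambda>w. ereal (y w)) \<omega> = -1) \<and>
       (AE \<omega> in M. ereal (\<rho> x \<omega>) =
          ext_cond_exp M F (\<lambda>w. ereal (x w * y w)) \<omega> - fenchel_transform M F heart \<rho> y \<omega>)"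
    proof (intro bexI conjI)
      have "\<psi> r = (SUP s\<in>{0..}. ereal (r * s) - ereal (f s))" if "0 \<le> r" for r
        unfolding psi[OF that] by (intro SUP_cong) (auto simp: phi)
      then show "(\<lambda>w. - g w) \<in> cond_orlicz_space M F \<psi>" by (rule neg_g_cond_orlicz_space)
      show "AE \<omega> in M. - g \<omega> \<le> 0" by (simp add: g_nonneg)
      show "AE \<omega> in M. ext_cond_exp M F (\<lambda>w. ereal (- g w)) \<omega> = -1" by (rule ext_cond_exp_neg_g_mean)
      show "AE \<omega> in M. ereal (\<rho> x \<omega>) =
          ext_cond_exp M F (\<lambda>w. ereal (x w * - g w)) \<omega> - fenchel_transform M F heart \<rho> (\<lambda>w. - g w) \<omega>"
        using ext_cond_exp_neg_g[OF x] fenchel_transform_neg_g by eventually_elim simp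
    qed
  qed
qed

end
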